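(* Let $\Omega$ be a parameter manifold of dimension $d\in\{1,2,3\}$ with a mesh, and let $\mathcal{B}=\{B_{\mathbf{A}} : \mathbf{A}\in\mathcal{A}\}$ be the set of functions on $\Omega$ generating a B-spline manifold space, all standing assumptions listed in the context being satisfied. If $\mathcal{B}$ is dual-compatible, then there exists a set of linear functionals $$\mathcal{B}^*=\{\Lambda_{\mathbf{A}} : L^2(\Omega)\to\mathbb{R},\ \mathbf{A}\in\mathcal{A}\}$$ that is dual to $\mathcal{B}$, i.e. $$\Lambda_{\mathbf{A}}(B_{\mathbf{A}'})=\delta_{\mathbf{A}\mathbf{A}'}\qquad\text{for all }\mathbf{A},\mathbf{A}'\in\mathcal{A}.$$
   Context: **Proto-manifold.** A proto-manifold of dimension $d$ consists of: a finite set $\{\omega_i\}_{i=1}^N$ of charts, which are open polytopes $\omega_i\subset\mathbb{R}^d$; open transition domains $\omega_{i,j}\subset\omega_i$ (possibly empty) with $\omega_{i,i}=\omega_i$; homeomorphisms (transition functions) $\psi_{i,j}:\omega_{i,j}\to\omega_{j,i}$ with the cocycle condition $\psi_{j,k}\circ\psi_{i,j}=\psi_{i,k}$ on $\omega_{i,j}\cap\omega_{i,k}$ for all $i,j,k$; and such that for all $i\ne j$, $\boldsymbol\zeta_i\in\partial\omega_{i,j}\cap\omega_i$, $\boldsymbol\zeta_j\in\partial\omega_{j,i}\cap\omega_j$ there are open balls $V_{\boldsymbol\zeta_i},V_{\boldsymbol\zeta_j}$ centered at these points such that no point of $V_{\boldsymbol\zeta_j}\cap\omega_{j,i}$ is the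 image under $\psi_{i,j}$ of a point of $V_{\boldsymbol\zeta_i}\cap\omega_{i,j}$. **Parameter manifold.** $\Omega=(\bigsqcup_i\omega_i)/\sim$, where $[\boldsymbol\zeta_i,i]\sim[\boldsymbol\zeta_j,j]$ iff $\psi_{i,j}(\boldsymbol\zeta_i)=\boldsymbol\zeta_j$. $\pi_i:\omega_i\to\Omega$ maps a point to its equivalence class; $\Omega_i=\pi_i(\omega_i)$. $\Omega$ is without boundary, and a metric on $\Omega$ is assumed given so that the usual Lebesgue space $L^2(\Omega)$ is defined. **Mesh.** A proto-mesh is a family $\{\tau_i\}$, where $\tau_i$ is a finite mesh of $\omega_i$ into disjoint open elements $q$ (intervals, quadrilaterals, hexahedra for $d=1,2,3$) whose closures have union $\overline{\omega_i}$; each $\omega_{i,j}$ is the interior of the union of the closures of some elements of $\tau_i$; and $\psi_{i,j}(q)\in\tau_j$ for each $q\in\tau_i$, $q\subset\omega_{i,j}$. The mesh on $\Omega$ is $\mathcal{T}=\{\pi_i(q): q\in\tau_i, i=1,\dots,N\}$. Each $\psi_{i,j}$ is $d$-linear on each element. **Charts.** A box mesh of a $d$-box is a partition of it into finitely many axis-parallel $d$-boxes (hanging nodes allowed). Every chart is of one of the following types. *Structured chart:* (A) $\omega_i=\prod_{\ell=1}^d\,]a_{i,\ell},b_{i,\ell}[$ and $\tau_i$ is a box mesh; (B) each $\omega_{i,j}$ is a $d$-box or a union of $d$-boxes with disjoint closures; (C) if $\omega_j$ is also structured, $\psi_{i,j}$ is affine on each connected component of $\omega_{i,j}$. *Unstructured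 vertex chart, $d=2$,* with extraordinary vertex $\boldsymbol\xi_i$ of valence $k_i\neq4$: (A) $\omega_i$ is formed by a ring of $k_i$ conforming quadrilateral segments $s_{i,1},\dots,s_{i,k_i}$ around the common vertex $\boldsymbol\xi_i$; each segment has a mesh $\sigma_{i,\ell}$ topologically equivalent to a box mesh, and $\tau_i=\bigcup_\ell\sigma_{i,\ell}$; (B) the union of the $\omega_{i,j}$ over structured $\omega_j$ is $\omega_i\setminus\{\boldsymbol\xi_i\}$, and these transition domains are given by unions of segments; (C) $\omega_{i,j}=\emptyset$ for every unstructured $\omega_j$, $j\ne i$. *Unstructured edge chart, $d=3$,* of valence $k_i\ne4$: (A) $\omega_i=\hat\omega_i\times\,]a_{i,3},b_{i,3}[$, where $\hat\omega_i$ is a two-dimensional unstructured vertex chart with extraordinary point $\hat{\boldsymbol\xi}_i$ of valence $k_i$ and segments $\hat s_{i,\ell}$; each segment $s_{i,\ell}=\hat s_{i,\ell}\times\,]a_{i,3},b_{i,3}[$ has a mesh $\sigma_{i,\ell}$ equivalent to a three-dimensional box mesh, and $\tau_i=\bigcup_\ell\sigma_{i,\ell}$; (B) the union of the $\omega_{i,j}$ over structured $\omega_j$ is $\omega_i$ minus the extraordinary line $\{\hat{\boldsymbol\xi}_i\}\times\,]a_{i,3},b_{i,3}[$, and these transition domains are products of a union of two-dimensional segments with an interval; (C) for structured $\omega_j$, $\psi_{i,j}$ is linear in the third coordinate $\zeta_3$; (D) if $\omega_j$, $j\neq i$, is an unstructured edge chart and $\omega_{i,j}\ne\emptyset$, there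 is a structured chart $\omega_k$ with $\omega_{i,j}\subseteq\omega_{i,k}$. *Unstructured vertex chart, $d=3$,* with extraordinary vertex $\boldsymbol\xi_i$ of valence $k_i$: (A) $\omega_i$ is formed by $k_i$ conforming hexahedral segments $s_{i,\ell}$ around the common vertex $\boldsymbol\xi_i$, each with a mesh $\sigma_{i,\ell}$ topologically equivalent to a box mesh, $\tau_i=\bigcup_\ell\sigma_{i,\ell}$; (B) the union of the $\omega_{i,j}$ over unstructured edge charts $\omega_j$ is $\omega_i\setminus\{\boldsymbol\xi_i\}$, and these transition domains are unions of segments; (C) $\omega_{i,j}=\emptyset$ for every other unstructured vertex chart $\omega_j$. **Spline manifold space.** For each $i$ a finite linearly independent set of proto-basis functions $b_{\mathbf{A}_i}:\omega_i\to\mathbb{R}$, $\mathbf{A}_i\in\mathcal{A}_i$, is given, which are polynomial on each $q\in\tau_i$ and satisfy $b_{\mathbf{A}_i}(\boldsymbol\zeta)\to0$ as $\boldsymbol\zeta\to\partial\omega_i$. Define $B_{\mathbf{A}_i}:\Omega\to\mathbb{R}$ by $B_{\mathbf{A}_i}=b_{\mathbf{A}_i}\circ\pi_i^{-1}$ on $\Omega_i$ and $0$ elsewhere. The global index set is $\mathcal{A}=(\bigsqcup_i\mathcal{A}_i)/\approx$, where $[\mathbf{A}_i,i]\approx[\mathbf{A}_j,j]$ iff $B_{\mathbf{A}_i}=B_{\mathbf{A}_j}$; thus $B_{\mathbf{A}}$ is well defined for $\mathbf{A}\in\mathcal{A}$, and $\mathcal{B}=\{B_{\mathbf{A}}:\mathbf{A}\in\mathcal{A}\}$.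 One writes $\mathbf{A}\in\mathcal{A}_i$ for $\mathbf{A}\in\mathcal{A}$ if $\mathbf{A}$ is the class of some element of $\mathcal{A}_i$. Let $\tilde{\mathcal{A}}_i=\{\mathbf{A}\in\mathcal{A}:\operatorname{supp}B_{\mathbf{A}}\cap\operatorname{supp}B_{\mathbf{A}_i}\neq\emptyset\text{ for some }\mathbf{A}_i\in\mathcal{A}_i\}$. Supports are understood as open sets (interior of the closed support). Set $\mathcal{A}_s=\bigcup_{\omega_i\text{ structured}}\mathcal{A}_i$, $\mathcal{A}_e=\big(\bigcup_{\omega_i\text{ unstr. edge}}\mathcal{A}_i\big)\setminus\mathcal{A}_s$, $\mathcal{A}_v=\big(\bigcup_{\omega_i\text{ unstr. vertex}}\mathcal{A}_i\big)\setminus(\mathcal{A}_s\cup\mathcal{A}_e)$. **B-spline assumptions.** (i) If $\operatorname{supp}B_{\mathbf{A}}\subseteq\Omega_i$, then $\mathbf{A}\in\mathcal{A}_i$. If $\omega_i$ is structured, $\bigcup_{\mathbf{A}_i\in\mathcal{A}_i}\operatorname{supp}B_{\mathbf{A}_i}=\Omega_i$. If the support of $B_{\mathbf{A}}$ is structured (covered by a structured mesh, possibly with hanging nodes), some structured chart covers it. (ii) For a fixed degree $p$: if $\omega_i$ is structured, then for every $\mathbf{A}\in\tilde{\mathcal{A}}_i$ there are local knot vectors $\Xi_{\mathbf{A},i,1},\dots,\Xi_{\mathbf{A},i,d}$ with $B_{\mathbf{A}}\circ\pi_i(\boldsymbol\zeta)=b[\Xi_{\mathbf{A},i,1}](\zeta_1)\cdots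 b[\Xi_{\mathbf{A},i,d}](\zeta_d)$ for all $\boldsymbol\zeta\in\omega_i$, where $b[\Xi]$ is the univariate degree-$p$ B-spline with local knot vector $\Xi$ (nondecreasing, $p+2$ entries). (iii) If $\omega_i$ is an unstructured edge chart, then for every $\mathbf{A}\in\tilde{\mathcal{A}}_i$ there are a bivariate function $\beta_{\mathbf{A},i}$ and a local knot vector $\Xi_{\mathbf{A},i,3}$ with $B_{\mathbf{A}}\circ\pi_i(\boldsymbol\zeta)=\beta_{\mathbf{A},i}(\zeta_1,\zeta_2)\,b[\Xi_{\mathbf{A},i,3}](\zeta_3)$ for all $\boldsymbol\zeta\in\omega_i$. **Assumption on proto-dual functionals.** A proto-dual basis is a family of functionals $\hat\lambda_{\mathbf{A}_i}:L^2(\omega_i)\to\mathbb{R}$, $\mathbf{A}_i\in\mathcal{A}_i$, $i=1,\dots,N$, with $\hat\lambda_{\mathbf{A}_i}(b_{\mathbf{A}'_i})=\delta_{\mathbf{A}_i\mathbf{A}'_i}$ for $\mathbf{A}_i,\mathbf{A}_i'\in\mathcal{A}_i$. The proto-dual functionals are assumed to satisfy: $[\mathbf{A}_i,i]\approx[\mathbf{A}_j,j]$ implies $\hat\lambda_{\mathbf{A}_i}(\phi\circ\pi_i)=\hat\lambda_{\mathbf{A}_j}(\phi\circ\pi_j)$ for all $\phi\in L^2(\Omega)$. **Overlap.** Knot vectors $\Xi'=\{\xi'_1,\dots,\xi'_{p+2}\}$ and $\Xi''=\{\xi''_1,\dots,\xi''_{p+2}\}$ overlap if there are a knot vector $\Xi=\{\xi_1,\dots,\xi_k\}$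 and integers $k',k''$ with $\xi'_m=\xi_{m+k'}$ and $\xi''_m=\xi_{m+k''}$ for $m=1,\dots,p+2$. **Dual-compatibility.** $\mathcal{B}$ is dual-compatible if: 1. for every structured chart $\omega_i$, all $\mathbf{A}\in\mathcal{A}_i$ and all $\mathbf{A}'\in\tilde{\mathcal{A}}_i$ with $\mathbf{A}'\neq\mathbf{A}$, there is $l\in\{1,\dots,d\}$ such that $\Xi_{\mathbf{A},i,l}$ and $\Xi_{\mathbf{A}',i,l}$ are different and overlap; 2. for every unstructured edge chart $\omega_i$, all $\mathbf{A}\in\mathcal{A}_i\cap\mathcal{A}_e$ and all $\mathbf{A}'\in\mathcal{A}_i$ with $\mathbf{A}'\ne\mathbf{A}$, either $\Xi_{\mathbf{A},i,3}$ and $\Xi_{\mathbf{A}',i,3}$ overlap and are different, or $\beta_{\mathbf{A},i}\neq\beta_{\mathbf{A}',i}$; 3. for every unstructured edge chart $\omega_i$, all $\mathbf{A}\in\mathcal{A}_i\cap\mathcal{A}_e$ and all $\mathbf{A}'\in(\tilde{\mathcal{A}}_i\setminus\mathcal{A}_i)\cap(\mathcal{A}_e\cup\mathcal{A}_v)$, $\Xi_{\mathbf{A},i,3}$ and $\Xi_{\mathbf{A}',i,3}$ overlap and are different. *)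

theory Defs
  imports "HOL-Analysis.Analysis"
begin

section \<open>Polytopes, elements and meshes in R^d\<close>

text \<open>Polytopes need not be convex, since vertex charts are in general only star-shaped.\<close>

definition open_polytope :: "(real^'d) set \<Rightarrow> bool" where
  "open_polytope W \<longleftrightarrow> (\<exists>P. finite P \<and> (\<forall>C\<in>P. polytope C) \<and> W = interior (\<Union>P))"

definition open_box :: "(real^'d) set \<Rightarrow> bool" where
  "open_box R \<longleftrightarrow> R \<noteq> {} \<and> (\<exists>a b. R = box a b)"

text \<open>A map is d-linear if it is affine in each coordinate separately.\<close>

definition d_linear :: "(real^'d \<Rightarrow> real^'d) \<Rightarrow> bool" where
  "d_linear F \<longleftrightarrow>
     (\<forall>x l t. F (x + t *\<^sub>R axis l 1) = (1 - t) *\<^sub>R F x + t *\<^sub>R F (x + axis l 1))"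

text \<open>An element (interval, quadrilateral, hexahedron) is a one-to-one d-linear image of the
  open unit cube; hexahedra may have bilinear faces.\<close>

definition parametrizes :: "(real^'d \<Rightarrow> real^'d) \<Rightarrow> (real^'d) set \<Rightarrow> bool" where
  "parametrizes F q \<longleftrightarrow> d_linear F \<and> inj_on F (cbox 0 1) \<and> q = F ` box 0 1"

definition element :: "(real^'d) set \<Rightarrow> bool" where
  "element q \<longleftrightarrow> (\<exists>F. parametrizes F q)"

text \<open>d-linearity of a map on a general element is isoparametric: it is a d-linear
  parametrization of the image element after the inverse of one of the given element. This notion
  is invariant under inversion; on a box it is plain d-linearity.\<close>

definition d_linear_on_element :: "(real^'d \<Rightarrow> real^'d) \<Rightarrow> (real^'d) set \<Rightarrow> bool" where
  "d_linear_on_element \<psi> q \<longleftrightarrow>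
     (\<exists>F G. parametrizes F q \<and> parametrizes G (\<psi> ` q) \<and> (\<forall>x\<in>box 0 1. \<psi> (F x) = G x))"

definition mesh_of :: "(real^'d) set \<Rightarrow> (real^'d) set set \<Rightarrow> bool" where
  "mesh_of W T \<longleftrightarrow> finite T \<and> (\<forall>q\<in>T. element q) \<and> pairwise disjnt T \<and>
     (\<Union>q\<in>T. closure q) = closure W"

definition box_mesh :: "(real^'d) set \<Rightarrow> (real^'d) set set \<Rightarrow> bool" where
  "box_mesh R T \<longleftrightarrow> open_box R \<and> finite T \<and> (\<forall>q\<in>T. open_box q) \<and> pairwise disjnt T \<and>
     (\<Union>q\<in>T. closure q) = closure R"

definition equiv_to_box_mesh :: "(real^'d) set \<Rightarrow> (real^'d) set set \<Rightarrow> bool" where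
  "equiv_to_box_mesh s \<sigma> \<longleftrightarrow>
     (\<exists>(R :: (real^'d) set) T h g. box_mesh R T \<and> homeomorphism (closure R) (closure s) h g \<and>
                \<sigma> = (\<lambda>q. h ` q) ` T)"

text \<open>The union of a set of open cells together with the faces between them.\<close>

definition merge :: "(real^'d) set set \<Rightarrow> (real^'d) set" where
  "merge C = interior (\<Union>q\<in>C. closure q)"

text \<open>Conforming segments around a common vertex: any two closed segments meet in a common face.
  As the vertex is an interior point of the union, in two dimensions the segments form a
  ring.\<close>

definition segments_around ::
    "(real^'d) set \<Rightarrow> real^'d \<Rightarrow> nat \<Rightarrow> (nat \<Rightarrow> (real^'d) set) \<Rightarrow> bool" where
  "segments_around W \<xi> k s \<longleftrightarrow>
     \<xi> \<in> W \<and> W = merge (s ` {..<k}) \<and> (\<forall>l<k. \<forall>m<k. l \<noteq> m \<longrightarrow> s l \<inter> s m = {}) \<and>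
     (\<exists>F. (\<forall>l<k. parametrizes (F l) (s l) \<and> F l 0 = \<xi>) \<and>
          (\<forall>l<k. \<forall>m<k. l \<noteq> m \<longrightarrow>
             (\<exists>f g. f face_of cbox 0 1 \<and> g face_of cbox 0 1 \<and>
                    closure (s l) \<inter> closure (s m) = F l ` f \<and>
                    closure (s l) \<inter> closure (s m) = F m ` g)))"


section \<open>Proto-manifolds and parameter manifolds\<close>

text \<open>Charts are numbered from 0. The chart with number i is \<open>chart M i\<close>, the transition domain
  inside it is \<open>tdom M i j\<close>, and the transition function from there is \<open>transition M i j\<close>.\<close>

record ('d::finite) proto_manifold =
  num_charts :: nat
  chart :: "nat \<Rightarrow> (real^'d) set"
  tdom :: "nat \<Rightarrow> nat \<Rightarrow> (real^'d) set"
  transition :: "nat \<Rightarrow> nat \<Rightarrow> real^'d \<Rightarrow> real^'d"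

text \<open>The cocycle condition includes that the composition is defined on the stated set.\<close>

definition is_proto_manifold :: "('d::finite, 'z) proto_manifold_scheme \<Rightarrow> bool" where
  "is_proto_manifold M \<longleftrightarrow>
     (\<forall>i<num_charts M. open_polytope (chart M i) \<and> tdom M i i = chart M i) \<and>
     (\<forall>i<num_charts M. \<forall>j<num_charts M.
        open (tdom M i j) \<and> tdom M i j \<subseteq> chart M i \<and>
        (\<exists>\<phi>. homeomorphism (tdom M i j) (tdom M j i) (transition M i j) \<phi>)) \<and>
     (\<forall>i<num_charts M. \<forall>j<num_charts M. \<forall>k<num_charts M. \<forall>x\<in>tdom M i j \<inter> tdom M i k.
        transition M i j x \<in> tdom M j k \<and>
        transition M j k (transition M i j x) = transition M i k x) \<and>
     (\<forall>i<num_charts M. \<forall>j<num_charts M. i \<noteq> j \<longrightarrow>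
        (\<forall>x \<in> frontier (tdom M i j) \<inter> chart M i. \<forall>y \<in> frontier (tdom M j i) \<inter> chart M j.
           \<exists>r>0. \<exists>s>0. \<forall>z \<in> ball x r \<inter> tdom M i j.
              transition M i j z \<notin> ball y s \<inter> tdom M j i))"

definition glue :: "('d::finite, 'z) proto_manifold_scheme \<Rightarrow>
    ((nat \<times> (real^'d)) \<times> (nat \<times> (real^'d))) set" where
  "glue M = {((i, x), (j, y)). i < num_charts M \<and> j < num_charts M \<and>
               x \<in> tdom M i j \<and> y \<in> tdom M j i \<and> transition M i j x = y}"

definition Omega :: "('d::finite, 'z) proto_manifold_scheme \<Rightarrow> (nat \<times> (real^'d)) set set" where
  "Omega M = (SIGMA i:{..<num_charts M}. chart M i) // glue M"

definition proj :: "('d::finite, 'z) proto_manifold_scheme \<Rightarrow> nat \<Rightarrow> real^'d \<Rightarrow>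
    (nat \<times> (real^'d)) set" where
  "proj M i x = glue M `` {(i, x)}"

definition Omega_chart :: "('d::finite, 'z) proto_manifold_scheme \<Rightarrow> nat \<Rightarrow>
    (nat \<times> (real^'d)) set set" where
  "Omega_chart M i = proj M i ` chart M i"

text \<open>The quotient topology.\<close>

definition Omega_top :: "('d::finite, 'z) proto_manifold_scheme \<Rightarrow>
    (nat \<times> (real^'d)) set topology" where
  "Omega_top M = topology (\<lambda>U. U \<subseteq> Omega M \<and>
     (\<forall>i<num_charts M. open {x \<in> chart M i. proj M i x \<in> U}))"

text \<open>Supports are open.\<close>

definition supp :: "('d::finite, 'z) proto_manifold_scheme \<Rightarrow>
    ((nat \<times> (real^'d)) set \<Rightarrow> real) \<Rightarrow> (nat \<times> (real^'d)) set set" where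
  "supp M f = Omega_top M interior_of (Omega_top M closure_of {P \<in> Omega M. f P \<noteq> 0})"


section \<open>Riemannian metric and volume\<close>

record ('d::finite) riemannian_manifold = "'d proto_manifold" +
  metric :: "nat \<Rightarrow> real^'d \<Rightarrow> real^'d^'d"
  volume :: "(nat \<times> (real^'d)) set measure"


section \<open>Meshes and chart types\<close>

datatype chart_kind = Structured | Edge | Vertex

text \<open>The types of the charts are data because their defining conditions refer to the types of
  the other charts. \<open>coord M 1, \<dots>, coord M d\<close> enumerates the coordinate directions.\<close>

record ('d::finite) meshed_manifold = "'d riemannian_manifold" +
  mesh :: "nat \<Rightarrow> (real^'d) set set"
  kind :: "nat \<Rightarrow> chart_kind"
  coord :: "nat \<Rightarrow> 'd"

definition is_proto_mesh :: "('d::finite, 'z) meshed_manifold_scheme \<Rightarrow> bool" where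
  "is_proto_mesh M \<longleftrightarrow>
     (\<forall>i<num_charts M. mesh_of (chart M i) (mesh M i)) \<and>
     (\<forall>i<num_charts M. \<forall>j<num_charts M.
        (\<exists>T. T \<subseteq> mesh M i \<and> tdom M i j = merge T) \<and>
        (\<forall>q\<in>mesh M i. q \<subseteq> tdom M i j \<longrightarrow>
           transition M i j ` q \<in> mesh M j \<and> d_linear_on_element (transition M i j) q))"

text \<open>The metric is uniformly equivalent to the Euclidean metric on each chart. The volume is the
  measure with density \<open>sqrt (det (metric M i))\<close> in the chart i, on the sets that are Lebesgue
  measurable in every chart.\<close>

definition is_metric :: "('d::finite, 'z) meshed_manifold_scheme \<Rightarrow> bool" where
  "is_metric M \<longleftrightarrow>
     (\<forall>i<num_charts M.
        metric M i \<in> borel_measurable (lebesgue_on (chart M i)) \<and>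
        (\<forall>x\<in>chart M i. transpose (metric M i x) = metric M i x) \<and>
        (\<exists>c>0. \<exists>C. \<forall>x\<in>chart M i. \<forall>v.
           c * (v \<bullet> v) \<le> v \<bullet> (metric M i x *v v) \<and> v \<bullet> (metric M i x *v v) \<le> C * (v \<bullet> v))) \<and>
     (\<forall>i<num_charts M. \<forall>j<num_charts M. \<forall>q\<in>mesh M i. q \<subseteq> tdom M i j \<longrightarrow>
        (\<forall>x\<in>q. \<forall>D. (transition M i j has_derivative D) (at x) \<longrightarrow>
           (\<forall>v w. v \<bullet> (metric M i x *v w) = D v \<bullet> (metric M j (transition M i j x) *v D w))))"

definition is_volume :: "('d::finite, 'z) riemannian_manifold_scheme \<Rightarrow> bool" where
  "is_volume M \<longleftrightarrow>
     space (volume M) = Omega M \<and>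
     sets (volume M) = {U. U \<subseteq> Omega M \<and>
        (\<forall>i<num_charts M. {x \<in> chart M i. proj M i x \<in> U} \<in> sets lebesgue)} \<and>
     (\<forall>i<num_charts M. \<forall>E\<in>sets lebesgue. E \<subseteq> chart M i \<longrightarrow>
        emeasure (volume M) (proj M i ` E) =
          (\<integral>\<^sup>+ x\<in>E. ennreal (sqrt (det (metric M i x))) \<partial>lebesgue))"

definition charts_of :: "('d::finite, 'z) meshed_manifold_scheme \<Rightarrow> chart_kind \<Rightarrow> nat set" where
  "charts_of M c = {i. i < num_charts M \<and> kind M i = c}"

definition structured_chart :: "('d::finite, 'z) meshed_manifold_scheme \<Rightarrow> nat \<Rightarrow> bool" where
  "structured_chart M i \<longleftrightarrow>
     box_mesh (chart M i) (mesh M i) \<and>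
     (\<forall>j<num_charts M. \<exists>C. finite C \<and> (\<forall>R\<in>C. open_box R) \<and>
        pairwise (\<lambda>R R'. closure R \<inter> closure R' = {}) C \<and> tdom M i j = \<Union>C) \<and>
     (\<forall>j\<in>charts_of M Structured. \<forall>C\<in>components (tdom M i j).
        \<exists>L c. linear L \<and> (\<forall>x\<in>C. transition M i j x = L x + c))"

definition vertex_chart_2d :: "('d::finite, 'z) meshed_manifold_scheme \<Rightarrow> nat \<Rightarrow> bool" where
  "vertex_chart_2d M i \<longleftrightarrow> (\<exists>k \<xi> s \<sigma>.
     k \<noteq> 4 \<and> segments_around (chart M i) \<xi> k s \<and>
     (\<forall>l<k. equiv_to_box_mesh (s l) (\<sigma> l)) \<and> mesh M i = (\<Union>l<k. \<sigma> l) \<and>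
     (\<Union>j\<in>charts_of M Structured. tdom M i j) = chart M i - {\<xi>} \<and>
     (\<forall>j\<in>charts_of M Structured. \<exists>L\<subseteq>{..<k}. tdom M i j = merge (s ` L)) \<and>
     (\<forall>j<num_charts M. j \<noteq> i \<longrightarrow> kind M j \<noteq> Structured \<longrightarrow> tdom M i j = {}))"

definition planar :: "('d::finite, 'z) meshed_manifold_scheme \<Rightarrow> real^'d \<Rightarrow> real^2" where
  "planar M x = vector [x $ coord M 1, x $ coord M 2]"

definition cylinder :: "('d::finite, 'z) meshed_manifold_scheme \<Rightarrow> (real^2) set \<Rightarrow> real set \<Rightarrow>
    (real^'d) set" where
  "cylinder M W I = {x. planar M x \<in> W \<and> x $ coord M 3 \<in> I}"

definition edge_chart_3d :: "('d::finite, 'z) meshed_manifold_scheme \<Rightarrow> nat \<Rightarrow> bool" where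
  "edge_chart_3d M i \<longleftrightarrow> (\<exists>k \<xi> s \<sigma> W a b.
     k \<noteq> 4 \<and> a < b \<and> segments_around W \<xi> k s \<and> chart M i = cylinder M W {a<..<b} \<and>
     (\<forall>l<k. equiv_to_box_mesh (cylinder M (s l) {a<..<b}) (\<sigma> l)) \<and> mesh M i = (\<Union>l<k. \<sigma> l) \<and>
     (\<Union>j\<in>charts_of M Structured. tdom M i j) = chart M i - cylinder M {\<xi>} {a<..<b} \<and>
     (\<forall>j\<in>charts_of M Structured.
        (\<exists>L\<subseteq>{..<k}. \<exists>a' b'. tdom M i j = cylinder M (merge (s ` L)) {a'<..<b'}) \<and>
        (\<forall>z. \<exists>u v. \<forall>x\<in>tdom M i j. planar M x = z \<longrightarrow>
           transition M i j x = u + (x $ coord M 3) *\<^sub>R v)) \<and>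
     (\<forall>j\<in>charts_of M Edge. j \<noteq> i \<longrightarrow> tdom M i j \<noteq> {} \<longrightarrow>
        (\<exists>m\<in>charts_of M Structured. tdom M i j \<subseteq> tdom M i m)))"

definition vertex_chart_3d :: "('d::finite, 'z) meshed_manifold_scheme \<Rightarrow> nat \<Rightarrow> bool" where
  "vertex_chart_3d M i \<longleftrightarrow> (\<exists>k \<xi> s \<sigma>.
     segments_around (chart M i) \<xi> k s \<and>
     (\<forall>l<k. equiv_to_box_mesh (s l) (\<sigma> l)) \<and> mesh M i = (\<Union>l<k. \<sigma> l) \<and>
     (\<Union>j\<in>charts_of M Edge. tdom M i j) = chart M i - {\<xi>} \<and>
     (\<forall>j\<in>charts_of M Edge. \<exists>L\<subseteq>{..<k}. tdom M i j = merge (s ` L)) \<and>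
     (\<forall>j\<in>charts_of M Vertex. j \<noteq> i \<longrightarrow> tdom M i j = {}))"

definition admissible_charts :: "('d::finite, 'z) meshed_manifold_scheme \<Rightarrow> bool" where
  "admissible_charts M \<longleftrightarrow>
     bij_betw (coord M) {1..CARD('d)} UNIV \<and>
     (\<forall>i\<in>charts_of M Structured. structured_chart M i) \<and>
     (\<forall>i\<in>charts_of M Edge. CARD('d) = 3 \<and> edge_chart_3d M i) \<and>
     (\<forall>i\<in>charts_of M Vertex. CARD('d) = 2 \<and> vertex_chart_2d M i \<or>
                              CARD('d) = 3 \<and> vertex_chart_3d M i)"

text \<open>A region is structured if it lies in an embedded box whose box mesh is mapped d-linearly,
  element by element, to mesh elements of \<open>Omega M\<close>. Merely topological equivalence would not do:
  an extraordinary vertex of valence 3 is homeomorphic to a T-junction.\<close>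

definition structured_region :: "('d::finite, 'z) meshed_manifold_scheme \<Rightarrow>
    (nat \<times> (real^'d)) set set \<Rightarrow> bool" where
  "structured_region M S \<longleftrightarrow> (\<exists>(R :: (real^'d) set) T h.
     box_mesh R T \<and> embedding_map (top_of_set R) (Omega_top M) h \<and> S \<subseteq> h ` R \<and>
     (\<forall>q\<in>T. \<exists>i<num_charts M. \<exists>F. d_linear F \<and> inj_on F (closure q) \<and> F ` q \<in> mesh M i \<and>
        (\<forall>x\<in>q. h x = proj M i (F x))))"


section \<open>B-splines\<close>

text \<open>The Cox-de Boor recursion for the B-spline of degree p on a local knot vector of p + 2
  entries. Quotients with zero denominator are 0.\<close>

primrec bspline :: "nat \<Rightarrow> real list \<Rightarrow> real \<Rightarrow> real" where
  "bspline 0 \<Xi> x = (if \<Xi> ! 0 \<le> x \<and> x < \<Xi> ! 1 then 1 else 0)"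
| "bspline (Suc p) \<Xi> x =
     (x - \<Xi> ! 0) / (\<Xi> ! (p + 1) - \<Xi> ! 0) * bspline p (butlast \<Xi>) x +
     (\<Xi> ! (p + 2) - x) / (\<Xi> ! (p + 2) - \<Xi> ! 1) * bspline p (tl \<Xi>) x"

definition local_knots :: "nat \<Rightarrow> real list \<Rightarrow> bool" where
  "local_knots p \<Xi> \<longleftrightarrow> length \<Xi> = p + 2 \<and> sorted \<Xi>"

definition overlap :: "nat \<Rightarrow> real list \<Rightarrow> real list \<Rightarrow> bool" where
  "overlap p \<Xi>' \<Xi>'' \<longleftrightarrow> (\<exists>\<Xi> k' k''. sorted \<Xi> \<and>
     k' + (p + 2) \<le> length \<Xi> \<and> k'' + (p + 2) \<le> length \<Xi> \<and>
     (\<forall>m<p + 2. \<Xi>' ! m = \<Xi> ! (m + k') \<and> \<Xi>'' ! m = \<Xi> ! (m + k'')))"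


section \<open>Spline manifold spaces\<close>

text \<open>The global indices, i.e. the elements of \<open>indices S\<close> below, are equivalence classes of
  proto-indices and have the type \<open>(nat \<times> 'a) set\<close>.\<close>

record ('d::finite, 'a) spline_manifold = "'d meshed_manifold" +
  proto_indices :: "nat \<Rightarrow> 'a set"
  proto_basis :: "nat \<Rightarrow> 'a \<Rightarrow> real^'d \<Rightarrow> real"
  spline_degree :: nat
  knots :: "(nat \<times> 'a) set \<Rightarrow> nat \<Rightarrow> 'd \<Rightarrow> real list"
  planar_factor :: "(nat \<times> 'a) set \<Rightarrow> nat \<Rightarrow> real^2 \<Rightarrow> real"

definition is_proto_basis :: "('d::finite, 'a, 'z) spline_manifold_scheme \<Rightarrow> bool" where
  "is_proto_basis S \<longleftrightarrow> (\<forall>i<num_charts S.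
     finite (proto_indices S i) \<and>
     (\<forall>c. (\<forall>x\<in>chart S i. (\<Sum>a\<in>proto_indices S i. c a * proto_basis S i a x) = 0) \<longrightarrow>
          (\<forall>a\<in>proto_indices S i. c a = 0)) \<and>
     (\<forall>a\<in>proto_indices S i.
        (\<forall>q\<in>mesh S i. \<exists>f. real_polynomial_function f \<and> (\<forall>x\<in>q. proto_basis S i a x = f x)) \<and>
        (\<forall>y\<in>frontier (chart S i). (proto_basis S i a \<longlongrightarrow> 0) (at y within chart S i))))"

definition basis_fun :: "('d::finite, 'a, 'z) spline_manifold_scheme \<Rightarrow> nat \<times> 'a \<Rightarrow>
    (nat \<times> (real^'d)) set \<Rightarrow> real" where
  "basis_fun S = (\<lambda>(i, a) P. if P \<in> Omega_chart S i
     then proto_basis S i a (inv_into (chart S i) (proj S i) P) else 0)"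

definition same_fun :: "('d::finite, 'a, 'z) spline_manifold_scheme \<Rightarrow>
    ((nat \<times> 'a) \<times> (nat \<times> 'a)) set" where
  "same_fun S = {(u, v). u \<in> (SIGMA i:{..<num_charts S}. proto_indices S i) \<and>
     v \<in> (SIGMA i:{..<num_charts S}. proto_indices S i) \<and> basis_fun S u = basis_fun S v}"

definition indices :: "('d::finite, 'a, 'z) spline_manifold_scheme \<Rightarrow> (nat \<times> 'a) set set" where
  "indices S = (SIGMA i:{..<num_charts S}. proto_indices S i) // same_fun S"

definition B :: "('d::finite, 'a, 'z) spline_manifold_scheme \<Rightarrow> (nat \<times> 'a) set \<Rightarrow>
    (nat \<times> (real^'d)) set \<Rightarrow> real" where
  "B S A = the_elem (basis_fun S ` A)"

definition chart_indices :: "('d::finite, 'a, 'z) spline_manifold_scheme \<Rightarrow> nat \<Rightarrow>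
    (nat \<times> 'a) set set" where
  "chart_indices S i = {A \<in> indices S. \<exists>a\<in>proto_indices S i. (i, a) \<in> A}"

definition near_indices :: "('d::finite, 'a, 'z) spline_manifold_scheme \<Rightarrow> nat \<Rightarrow>
    (nat \<times> 'a) set set" where
  "near_indices S i =
     {A \<in> indices S. \<exists>A'\<in>chart_indices S i. supp S (B S A) \<inter> supp S (B S A') \<noteq> {}}"

definition indices_s :: "('d::finite, 'a, 'z) spline_manifold_scheme \<Rightarrow> (nat \<times> 'a) set set" where
  "indices_s S = (\<Union>i\<in>charts_of S Structured. chart_indices S i)"

definition indices_e :: "('d::finite, 'a, 'z) spline_manifold_scheme \<Rightarrow> (nat \<times> 'a) set set" where
  "indices_e S = (\<Union>i\<in>charts_of S Edge. chart_indices S i) - indices_s S"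

definition indices_v :: "('d::finite, 'a, 'z) spline_manifold_scheme \<Rightarrow> (nat \<times> 'a) set set" where
  "indices_v S = (\<Union>i\<in>charts_of S Vertex. chart_indices S i) - (indices_s S \<union> indices_e S)"

definition bspline_assumptions :: "('d::finite, 'a, 'z) spline_manifold_scheme \<Rightarrow> bool" where
  "bspline_assumptions S \<longleftrightarrow>
     (\<forall>i<num_charts S. \<forall>A\<in>indices S.
        supp S (B S A) \<subseteq> Omega_chart S i \<longrightarrow> A \<in> chart_indices S i) \<and>
     (\<forall>i\<in>charts_of S Structured. (\<Union>A\<in>chart_indices S i. supp S (B S A)) = Omega_chart S i) \<and>
     (\<forall>A\<in>indices S. structured_region S (supp S (B S A)) \<longrightarrow>
        (\<exists>i\<in>charts_of S Structured. supp S (B S A) \<subseteq> Omega_chart S i)) \<and>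
     (\<forall>i\<in>charts_of S Structured. \<forall>A\<in>near_indices S i.
        (\<forall>l. local_knots (spline_degree S) (knots S A i l)) \<and>
        (\<forall>x\<in>chart S i. B S A (proj S i x) =
           (\<Prod>l\<in>UNIV. bspline (spline_degree S) (knots S A i l) (x $ l)))) \<and>
     (\<forall>i\<in>charts_of S Edge. \<forall>A\<in>near_indices S i.
        local_knots (spline_degree S) (knots S A i (coord S 3)) \<and>
        (\<forall>x\<in>chart S i. B S A (proj S i x) =
           planar_factor S A i (planar S x) *
           bspline (spline_degree S) (knots S A i (coord S 3)) (x $ coord S 3)))"

definition dual_compatible :: "('d::finite, 'a, 'z) spline_manifold_scheme \<Rightarrow> bool" where
  "dual_compatible S \<longleftrightarrow>
     (\<forall>i\<in>charts_of S Structured. \<forall>A\<in>chart_indices S i. \<forall>A'\<in>near_indices S i. A' \<noteq> A \<longrightarrow>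
        (\<exists>l. knots S A i l \<noteq> knots S A' i l \<and>
             overlap (spline_degree S) (knots S A i l) (knots S A' i l))) \<and>
     (\<forall>i\<in>charts_of S Edge. \<forall>A\<in>chart_indices S i \<inter> indices_e S. \<forall>A'\<in>chart_indices S i. A' \<noteq> A \<longrightarrow>
        overlap (spline_degree S) (knots S A i (coord S 3)) (knots S A' i (coord S 3)) \<and>
          knots S A i (coord S 3) \<noteq> knots S A' i (coord S 3) \<or>
        (\<exists>z\<in>planar S ` chart S i. planar_factor S A i z \<noteq> planar_factor S A' i z)) \<and>
     (\<forall>i\<in>charts_of S Edge. \<forall>A\<in>chart_indices S i \<inter> indices_e S.
        \<forall>A'\<in>(near_indices S i - chart_indices S i) \<inter> (indices_e S \<union> indices_v S).
          overlap (spline_degree S) (knots S A i (coord S 3)) (knots S A' i (coord S 3)) \<and>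
          knots S A i (coord S 3) \<noteq> knots S A' i (coord S 3))"


section \<open>Functionals on L2\<close>

definition L2 :: "'b measure \<Rightarrow> ('b \<Rightarrow> real) set" where
  "L2 \<mu> = {f \<in> borel_measurable \<mu>. integrable \<mu> (\<lambda>x. (f x)\<^sup>2)}"

text \<open>Functionals on the space of classes of square-integrable functions are given as functionals
  on functions that respect equality almost everywhere.\<close>

definition L2_functional :: "'b measure \<Rightarrow> (('b \<Rightarrow> real) \<Rightarrow> real) \<Rightarrow> bool" where
  "L2_functional \<mu> \<Lambda> \<longleftrightarrow>
     (\<forall>f\<in>L2 \<mu>. \<forall>g\<in>L2 \<mu>. \<Lambda> (\<lambda>x. f x + g x) = \<Lambda> f + \<Lambda> g) \<and>
     (\<forall>c. \<forall>f\<in>L2 \<mu>. \<Lambda> (\<lambda>x. c * f x) = c * \<Lambda> f) \<and>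
     (\<forall>f\<in>L2 \<mu>. \<forall>g\<in>L2 \<mu>. (AE x in \<mu>. f x = g x) \<longrightarrow> \<Lambda> f = \<Lambda> g)"

definition is_proto_dual :: "('d::finite, 'a, 'z) spline_manifold_scheme \<Rightarrow>
    (nat \<Rightarrow> 'a \<Rightarrow> (real^'d \<Rightarrow> real) \<Rightarrow> real) \<Rightarrow> bool" where
  "is_proto_dual S pdual \<longleftrightarrow>
     (\<forall>i<num_charts S. \<forall>a\<in>proto_indices S i.
        L2_functional (lebesgue_on (chart S i)) (pdual i a) \<and>
        (\<forall>a'\<in>proto_indices S i. pdual i a (proto_basis S i a') = (if a = a' then 1 else 0))) \<and>
     (\<forall>i a j a'. ((i, a), (j, a')) \<in> same_fun S \<longrightarrow>
        (\<forall>\<phi>\<in>L2 (volume S). pdual i a (\<phi> \<circ> proj S i) = pdual j a' (\<phi> \<circ> proj S j)))"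


section \<open>Well-definedness\<close>

lemma openin_Omega_top:
  "openin (Omega_top M) U \<longleftrightarrow>
     U \<subseteq> Omega M \<and> (\<forall>i<num_charts M. open {x \<in> chart M i. proj M i x \<in> U})"
proof -
  have "istopology (\<lambda>U. U \<subseteq> Omega M \<and> (\<forall>i<num_charts M. open {x \<in> chart M i. proj M i x \<in> U}))"
    unfolding istopology_def
  proof (intro conjI allI impI; (elim conjE)?)
    fix U V assume "U \<subseteq> Omega M" then show "U \<inter> V \<subseteq> Omega M" by blast
  next
    fix U V i assume i: "i < num_charts M"
      and U: "\<forall>i<num_charts M. open {x \<in> chart M i. proj M i x \<in> U}"
      and V: "\<forall>i<num_charts M. open {x \<in> chart M i. proj M i x \<in> V}"
    have "{x \<in> chart M i. proj M i x \<in> U \<inter> V} =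
        {x \<in> chart M i. proj M i x \<in> U} \<inter> {x \<in> chart M i. proj M i x \<in> V}" by blast
    then show "open {x \<in> chart M i. proj M i x \<in> U \<inter> V}" using i U V by (simp add: open_Int)
  next
    fix K assume "\<forall>U\<in>K. U \<subseteq> Omega M \<and> (\<forall>i<num_charts M. open {x \<in> chart M i. proj M i x \<in> U})"
    then show "\<Union>K \<subseteq> Omega M" by blast
  next
    fix K i assume i: "i < num_charts M"
      and K: "\<forall>U\<in>K. U \<subseteq> Omega M \<and> (\<forall>i<num_charts M. open {x \<in> chart M i. proj M i x \<in> U})"
    have "{x \<in> chart M i. proj M i x \<in> \<Union>K} = (\<Union>U\<in>K. {x \<in> chart M i. proj M i x \<in> U})" by blast
    then show "open {x \<in> chart M i. proj M i x \<in> \<Union>K}" using i K by (simp add: open_UN)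
  qed
  then show ?thesis by (simp add: Omega_top_def topology_inverse')
qed

lemma is_proto_manifoldD:
  assumes "is_proto_manifold M" "i < num_charts M" "j < num_charts M"
  shows "tdom M i i = chart M i" "tdom M i j \<subseteq> chart M i"
    "\<exists>\<phi>. homeomorphism (tdom M i j) (tdom M j i) (transition M i j) \<phi>"
    "k < num_charts M \<Longrightarrow> x \<in> tdom M i j \<Longrightarrow> x \<in> tdom M i k \<Longrightarrow>
       transition M i j x \<in> tdom M j k \<and> transition M j k (transition M i j x) = transition M i k x"
proof -
  note D = assms(1)[unfolded is_proto_manifold_def]
  note D1 = conjunct1[OF D] and D2 = conjunct1[OF conjunct2[OF D]]
    and D3 = conjunct1[OF conjunct2[OF conjunct2[OF D]]]
  show "tdom M i i = chart M i" using D1 assms(2) by simp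
  show "tdom M i j \<subseteq> chart M i" using D2 assms(2,3) by simp
  show "\<exists>\<phi>. homeomorphism (tdom M i j) (tdom M j i) (transition M i j) \<phi>"
    using D2 assms(2,3) by simp
  show "k < num_charts M \<Longrightarrow> x \<in> tdom M i j \<Longrightarrow> x \<in> tdom M i k \<Longrightarrow>
       transition M i j x \<in> tdom M j k \<and> transition M j k (transition M i j x) = transition M i k x"
    using D3 assms(2,3) by simp
qed

lemma transition_self:
  assumes M: "is_proto_manifold M" and i: "i < num_charts M" and x: "x \<in> chart M i"
  shows "transition M i i x = x"
proof -
  have x': "x \<in> tdom M i i" using is_proto_manifoldD(1)[OF M i i] x by simp
  obtain \<phi> where h: "homeomorphism (tdom M i i) (tdom M i i) (transition M i i) \<phi>"
    using is_proto_manifoldD(3)[OF M i i] by blast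
  note c = is_proto_manifoldD(4)[OF M i i i x' x']
  have "\<phi> (transition M i i (transition M i i x)) = transition M i i x"
    using h conjunct1[OF c] by (rule homeomorphism_apply1)
  moreover have "\<phi> (transition M i i x) = x"
    using h x' by (rule homeomorphism_apply1)
  ultimately show ?thesis using c by simp
qed

lemma equiv_glue:
  assumes M: "is_proto_manifold M"
  shows "equiv (SIGMA i:{..<num_charts M}. chart M i) (glue M)"
proof -
  note self = is_proto_manifoldD(1)[OF M _ _] and sub = is_proto_manifoldD(2)[OF M]
    and coc = is_proto_manifoldD(4)[OF M]
  have img: "transition M i j x \<in> tdom M j i \<and> transition M j i (transition M i j x) = x"
    if ij: "i < num_charts M" "j < num_charts M" and x: "x \<in> tdom M i j" for i j x
  proof -
    have x': "x \<in> chart M i" using sub[OF ij] x by blast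
    then have "x \<in> tdom M i i" using self[OF ij(1) ij(1)] by simp
    then show ?thesis
      using coc[OF ij ij(1) x] transition_self[OF M ij(1) x'] by simp
  qed
  show ?thesis
  proof (rule equivI)
    show "glue M \<subseteq> (SIGMA i:{..<num_charts M}. chart M i) \<times> (SIGMA i:{..<num_charts M}. chart M i)"
      unfolding glue_def by (auto dest: subsetD[OF sub])
    show "refl_on (SIGMA i:{..<num_charts M}. chart M i) (glue M)"
    proof (rule refl_onI)
      fix u assume "u \<in> (SIGMA i:{..<num_charts M}. chart M i)"
      then obtain i x where u: "u = (i, x)" "i < num_charts M" "x \<in> chart M i" by auto
      then show "(u, u) \<in> glue M"
        using self[OF u(2,2)] transition_self[OF M u(2,3)] by (simp add: glue_def)
    qed
    show "sym (glue M)"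
      unfolding sym_def glue_def by (auto dest: img)
    show "trans (glue M)"
    proof (rule transI)
      fix u v w assume uv: "(u, v) \<in> glue M" and vw: "(v, w) \<in> glue M"
      obtain i x j y k z where e: "u = (i, x)" "v = (j, y)" "w = (k, z)" by (metis surj_pair)
      have a: "i < num_charts M" "j < num_charts M" "k < num_charts M"
        "x \<in> tdom M i j" "transition M i j x = y" "y \<in> tdom M j i"
        "y \<in> tdom M j k" "transition M j k y = z"
        using uv vw by (auto simp: glue_def e)
      have yx: "transition M j i y = x" using img[OF a(1,2,4)] a(5) by simp
      have xk: "x \<in> tdom M i k" "transition M i k x = z"
        using coc[OF a(2,1,3,6,7)] yx a(8) by simp_all
      moreover have "z \<in> tdom M k i" using img[OF a(1,3) xk(1)] xk(2) by simp
      ultimately show "(u, w) \<in> glue M" using a by (simp add: glue_def e)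
    qed
  qed
qed

lemma inj_on_proj:
  assumes M: "is_proto_manifold M" and i: "i < num_charts M"
  shows "inj_on (proj M i) (chart M i)"
proof (rule inj_onI)
  fix x y assume xy: "x \<in> chart M i" "y \<in> chart M i" "proj M i x = proj M i y"
  have "((i, x), (i, y)) \<in> glue M"
    using eq_equiv_class[OF _ equiv_glue[OF M], of "(i, x)" "(i, y)"] xy i
    by (simp add: proj_def)
  then show "x = y" using transition_self[OF M i xy(1)] by (simp add: glue_def)
qed

lemma equiv_same_fun:
  "equiv (SIGMA i:{..<num_charts S}. proto_indices S i) (same_fun S)"
  by (rule equivI) (auto simp: same_fun_def refl_on_def sym_def trans_def)

lemma B_eq_basis_fun:
  assumes "A \<in> indices S" "u \<in> A"
  shows "B S A = basis_fun S u"
proof -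
  obtain v where v: "A = same_fun S `` {v}" using assms by (auto simp: indices_def quotient_def)
  have "basis_fun S ` A = {basis_fun S u}" using assms(2) by (auto simp: v same_fun_def)
  then show ?thesis by (simp add: B_def)
qed

end

theory Submission
  imports Defs
begin

text \<open>Functionals dual to the \<open>B\<^sub>A\<close> in \<open>L2(\<Omega>)\<close> exist as soon as the \<open>B\<^sub>A\<close> are linearly
  independent almost everywhere: they can be taken to be integrals against square-integrable
  functions. As every \<open>B\<^sub>A\<close> is continuous on every mesh element, a combination that vanishes almost
  everywhere vanishes identically on all elements. Its coefficients are then seen to vanish in the
  order \<open>A\<^sub>s, A\<^sub>e, A\<^sub>v\<close>. Near a point of a structured chart \<open>i\<close> where \<open>B\<^sub>A \<noteq> 0\<close> only the tensor product
  splines of the near indices of \<open>i\<close> are present, and a tensor product of univariate functionals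
  isolates \<open>c\<^sub>A\<close>. On an edge chart, the univariate spline along the edge of every function of the
  chart overlaps and differs from that of every remaining one from outside it, whence the partial sum over
  the functions of the chart vanishes by itself and its coefficients are read off by the proto-dual
  functionals. On a vertex chart only functions of that chart are left.

  The univariate fact behind the edge case: if every B-spline of one family overlaps and differs from
  every B-spline of a second family, then the spans of the two families on a knot-free interval
  meet only in 0. Setting one argument of the blossoms to the last knot before, or to the first knot
  after the interval removes that knot, lowers the degree of all splines and preserves the hypothesis;
  as the blossom is affine in each argument, these two values determine it, and induction on the
  degree applies.\<close>

section \<open>Finite duality and blossoms of B-splines\<close>

text \<open>A linear functional that vanishes on the common kernel of finitely many others is a
  combination of them. The induction passes to the kernel of one coordinate after the other. It
  serves both for point evaluations of splines and for pairings with square-integrable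
  functions.\<close>

lemma separating_vector:
  fixes W :: "('i \<Rightarrow> real) set"
  assumes "finite I" "k \<notin> I"
    and "\<And>u v s. u \<in> W \<Longrightarrow> v \<in> W \<Longrightarrow> (\<lambda>i. u i + s * v i) \<in> W"
    and "\<And>c. \<exists>w\<in>W. w k \<noteq> (\<Sum>i\<in>I. c i * w i)"
  shows "\<exists>w\<in>W. w k = 1 \<and> (\<forall>i\<in>I. w i = 0)"
  using assms
proof (induction I arbitrary: W rule: finite_induct)
  case empty
  then obtain w where w: "w \<in> W" "w k \<noteq> 0" by auto
  have "(\<lambda>i. w i + (1 / w k - 1) * w i) \<in> W" using empty.prems(2)[OF w(1) w(1)] .
  moreover have "w k + (1 / w k - 1) * w k = 1" using w(2) by (simp add: field_simps)
  ultimately show ?case by (intro bexI[of _ "\<lambda>i. w i + (1 / w k - 1) * w i"]) auto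
next
  case (insert m I)
  show ?case
  proof (cases "\<exists>w\<in>W. w m \<noteq> 0")
    case False
    have "\<exists>w\<in>W. w k = 1 \<and> (\<forall>i\<in>I. w i = 0)"
    proof (rule insert.IH)
      show "\<exists>w\<in>W. w k \<noteq> (\<Sum>i\<in>I. c i * w i)" for c
      proof -
        obtain w where w: "w \<in> W" "w k \<noteq> (\<Sum>i\<in>insert m I. c i * w i)"
          using insert.prems(3) by blast
        moreover have "w m = 0" using w(1) False by blast
        ultimately have "w k \<noteq> (\<Sum>i\<in>I. c i * w i)" using insert.hyps by simp
        then show ?thesis using w(1) by blast
      qed
    qed (use insert.prems in auto)
    then show ?thesis using False by auto
  next
    case True
    then obtain w where w: "w \<in> W" "w m \<noteq> 0" by blast
    have "\<exists>v\<in>{v\<in>W. v m = 0}. v k = 1 \<and> (\<forall>i\<in>I. v i = 0)"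
    proof (rule insert.IH)
      fix c
      \<comment> \<open>The coefficient of \<open>m\<close> is the one for which the relation holds
        at \<open>w\<close>. A violation at \<open>u\<close> therefore persists after
        \<open>u\<close> is corrected by the multiple of \<open>w\<close> that makes it vanish at
        \<open>m\<close>.\<close>
      let ?c = "c(m := (w k - (\<Sum>i\<in>I. c i * w i)) / w m)"
      obtain u where u: "u \<in> W" "u k \<noteq> (\<Sum>i\<in>insert m I. ?c i * u i)"
        using insert.prems(3) by blast
      let ?v = "\<lambda>i. u i + (- u m / w m) * w i"
      have "(\<Sum>i\<in>I. ?c i * u i) = (\<Sum>i\<in>I. c i * u i)"
        using insert.hyps by (intro sum.cong) auto
      then have u': "u k \<noteq> (w k - (\<Sum>i\<in>I. c i * w i)) / w m * u m + (\<Sum>i\<in>I. c i * u i)"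
        using u(2) insert.hyps by simp
      have "(\<Sum>i\<in>I. c i * ?v i) = (\<Sum>i\<in>I. c i * u i) + (- u m / w m) * (\<Sum>i\<in>I. c i * w i)"
        by (simp add: algebra_simps sum.distrib sum_distrib_left sum_subtractf sum_negf)
      then have "?v k \<noteq> (\<Sum>i\<in>I. c i * ?v i)"
        using u' w(2) by (simp add: field_simps)
      moreover have "?v \<in> W" using insert.prems(2)[OF u(1) w(1)] .
      moreover have "?v m = 0" using w(2) by simp
      ultimately show "\<exists>v\<in>{v\<in>W. v m = 0}. v k \<noteq> (\<Sum>i\<in>I. c i * v i)"
        by (intro bexI[of _ ?v]) auto
    qed (use insert.prems in auto)
    then show ?thesis by auto
  qed
qed

section \<open>Blossoms: symmetry, knot removal, polarisation, independence\<close>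

text \<open>\<open>blossom l r a b us\<close> is the blossom, at the arguments \<open>us\<close>, of the polynomial that a B-spline of
  degree \<open>length us\<close> with \<open>a + b = length us + 2\<close> knots equals on a knot-free interval, where
  \<open>l 0 \<ge> l 1 \<ge> \<dots> \<ge> l (a - 1)\<close> are the knots to the left of the interval and
  \<open>r 0 \<le> r 1 \<le> \<dots> \<le> r (b - 1)\<close> those to the right. It vanishes if the interval lies outside the
  support, i.e. if \<open>a = 0\<close> or \<open>b = 0\<close>.\<close>

fun blossom :: "(nat \<Rightarrow> real) \<Rightarrow> (nat \<Rightarrow> real) \<Rightarrow> nat \<Rightarrow> nat \<Rightarrow> real list \<Rightarrow> real" where
  "blossom l r 0 b us = 0"
| "blossom l r (Suc a) 0 us = 0"
| "blossom l r (Suc a) (Suc b) [] = 1"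
| "blossom l r (Suc a) (Suc b) (u # us) =
     (u - l a) / (r (b - 1) - l a) * blossom l r (Suc a) b us +
     (r b - u) / (r b - l (a - 1)) * blossom l r a (Suc b) us"

lemma blossom_0 [simp]: "blossom l r a 0 us = 0"
  by (cases a) auto

lemma blossom_cong:
  assumes "\<And>k. k < a \<Longrightarrow> l k = l' k" "\<And>k. k < b \<Longrightarrow> r k = r' k"
  shows "blossom l r a b us = blossom l' r' a b us"
  using assms
proof (induction l r a b us rule: blossom.induct)
  case (4 l r a b u us)
  have "(u - l a) / (r (b - 1) - l a) * blossom l r (Suc a) b us =
      (u - l' a) / (r' (b - 1) - l' a) * blossom l' r' (Suc a) b us"
    using 4 by (cases b) auto
  moreover have "(r b - u) / (r b - l (a - 1)) * blossom l r a (Suc b) us =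
      (r' b - u) / (r' b - l' (a - 1)) * blossom l' r' a (Suc b) us"
    using 4 by (cases a) auto
  ultimately show ?case by simp
qed auto

text \<open>Reflecting the line at 0 exchanges left and right knots and leaves the weights
  unchanged, since numerators and denominators both change sign. Statements about right knots
  thereby acquire mirror images.\<close>

lemma blossom_reflect:
  "blossom l r a b us = blossom (\<lambda>k. - r k) (\<lambda>k. - l k) b a (map uminus us)"
proof (induction l r a b us rule: blossom.induct)
  case (4 l r a b u us)
  have e: "(- u - - r b) / (- l (a - 1) - - r b) = (r b - u) / (r b - l (a - 1))"
    "(- l a - - u) / (- l a - - r (b - 1)) = (u - l a) / (r (b - 1) - l a)" by (simp_all add: algebra_simps)
  show ?case unfolding list.map blossom.simps e 4[symmetric] by simp
qed auto

text \<open>Expanding two arguments leaves three blossoms on fewer knots. The outer two coefficients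
  are visibly symmetric in \<open>u\<close> and \<open>v\<close>; only the middle one needs an
  identity. Exchanging the first two arguments is all the symmetry used later.\<close>

lemma blossom_swap:
  assumes lr: "\<And>i j. l i < r j"
  shows "blossom l r a b (u # v # us) = blossom l r a b (v # u # us)"
proof (cases "a = 0 \<or> b = 0")
  case True then show ?thesis by (metis blossom.simps(1) blossom_0)
next
  case False
  then obtain a' b' where ab: "a = Suc a'" "b = Suc b'" by (metis not0_implies_Suc)
  have nz: "r j - l i \<noteq> 0" for i j using lr[of i j] by simp
  have key: "(u - l i) / (r j' - l i) * ((r j' - v) / (r j' - l i')) +
      (r j - u) / (r j - l i') * ((v - l i') / (r j' - l i'))
     = (v - l i) / (r j' - l i) * ((r j' - u) / (r j' - l i')) +
      (r j - v) / (r j - l i') * ((u - l i') / (r j' - l i'))" for i i' j j'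
  proof -
    \<comment> \<open>Exchanging \<open>u\<close> and \<open>v\<close> changes the first quotient by
      \<open>u - v\<close> and the second by the negative of it, whatever the knots are, so their
      sum is symmetric.\<close>
    have add_eq: "a - b = e \<Longrightarrow> c - d = e \<Longrightarrow> a + d = b + c" for a b c d e :: real by simp
    have "(u - l i) * (r j' - v) / (r j' - l i) - (v - l i) * (r j' - u) / (r j' - l i) = (u - v)"
      using nz[of j' i] by (simp add: divide_simps) (simp add: algebra_simps)
    moreover have "(r j - v) * (u - l i') / (r j - l i') - (r j - u) * (v - l i') / (r j - l i') = (u - v)"
      using nz[of j i'] by (simp add: divide_simps) (simp add: algebra_simps)
    ultimately have "(u - l i) * (r j' - v) / (r j' - l i) + (r j - u) * (v - l i') / (r j - l i')
      = (v - l i) * (r j' - u) / (r j' - l i) + (r j - v) * (u - l i') / (r j - l i')"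
      by (rule add_eq)
    then have "((u - l i) * (r j' - v) / (r j' - l i) + (r j - u) * (v - l i') / (r j - l i')) / (r j' - l i')
      = ((v - l i) * (r j' - u) / (r j' - l i) + (r j - v) * (u - l i') / (r j - l i')) / (r j' - l i')" by simp
    then show ?thesis by (simp add: add_divide_distrib)
  qed
  show ?thesis
  proof (cases a')
    case 0 then show ?thesis by (cases b') (auto simp: ab)
  next
    case (Suc a2)
    show ?thesis
    proof (cases b')
      case 0 then show ?thesis by (auto simp: ab Suc)
    next
      case (Suc b2)
      let ?x = "blossom l r (Suc (Suc a2)) b2 us" and ?y = "blossom l r (Suc a2) (Suc b2) us"
        and ?z = "blossom l r a2 (Suc (Suc b2)) us"
      have ex: "blossom l r a b (u # v # us) =
         (u - l a') / (r b2 - l a') * ((v - l a') / (r (b2-1) - l a')) * ?x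
       + ((u - l a') / (r b2 - l a') * ((r b2 - v) / (r b2 - l a2)) + (r b' - u) / (r b' - l a2) * ((v - l a2) / (r b2 - l a2))) * ?y
       + (r b' - u) / (r b' - l a2) * ((r b' - v) / (r b' - l (a2-1))) * ?z" for u v
        using \<open>a' = Suc a2\<close> Suc by (simp add: ab distrib_left distrib_right mult.assoc)
      show ?thesis unfolding ex unfolding key[of a' b2 a2 b'] by (simp add: mult.commute)
    qed
  qed
qed

text \<open>By \<open>blossom_swap\<close> the knot moves behind the argument \<open>v\<close>;
  expanding \<open>v\<close> leaves two shorter blossoms to the induction hypothesis. This knot
  removal is what lowers the degree in \<open>blossom_sums_independent\<close>.\<close>

lemma blossom_first_right:
  assumes lr: "\<And>i j. l i < r j" and "a + b = length us + 2"
  shows "blossom l r a (Suc b) (r 0 # us) = blossom l (r \<circ> Suc) a b us"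
  using assms(2)
proof (induction us arbitrary: a b)
  case Nil
  then have "a = 0 \<or> a = 1 \<and> b = 1 \<or> a = 2 \<and> b = 0" by auto
  then show ?case using lr[of 0 0] by (auto simp: numeral_2_eq_2)
next
  case (Cons v us)
  show ?case
  proof (cases "a = 0 \<or> b = 0")
    case True then show ?thesis by (cases a) auto
  next
    case False
    then obtain a' b' where ab: "a = Suc a'" "b = Suc b'" by (metis not0_implies_Suc)
    have "blossom l r a (Suc b) (r 0 # v # us) = blossom l r a (Suc b) (v # r 0 # us)"
      using lr by (rule blossom_swap)
    also have "\<dots> = (v - l a') / (r b' - l a') * blossom l r a b (r 0 # us) +
        (r b - v) / (r b - l (a' - 1)) * blossom l r a' (Suc b) (r 0 # us)"
      by (simp add: ab)
    also have "blossom l r a b (r 0 # us) = blossom l (r \<circ> Suc) a b' us"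
      using Cons.IH[of a b'] Cons.prems by (simp add: ab comp_def del: blossom.simps(4))
    also have "blossom l r a' (Suc b) (r 0 # us) = blossom l (r \<circ> Suc) a' b us"
      using Cons.IH[of a' b] Cons.prems by (simp add: ab comp_def del: blossom.simps(4))
    also have "(v - l a') / (r b' - l a') * blossom l (r \<circ> Suc) a b' us +
        (r b - v) / (r b - l (a' - 1)) * blossom l (r \<circ> Suc) a' b us = blossom l (r \<circ> Suc) a b (v # us)"
      by (cases b') (auto simp: ab comp_def)
    finally show ?thesis .
  qed
qed

lemma blossom_first_left:
  assumes lr: "\<And>i j. l i < r j" and "a + b = length us + 2"
  shows "blossom l r (Suc a) b (l 0 # us) = blossom (l \<circ> Suc) r a b us"
proof -
  have "blossom l r (Suc a) b (l 0 # us) = blossom (\<lambda>k. - r k) (\<lambda>k. - l k) b (Suc a) (- l 0 # map uminus us)"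
    by (subst blossom_reflect) simp
  also have "\<dots> = blossom (\<lambda>k. - r k) ((\<lambda>k. - l k) \<circ> Suc) b a (map uminus us)"
    using lr assms(2) by (intro blossom_first_right[of "\<lambda>k. - r k" "\<lambda>k. - l k"]) auto
  also have "\<dots> = blossom (l \<circ> Suc) r a b us"
    by (subst blossom_reflect[of "l \<circ> Suc"]) (simp add: o_def)
  finally show ?thesis .
qed

text \<open>The slope is written as a difference of blossoms at \<open>t\<close> and
  \<open>t + 1\<close>, so that the formula passes termwise to sums of blossoms.\<close>

lemma blossom_affine:
  "blossom l r a b (u # us) =
     blossom l r a b (t # us) + (u - t) * (blossom l r a b ((t + 1) # us) - blossom l r a b (t # us))"
proof (cases "a = 0 \<or> b = 0")
  case True then show ?thesis by (cases a) auto
next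
  case False
  then obtain a' b' where ab: "a = Suc a'" "b = Suc b'" by (metis not0_implies_Suc)
  have "\<exists>x y. \<forall>u. blossom l r a b (u # us) = x + u * y"
    by (rule exI[of _ "(- l a') / (r (b' - 1) - l a') * blossom l r (Suc a') b' us +
     r b' / (r b' - l (a' - 1)) * blossom l r a' (Suc b') us"],
     rule exI[of _ "1 / (r (b' - 1) - l a') * blossom l r (Suc a') b' us +
     (- 1) / (r b' - l (a' - 1)) * blossom l r a' (Suc b') us"]) (simp add: ab algebra_simps diff_divide_distrib)
  then obtain x y where "\<And>u. blossom l r a b (u # us) = x + u * y" by blast
  then show ?thesis by (simp add: algebra_simps)
qed

text \<open>Along the diagonal, the derivative of a symmetric multiaffine map is the number of
  arguments times the slope in one of them. The product rule treats the first argument and the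
  induction hypothesis the others.\<close>

lemma has_real_derivative_blossom:
  assumes lr: "\<And>i j. l i < r j"
  shows "((\<lambda>t. blossom l r a b (replicate (Suc n) t)) has_real_derivative
    real (Suc n) * (blossom l r a b ((t + 1) # replicate n t) - blossom l r a b (t # replicate n t))) (at t)"
proof (induction n arbitrary: a b)
  case 0
  have "(\<lambda>u. blossom l r a b [u]) = (\<lambda>u. blossom l r a b [t] + (u - t) * (blossom l r a b [t + 1] - blossom l r a b [t]))"
    using blossom_affine[of l r a b _ "[]" t] by blast
  moreover have "((\<lambda>u. blossom l r a b [t] + (u - t) * (blossom l r a b [t + 1] - blossom l r a b [t]))
      has_real_derivative (blossom l r a b [t + 1] - blossom l r a b [t])) (at t)"
    by (auto intro!: derivative_eq_intros)
  ultimately show ?case by simp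
next
  case (Suc n)
  show ?case
  proof (cases "a = 0 \<or> b = 0")
    case True then show ?thesis by (cases a) auto
  next
    case False
    then obtain a' b' where ab: "a = Suc a'" "b = Suc b'" by (metis not0_implies_Suc)
    let ?D = "r (b' - 1) - l a'" and ?E = "r b' - l (a' - 1)"
    let ?s = "t # replicate n t" and ?s' = "(t + 1) # replicate n t"
    have sum_eq: "p + s * x * e + (q + s * y * f) = p + q + s * (e * x + f * y)"
      for p q s x y e f :: real by (simp add: algebra_simps)
    note I1 = Suc.IH[of "Suc a'" b'] and I2 = Suc.IH[of a' "Suc b'"]
    have D: "((\<lambda>t. (t - l a') / ?D * blossom l r (Suc a') b' (replicate (Suc n) t) +
        (r b' - t) / ?E * blossom l r a' (Suc b') (replicate (Suc n) t)) has_real_derivative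
        (1 / ?D * blossom l r (Suc a') b' ?s + (- 1) / ?E * blossom l r a' (Suc b') ?s) +
        real (Suc n) * ((t - l a') / ?D * (blossom l r (Suc a') b' ?s' - blossom l r (Suc a') b' ?s) +
         (r b' - t) / ?E * (blossom l r a' (Suc b') ?s' - blossom l r a' (Suc b') ?s))) (at t)"
    proof (rule DERIV_cong[OF DERIV_add[OF DERIV_mult[OF _ I1] DERIV_mult[OF _ I2]]])
      show "((\<lambda>t. (t - l a') / ?D) has_real_derivative 1 / ?D) (at t)"
        by (intro DERIV_cdivide) (auto intro!: derivative_eq_intros)
      show "((\<lambda>t. (r b' - t) / ?E) has_real_derivative (- 1) / ?E) (at t)"
        by (intro DERIV_cdivide) (auto intro!: derivative_eq_intros)
    qed (unfold replicate_Suc, rule sum_eq)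
    have F: "(\<lambda>t. blossom l r a b (replicate (Suc (Suc n)) t)) =
      (\<lambda>t. (t - l a') / ?D * blossom l r (Suc a') b' (replicate (Suc n) t) +
        (r b' - t) / ?E * blossom l r a' (Suc b') (replicate (Suc n) t))"
      by (simp add: ab)
    have Q: "(t - l a') / ?D * (blossom l r (Suc a') b' ?s' - blossom l r (Suc a') b' ?s) +
         (r b' - t) / ?E * (blossom l r a' (Suc b') ?s' - blossom l r a' (Suc b') ?s) =
         blossom l r a b (t # ?s') - blossom l r a b (t # ?s)"
      by (simp add: ab right_diff_distrib)
    have P: "1 / ?D * blossom l r (Suc a') b' ?s + (- 1) / ?E * blossom l r a' (Suc b') ?s =
         blossom l r a b ((t + 1) # ?s) - blossom l r a b (t # ?s)"
      by (simp add: ab algebra_simps add_divide_distrib diff_divide_distrib)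
    \<comment> \<open>The induction hypothesis leaves the unit increment in the second argument;
      symmetry moves it to the first, where it joins the contribution of the weights.\<close>
    have X: "blossom l r a b (t # ?s') = blossom l r a b ((t + 1) # ?s)"
      using lr by (rule blossom_swap)
    have scale: "x + real (Suc n) * x = real (Suc (Suc n)) * x" for x
      by (simp add: algebra_simps)
    show ?thesis using D unfolding F[symmetric] P Q X scale by simp
  qed
qed

text \<open>On \<open>T\<close> the sum and its derivative vanish, hence so do value and slope of
  the sum as an affine function of its first argument. One freed argument suffices: once a knot is
  put there, the remaining diagonal is that of a spline of lower degree.\<close>

lemma sum_blossom_polarize:
  assumes "finite I" and lr: "\<And>i j k. i \<in> I \<Longrightarrow> l i j < r i k"
    and "open T" and zero: "\<And>t. t \<in> T \<Longrightarrow> (\<Sum>i\<in>I. c i * blossom (l i) (r i) (a i) (b i) (replicate (Suc n) t)) = 0"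
    and t: "t \<in> T"
  shows "(\<Sum>i\<in>I. c i * blossom (l i) (r i) (a i) (b i) (u # replicate n t)) = 0"
proof -
  let ?N = "\<lambda>i. blossom (l i) (r i) (a i) (b i)"
  have "((\<lambda>t. \<Sum>i\<in>I. c i * ?N i (replicate (Suc n) t)) has_real_derivative
      (\<Sum>i\<in>I. c i * (real (Suc n) * (?N i ((t + 1) # replicate n t) - ?N i (t # replicate n t))))) (at t)"
    by (intro DERIV_sum DERIV_cmult has_real_derivative_blossom lr)
  moreover have "((\<lambda>t. \<Sum>i\<in>I. c i * ?N i (replicate (Suc n) t)) has_real_derivative 0) (at t)"
    by (rule has_field_derivative_transform_within_open[of "\<lambda>_. 0" _ _ T]) (use assms in auto)
  ultimately have "(\<Sum>i\<in>I. c i * (real (Suc n) * (?N i ((t + 1) # replicate n t) - ?N i (t # replicate n t)))) = 0"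
    by (rule DERIV_unique)
  then have d: "real (Suc n) * (\<Sum>i\<in>I. c i * (?N i ((t + 1) # replicate n t) - ?N i (t # replicate n t))) = 0"
    by (simp only: sum_distrib_left mult.left_commute)
  have "(\<Sum>i\<in>I. c i * ?N i (u # replicate n t)) =
     (\<Sum>i\<in>I. c i * ?N i (t # replicate n t)) +
      (u - t) * (\<Sum>i\<in>I. c i * (?N i ((t + 1) # replicate n t) - ?N i (t # replicate n t)))"
    unfolding sum_distrib_left sum.distrib[symmetric]
    by (intro sum.cong refl, subst blossom_affine[of _ _ _ _ u _ t]) (simp only: distrib_left mult.left_commute)
  then show ?thesis using d zero[OF t] by simp
qed

text \<open>Overlapping knot vectors read the same knots outward from a common interval, as far as
  both reach, and with equal lengths they differ exactly if the numbers of knots to its left differ.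
  The hypotheses on \<open>l\<close>, \<open>r\<close> and \<open>a\<close> encode this.\<close>

lemma blossom_sums_independent:
  assumes "finite I" "finite J" "open T"
    and lr: "\<And>i j k. i \<in> I \<union> J \<Longrightarrow> l i j < r i k"
    and ab: "\<And>i. i \<in> I \<union> J \<Longrightarrow> a i + b i = n + 2"
    and "\<And>i j. i \<in> I \<Longrightarrow> j \<in> J \<Longrightarrow> a i \<noteq> a j"
    and "\<And>i j k. i \<in> I \<Longrightarrow> j \<in> J \<Longrightarrow> k < a i \<Longrightarrow> k < a j \<Longrightarrow> l i k = l j k"
    and "\<And>i j k. i \<in> I \<Longrightarrow> j \<in> J \<Longrightarrow> k < b i \<Longrightarrow> k < b j \<Longrightarrow> r i k = r j k"
    and "I \<inter> J = {}"
    and "\<And>t. t \<in> T \<Longrightarrow> (\<Sum>i\<in>I \<union> J. c i * blossom (l i) (r i) (a i) (b i) (replicate n t)) = 0"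
    and "t \<in> T"
  shows "(\<Sum>i\<in>I. c i * blossom (l i) (r i) (a i) (b i) (replicate n t)) = 0"
  using assms
proof (induction n arbitrary: I J l r a b t)
  note [simp del] = blossom.simps(4)
  case (0 I J l r a b)
  let ?I = "{i\<in>I. 0 < a i \<and> 0 < b i}" and ?J = "{i\<in>J. 0 < a i \<and> 0 < b i}"
  have one: "a i = 1" if "i \<in> ?I \<union> ?J" for i using 0(5)[of i] that by auto
  have z: "blossom (l i) (r i) (a i) (b i) us = 0" if "i \<in> I - ?I \<union> (J - ?J)" for i us
    using that by auto
  \<comment> \<open>In degree 0 a contributing spline has one knot on either side, so
    \<open>a = 1\<close> in both families, against \<open>a i \<noteq> a j\<close>.\<close>
  have "?I = {} \<or> ?J = {}"
  proof (rule ccontr)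
    assume "\<not> ?thesis"
    then obtain i j where "i \<in> ?I" "j \<in> ?J" by blast
    then have "a i = 1" "a j = 1" using one by blast+
    moreover have "a i \<noteq> a j" by (rule 0(6)) (use \<open>i \<in> ?I\<close> \<open>j \<in> ?J\<close> in blast)+
    ultimately show False by simp
  qed
  then show ?case
  proof
    assume "?I = {}"
    then show ?thesis using z by (intro sum.neutral) auto
  next
    assume "?J = {}"
    then have "(\<Sum>i\<in>J. c i * blossom (l i) (r i) (a i) (b i) (replicate 0 t)) = 0"
      using z by (intro sum.neutral) auto
    then show ?thesis using 0(10)[OF 0(11)] 0(1,2,9) by (simp add: sum.union_disjoint)
  qed
next
  note [simp del] = blossom.simps(4)
  case (Suc n I0 J0 l r a b t)
  let ?N = "\<lambda>i. blossom (l i) (r i) (a i) (b i)"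
  \<comment> \<open>Only members with knots on both sides contribute; for these the subtractions
    \<open>a i - 1\<close> and \<open>b i - 1\<close> below are exact.\<close>
  define I where "I = {i\<in>I0. 0 < a i \<and> 0 < b i}"
  define J where "J = {i\<in>J0. 0 < a i \<and> 0 < b i}"
  have fin: "finite I" "finite J" and dis: "I \<inter> J = {}"
    using Suc.prems(1,2,9) by (auto simp: I_def J_def)
  have z: "?N i us = 0" if "i \<in> I0 - I \<union> (J0 - J)" for i us
    using that by (auto simp: I_def J_def)
  have sI: "(\<Sum>i\<in>I0. c i * ?N i us) = (\<Sum>i\<in>I. c i * ?N i us)" for us
    using z Suc.prems(1) by (intro sum.mono_neutral_right) (auto simp: I_def)
  have sIJ: "(\<Sum>i\<in>I0 \<union> J0. c i * ?N i us) = (\<Sum>i\<in>I \<union> J. c i * ?N i us)" for us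
    using z Suc.prems(1,2) by (intro sum.mono_neutral_right) (auto simp: I_def J_def)
  have zero: "(\<Sum>i\<in>I \<union> J. c i * ?N i (replicate (Suc n) t)) = 0" if "t \<in> T" for t
    using Suc.prems(10)[OF that] sIJ by simp
  have lr: "l i j < r i k" if "i \<in> I \<union> J" for i j k using Suc.prems(4) that by (auto simp: I_def J_def)
  have pos: "0 < a i" "0 < b i" if "i \<in> I \<union> J" for i using that by (auto simp: I_def J_def)
  have ab: "a i + b i = Suc n + 2" if "i \<in> I \<union> J" for i using Suc.prems(5) that by (auto simp: I_def J_def)
  have agree: "a i \<noteq> a j" "k < a i \<Longrightarrow> k < a j \<Longrightarrow> l i k = l j k"
    "k < b i \<Longrightarrow> k < b j \<Longrightarrow> r i k = r j k"
    if "i \<in> I" "j \<in> J" for i j k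
    using Suc.prems(6-8) that by (auto simp: I_def J_def)
  have pol: "(\<Sum>i\<in>I \<union> J. c i * ?N i (u # replicate n t)) = 0" if "t \<in> T" for u t
    by (rule sum_blossom_polarize[where T=T]) (use fin lr zero that Suc.prems(3) in auto)
  show ?case
  \<comment> \<open>Comparability forces all splines to share the knots \<open>z0, z1\<close> that are adjacent to the interval.\<close>
  proof (cases "I = {} \<or> J = {}")
    case True
    then show ?thesis using zero[OF Suc.prems(11)] by (auto simp: sI)
  next
    case False
    then obtain i0 j0 where ij: "i0 \<in> I" "j0 \<in> J" by blast
    define z1 where "z1 = r j0 0"
    define z0 where "z0 = l j0 0"
    have r0: "r i 0 = z1" "l i 0 = z0" if "i \<in> I \<union> J" for i
    proof -
      have *: "r k 0 = z1 \<and> l k 0 = z0" if "k \<in> I" for k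
        using agree(2,3)[OF that ij(2), of 0] pos[of k] pos[of j0] that ij by (auto simp: z1_def z0_def)
      have "r i 0 = z1 \<and> l i 0 = z0"
      proof (cases "i \<in> I")
        case False
        then have "i \<in> J" using that by simp
        then show ?thesis using agree(2,3)[OF ij(1), of i 0] *[OF ij(1)] pos[of i] pos[of i0] ij by auto
      qed (use * in auto)
      then show "r i 0 = z1" "l i 0 = z0" by auto
    qed
    have z01: "z0 < z1" using lr[of j0 0 0] ij by (simp add: z0_def z1_def)
    have right: "?N i (z1 # replicate n t) = blossom (l i) (r i \<circ> Suc) (a i) (b i - 1) (replicate n t)"
      if "i \<in> I \<union> J" for i t
      using blossom_first_right[of "l i" "r i" "a i" "b i - 1" "replicate n t"]
        lr[OF that] ab[OF that] pos[OF that] r0[OF that] by simp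
    have left: "?N i (z0 # replicate n t) = blossom (l i \<circ> Suc) (r i) (a i - 1) (b i) (replicate n t)"
      if "i \<in> I \<union> J" for i t
      using blossom_first_left[of "l i" "r i" "a i - 1" "b i" "replicate n t"]
        lr[OF that] ab[OF that] pos[OF that] r0[OF that] by simp
    have right_sum: "(\<Sum>i\<in>K. c i * ?N i (z1 # replicate n t)) =
        (\<Sum>i\<in>K. c i * blossom (l i) (r i \<circ> Suc) (a i) (b i - 1) (replicate n t))"
      if "K \<subseteq> I \<union> J" for K t
      by (intro sum.cong refl arg_cong2[where f="(*)"] right) (use that in blast)
    have left_sum: "(\<Sum>i\<in>K. c i * ?N i (z0 # replicate n t)) =
        (\<Sum>i\<in>K. c i * blossom (l i \<circ> Suc) (r i) (a i - 1) (b i) (replicate n t))"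
      if "K \<subseteq> I \<union> J" for K t
      by (intro sum.cong refl arg_cong2[where f="(*)"] left) (use that in blast)
    \<comment> \<open>Removing \<open>z1\<close> keeps every \<open>a i\<close>, and removing
      \<open>z0\<close> lowers each of them by one, so the two families stay distinct in both
      applications of the induction hypothesis.\<close>
    have "(\<Sum>i\<in>I. c i * blossom (l i) (r i \<circ> Suc) (a i) (b i - 1) (replicate n t)) = 0"
    proof (rule Suc.IH[OF fin Suc.prems(3) _ _ _ _ _ dis _ Suc.prems(11)])
      show "(\<Sum>i\<in>I \<union> J. c i * blossom (l i) (r i \<circ> Suc) (a i) (b i - 1) (replicate n t)) = 0" if "t \<in> T" for t
        using pol[OF that, of z1] unfolding right_sum[OF subset_refl] .
      show "a i + (b i - 1) = n + 2" if "i \<in> I \<union> J" for i using ab[OF that] pos[OF that] by simp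
      show "l i j < (r i \<circ> Suc) k" if "i \<in> I \<union> J" for i j k using lr[OF that] by simp
      show "a i \<noteq> a j" if "i \<in> I" "j \<in> J" for i j using agree(1)[OF that] .
      show "l i k = l j k" if "i \<in> I" "j \<in> J" "k < a i" "k < a j" for i j k using agree(2)[OF that] .
      show "(r i \<circ> Suc) k = (r j \<circ> Suc) k" if "i \<in> I" "j \<in> J" "k < b i - 1" "k < b j - 1" for i j k
        using agree(3)[OF that(1,2), of "Suc k"] that(3,4) by simp
    qed
    then have A1: "(\<Sum>i\<in>I. c i * ?N i (z1 # replicate n t)) = 0"
      by (subst right_sum) auto
    have "(\<Sum>i\<in>I. c i * blossom (l i \<circ> Suc) (r i) (a i - 1) (b i) (replicate n t)) = 0"
    proof (rule Suc.IH[OF fin Suc.prems(3) _ _ _ _ _ dis _ Suc.prems(11)])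
      show "(\<Sum>i\<in>I \<union> J. c i * blossom (l i \<circ> Suc) (r i) (a i - 1) (b i) (replicate n t)) = 0" if "t \<in> T" for t
        using pol[OF that, of z0] unfolding left_sum[OF subset_refl] .
      show "a i - 1 + b i = n + 2" if "i \<in> I \<union> J" for i using ab[OF that] pos[OF that] by simp
      show "(l i \<circ> Suc) j < r i k" if "i \<in> I \<union> J" for i j k using lr[OF that] by simp
      show "a i - 1 \<noteq> a j - 1" if "i \<in> I" "j \<in> J" for i j
        using agree(1)[OF that] pos(1)[OF UnI1[OF that(1)]] pos(1)[OF UnI2[OF that(2)]] by linarith
      show "r i k = r j k" if "i \<in> I" "j \<in> J" "k < b i" "k < b j" for i j k using agree(3)[OF that] .
      show "(l i \<circ> Suc) k = (l j \<circ> Suc) k" if "i \<in> I" "j \<in> J" "k < a i - 1" "k < a j - 1" for i j k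
        using agree(2)[OF that(1,2), of "Suc k"] that(3,4) by simp
    qed
    then have A0: "(\<Sum>i\<in>I. c i * ?N i (z0 # replicate n t)) = 0"
      by (subst left_sum) auto
    \<comment> \<open>The partial sum over \<open>I\<close> is affine in its first argument and
      vanishes at the distinct points \<open>z0\<close> and \<open>z1\<close>, hence also at
      \<open>t\<close>.\<close>
    let ?f = "\<lambda>u. (\<Sum>i\<in>I. c i * ?N i (u # replicate n t))"
    have aff: "?f u = ?f z0 + (u - z0) * (?f (z0 + 1) - ?f z0)" for u
      unfolding sum_subtractf[symmetric] sum_distrib_left sum.distrib[symmetric]
      by (intro sum.cong refl, subst blossom_affine[of _ _ _ _ u _ z0])
        (simp only: distrib_left mult.left_commute right_diff_distrib)
    have "?f (z0 + 1) - ?f z0 = 0" using aff[of z1] A0 A1 z01 by simp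
    then have "?f t = 0" using aff[of t] A0 by simp
    then show ?thesis by (simp add: sI)
  qed
qed

section \<open>B-splines on knot-free intervals and their dual functionals\<close>

lemma bspline_outside:
  assumes "length \<Xi> = p + 2" "sorted \<Xi>" "x < \<Xi> ! 0 \<or> \<Xi> ! (p + 1) \<le> x"
  shows "bspline p \<Xi> x = 0"
  using assms
proof (induction p arbitrary: \<Xi>)
  case (Suc p)
  have s: "sorted (butlast \<Xi>)" "sorted (tl \<Xi>)"
    using Suc.prems by (auto simp: sorted_butlast sorted_tl)
  have n: "butlast \<Xi> ! 0 = \<Xi> ! 0" "butlast \<Xi> ! (p + 1) = \<Xi> ! (p + 1)"
    "tl \<Xi> ! 0 = \<Xi> ! 1" "tl \<Xi> ! (p + 1) = \<Xi> ! (p + 2)"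
    using Suc.prems by (auto simp: nth_butlast nth_tl)
  have m: "\<Xi> ! 0 \<le> \<Xi> ! 1" "\<Xi> ! (p + 1) \<le> \<Xi> ! (p + 2)"
    using Suc.prems by (auto intro!: sorted_nth_mono)
  have "bspline p (butlast \<Xi>) x = 0" "bspline p (tl \<Xi>) x = 0"
    by (rule Suc.IH; use Suc.prems s n m in auto)+
  then show ?case by simp
qed auto

text \<open>The Cox-de Boor recursion and \<open>blossom\<close> unfold alike:
  \<open>butlast\<close> drops the outermost right knot, \<open>tl\<close> the outermost left one.
  The \<open>min\<close> and the truncated \<open>j - k\<close> repeat the extreme knots, so that
  left knots stay below right ones at all indices, as the blossom lemmas demand.\<close>

lemma bspline_eq_blossom:
  assumes "length \<Xi> = p + 2" "sorted \<Xi>" "j \<le> p" "\<Xi> ! j \<le> x" "x < \<Xi> ! (j + 1)"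
  shows "bspline p \<Xi> x = blossom (\<lambda>k. \<Xi> ! (j - k)) (\<lambda>k. \<Xi> ! min (j + 1 + k) (p + 1))
    (j + 1) (p + 1 - j) (replicate p x)"
  using assms
proof (induction p arbitrary: \<Xi> j)
  case (Suc p)
  define l where "l = (\<lambda>k. \<Xi> ! (j - k))"
  define r where "r = (\<lambda>k. \<Xi> ! min (j + 1 + k) (Suc p + 1))"
  have s: "sorted (butlast \<Xi>)" "sorted (tl \<Xi>)"
    using Suc.prems by (auto simp: sorted_butlast sorted_tl)
  have 1: "bspline p (butlast \<Xi>) x = blossom l r (Suc j) (Suc p - j) (replicate p x)"
  proof (cases "j = Suc p")
    case True
    then have "bspline p (butlast \<Xi>) x = 0"
      using Suc.prems s by (intro bspline_outside) (auto simp: nth_butlast)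
    then show ?thesis using True by simp
  next
    case False
    then have "bspline p (butlast \<Xi>) x = blossom (\<lambda>k. butlast \<Xi> ! (j - k))
        (\<lambda>k. butlast \<Xi> ! min (j + 1 + k) (p + 1)) (j + 1) (p + 1 - j) (replicate p x)"
      using Suc.prems s by (intro Suc.IH) (auto simp: nth_butlast)
    also have "\<dots> = blossom l r (j + 1) (p + 1 - j) (replicate p x)"
      using Suc.prems False by (intro blossom_cong) (auto simp: l_def r_def nth_butlast min_def)
    finally show ?thesis by simp
  qed
  have 2: "bspline p (tl \<Xi>) x = blossom l r j (Suc (Suc p - j)) (replicate p x)"
  proof (cases j)
    case 0
    then have "bspline p (tl \<Xi>) x = 0"
      using Suc.prems s by (intro bspline_outside) (auto simp: nth_tl)
    then show ?thesis using 0 by simp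
  next
    case (Suc i)
    then have "bspline p (tl \<Xi>) x = blossom (\<lambda>k. tl \<Xi> ! (i - k))
        (\<lambda>k. tl \<Xi> ! min (i + 1 + k) (p + 1)) (i + 1) (p + 1 - i) (replicate p x)"
      using Suc.prems s by (intro Suc.IH) (auto simp: nth_tl)
    also have "\<dots> = blossom l r (i + 1) (p + 1 - i) (replicate p x)"
      using Suc.prems \<open>j = Suc i\<close> by (intro blossom_cong) (auto simp: l_def r_def nth_tl min_def Suc_diff_le)
    finally show ?thesis using Suc Suc.prems by (simp add: Suc_diff_le)
  qed
  \<comment> \<open>The weights of the two recursions agree except in the last span here and in the
    first span below, where they multiply a spline that vanishes at \<open>x\<close>.\<close>
  have "(x - l j) / (r (Suc p - j - 1) - l j) * bspline p (butlast \<Xi>) x =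
      (x - \<Xi> ! 0) / (\<Xi> ! (p + 1) - \<Xi> ! 0) * bspline p (butlast \<Xi>) x"
  proof (cases "j = Suc p")
    case False
    then show ?thesis using Suc.prems by (simp add: l_def r_def min_def)
  qed (simp add: 1)
  moreover have "(r (Suc p - j) - x) / (r (Suc p - j) - l (j - 1)) * bspline p (tl \<Xi>) x =
      (\<Xi> ! (p + 2) - x) / (\<Xi> ! (p + 2) - \<Xi> ! 1) * bspline p (tl \<Xi>) x"
    using Suc.prems by (cases j) (auto simp: 2 l_def r_def)
  moreover have "blossom l r (j + 1) (Suc p + 1 - j) (replicate (Suc p) x) =
      (x - l j) / (r (Suc p - j - 1) - l j) * bspline p (butlast \<Xi>) x +
      (r (Suc p - j) - x) / (r (Suc p - j) - l (j - 1)) * bspline p (tl \<Xi>) x"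
    using Suc.prems(3) by (simp add: 1 2 Suc_diff_le)
  ultimately show ?case unfolding l_def[symmetric] r_def[symmetric] by simp
qed auto

lemma knot_span_exists:
  fixes \<Xi> :: "real list"
  assumes "\<Xi> ! 0 < x" "x < \<Xi> ! Suc p" "\<And>j. j \<le> Suc p \<Longrightarrow> \<Xi> ! j \<noteq> x"
  shows "\<exists>j\<le>p. \<Xi> ! j < x \<and> x < \<Xi> ! (j + 1)"
  using assms
proof (induction p)
  case (Suc p)
  show ?case
  proof (cases "x < \<Xi> ! Suc p")
    case True
    then show ?thesis using Suc.IH Suc.prems by (metis le_Suc_eq)
  next
    case False
    then have "\<Xi> ! Suc p < x" using Suc.prems(3)[of "Suc p"] by simp
    then show ?thesis using Suc.prems(2) by auto
  qed
qed auto

text \<open>On the whole knot-free interval a spline either vanishes or is the diagonal of one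
  blossom, so both the activity \<open>act\<close> and the span index \<open>j\<close> can be fixed
  at the single point \<open>x\<close>.\<close>

lemma bspline_sums_independent:
  assumes fin: "finite I" "finite J" "I \<inter> J = {}"
    and knots: "\<And>i. i \<in> I \<union> J \<Longrightarrow> local_knots p (\<Xi> i)"
    and free: "\<And>i. i \<in> I \<union> J \<Longrightarrow> set (\<Xi> i) \<inter> {s<..<e} = {}"
    and overlap: "\<And>i j. i \<in> I \<Longrightarrow> j \<in> J \<Longrightarrow> \<Xi> i \<noteq> \<Xi> j \<and> overlap p (\<Xi> i) (\<Xi> j)"
    and zero: "\<And>t. t \<in> {s<..<e} \<Longrightarrow> (\<Sum>i\<in>I \<union> J. c i * bspline p (\<Xi> i) t) = 0"
    and x: "x \<in> {s<..<e}"
  shows "(\<Sum>i\<in>I. c i * bspline p (\<Xi> i) x) = 0"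
proof -
  define act where "act i \<longleftrightarrow> \<Xi> i ! 0 < x \<and> x < \<Xi> i ! (p + 1)" for i
  define j where "j i = (SOME j. j \<le> p \<and> \<Xi> i ! j < x \<and> x < \<Xi> i ! (j + 1))" for i
  define l where "l i k = \<Xi> i ! (j i - k)" for i k
  define r where "r i k = \<Xi> i ! min (j i + 1 + k) (p + 1)" for i k
  let ?I = "{i\<in>I. act i}" and ?J = "{i\<in>J. act i}"
  have len: "length (\<Xi> i) = p + 2" "sorted (\<Xi> i)" if "i \<in> I \<union> J" for i
    using knots[OF that] by (auto simp: local_knots_def)
  have nin: "\<Xi> i ! m \<notin> {s<..<e}" if "i \<in> I \<union> J" "m \<le> p + 1" for i m
  proof -
    have "\<Xi> i ! m \<in> set (\<Xi> i)" using len[OF that(1)] that(2) by simp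
    then show ?thesis using free[OF that(1)] by blast
  qed
  have j: "j i \<le> p" "\<Xi> i ! j i < x" "x < \<Xi> i ! (j i + 1)" if "i \<in> I \<union> J" "act i" for i
  proof -
    have "\<exists>j\<le>p. \<Xi> i ! j < x \<and> x < \<Xi> i ! (j + 1)"
      using that(2) nin[OF that(1)] x by (intro knot_span_exists) (auto simp: act_def)
    then show "j i \<le> p" "\<Xi> i ! j i < x" "x < \<Xi> i ! (j i + 1)"
      unfolding j_def by (metis (mono_tags, lifting) someI_ex)+
  qed
  have mono: "\<Xi> i ! m \<le> \<Xi> i ! m'" if "i \<in> I \<union> J" "m \<le> m'" "m' \<le> p + 1" for i m m'
    using len[OF that(1)] that by (intro sorted_nth_mono) auto
  have eq: "bspline p (\<Xi> i) t = blossom (l i) (r i) (j i + 1) (p + 1 - j i) (replicate p t)"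
    if i: "i \<in> I \<union> J" "act i" and t: "t \<in> {s<..<e}" for i t
    unfolding l_def r_def
    by (rule bspline_eq_blossom)
      (use len[OF i(1)] j[OF i] nin[OF i(1), of "j i"] nin[OF i(1), of "j i + 1"] x t in auto)
  have out: "bspline p (\<Xi> i) t = 0" if i: "i \<in> I \<union> J" "\<not> act i" and t: "t \<in> {s<..<e}" for i t
    by (rule bspline_outside)
      (use len[OF i(1)] i(2) nin[OF i(1), of 0] nin[OF i(1), of "p + 1"] x t in \<open>auto simp: act_def\<close>)
  have sums: "(\<Sum>i\<in>K. c i * bspline p (\<Xi> i) t) =
      (\<Sum>i\<in>{i\<in>K. act i}. c i * blossom (l i) (r i) (j i + 1) (p + 1 - j i) (replicate p t))"
    if "K \<subseteq> I \<union> J" "t \<in> {s<..<e}" for K t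
  proof -
    have "(\<Sum>i\<in>K. c i * bspline p (\<Xi> i) t) = (\<Sum>i\<in>{i\<in>K. act i}. c i * bspline p (\<Xi> i) t)"
      using that fin out by (intro sum.mono_neutral_right) (auto intro: finite_subset)
    also have "\<dots> = (\<Sum>i\<in>{i\<in>K. act i}. c i * blossom (l i) (r i) (j i + 1) (p + 1 - j i) (replicate p t))"
      using that eq by (intro sum.cong) auto
    finally show ?thesis .
  qed
  have cmp: "j i \<noteq> j k \<and> (\<forall>m<min (j i + 1) (j k + 1). l i m = l k m) \<and>
      (\<forall>m<min (p + 1 - j i) (p + 1 - j k). r i m = r k m)" if ik: "i \<in> ?I" "k \<in> ?J" for i k
  proof -
    have ik': "i \<in> I \<union> J" "k \<in> I \<union> J" "act i" "act k" using ik by auto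
    obtain X k1 k2 where X: "sorted X" "k1 + (p + 2) \<le> length X" "k2 + (p + 2) \<le> length X"
      "\<And>m. m < p + 2 \<Longrightarrow> \<Xi> i ! m = X ! (m + k1) \<and> \<Xi> k ! m = X ! (m + k2)"
      and ne: "\<Xi> i \<noteq> \<Xi> k"
      using overlap[of i k] ik by (auto simp: overlap_def)
    have X1: "\<Xi> i ! m = X ! (m + k1)" "\<Xi> k ! m = X ! (m + k2)" if "m \<le> p + 1" for m
      using X(4)[of m] that by auto
    note ji = j[OF ik'(1,3)] and jk = j[OF ik'(2,4)]
    \<comment> \<open>Both spans contain \<open>x\<close> in their interior, so they are the same
      span of the common knot vector \<open>X\<close>.\<close>
    have "X ! (j i + k1) < x" "x < X ! (j i + 1 + k1)" "X ! (j k + k2) < x" "x < X ! (j k + 1 + k2)"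
      using ji jk X1(1)[of "j i"] X1(1)[of "j i + 1"] X1(2)[of "j k"] X1(2)[of "j k + 1"] by auto
    moreover have "X ! (j i + 1 + k1) \<le> X ! (j k + k2)" if "j i + k1 < j k + k2"
      using X(1-3) ji jk that by (intro sorted_nth_mono) auto
    moreover have "X ! (j k + 1 + k2) \<le> X ! (j i + k1)" if "j k + k2 < j i + k1"
      using X(1-3) ji jk that by (intro sorted_nth_mono) auto
    ultimately have same: "j i + k1 = j k + k2" by linarith
    \<comment> \<open>Equal span indices would force equal shifts into \<open>X\<close> and hence
      equal knot vectors.\<close>
    have "j i \<noteq> j k"
    proof
      assume "j i = j k"
      then have "k1 = k2" using same by simp
      then have "\<Xi> i = \<Xi> k" using X1 len[OF ik'(1)] len[OF ik'(2)]
        by (intro nth_equalityI) auto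
      then show False using ne by simp
    qed
    moreover have "l i m = l k m" if "m < min (j i + 1) (j k + 1)" for m
    proof -
      have "j i - m + k1 = j k - m + k2" using same that by auto
      then show ?thesis using ji jk X1(1)[of "j i - m"] X1(2)[of "j k - m"] by (simp add: l_def)
    qed
    moreover have "r i m = r k m" if "m < min (p + 1 - j i) (p + 1 - j k)" for m
    proof -
      have e: "j i + 1 + m + k1 = j k + 1 + m + k2" using same by auto
      have "j i + 1 + m \<le> p + 1" "j k + 1 + m \<le> p + 1" using that by auto
      then have "r i m = X ! (j i + 1 + m + k1)" "r k m = X ! (j k + 1 + m + k2)"
        using X1(1)[of "j i + 1 + m"] X1(2)[of "j k + 1 + m"] by (simp_all add: r_def min_absorb1)
      then show ?thesis by (simp only: e)
    qed
    ultimately show ?thesis by blast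
  qed
  have lr: "l i m < r i m'" if "i \<in> ?I \<union> ?J" for i m m'
  proof -
    have i: "i \<in> I \<union> J" "act i" using that by auto
    have "l i m \<le> \<Xi> i ! j i" unfolding l_def using j[OF i] by (intro mono i) auto
    also have "\<dots> < x" using j[OF i] by simp
    also have "\<dots> < \<Xi> i ! (j i + 1)" using j[OF i] by simp
    also have "\<dots> \<le> r i m'" unfolding r_def using j[OF i] by (intro mono i) auto
    finally show ?thesis .
  qed
  have "(\<Sum>i\<in>?I. c i * blossom (l i) (r i) (j i + 1) (p + 1 - j i) (replicate p x)) = 0"
  proof (rule blossom_sums_independent[where J = ?J and T = "{s<..<e}" and l = l])
    show "j i + 1 + (p + 1 - j i) = p + 2" if "i \<in> ?I \<union> ?J" for i
      using j[of i] that by auto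
    show "j i + 1 \<noteq> j k + 1" if "i \<in> ?I" "k \<in> ?J" for i k using cmp[OF that] by simp
    show "l i m = l k m" if "i \<in> ?I" "k \<in> ?J" "m < j i + 1" "m < j k + 1" for i k m
      using cmp[OF that(1,2)] that(3,4) by simp
    show "r i m = r k m" if "i \<in> ?I" "k \<in> ?J" "m < p + 1 - j i" "m < p + 1 - j k" for i k m
      using cmp[OF that(1,2)] that(3,4) by simp
    show "(\<Sum>i\<in>?I \<union> ?J. c i * blossom (l i) (r i) (j i + 1) (p + 1 - j i) (replicate p t)) = 0"
      if "t \<in> {s<..<e}" for t
    proof -
      have "?I \<union> ?J = {i\<in>I \<union> J. act i}" by auto
      then show ?thesis using sums[OF subset_refl that] zero[OF that] by simp
    qed
  qed (use fin x lr in auto)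
  then show ?thesis using sums[of I x] x by simp
qed

text \<open>Otherwise the spline on \<open>\<Xi>\<close> would be a combination of those in
  \<open>Y\<close> on the interval, and \<open>bspline_sums_independent\<close>, with
  \<open>{\<Xi>}\<close> as the first family, would make it vanish at \<open>x\<close>. Finite
  combinations of point evaluations are chosen because they apply to identities that hold
  pointwise.\<close>

lemma bspline_point_dual:
  assumes x: "local_knots p \<Xi>" "x \<in> {s<..<e}" "bspline p \<Xi> x \<noteq> 0" "set \<Xi> \<inter> {s<..<e} = {}"
    and Y: "finite Y" "\<And>y. y \<in> Y \<Longrightarrow> local_knots p y \<and> set y \<inter> {s<..<e} = {} \<and> \<Xi> \<noteq> y \<and> overlap p \<Xi> y"
  shows "\<exists>P w. finite P \<and> P \<subseteq> {s<..<e} \<and> (\<Sum>t\<in>P. w t * bspline p \<Xi> t) = 1 \<and>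
    (\<forall>y\<in>Y. (\<Sum>t\<in>P. w t * bspline p y t) = 0)"
proof -
  define W where "W = {\<lambda>y. \<Sum>t\<in>P. w t * bspline p y t | P w. finite P \<and> P \<subseteq> {s<..<e}}"
  have "\<exists>v\<in>W. v \<Xi> = 1 \<and> (\<forall>y\<in>Y. v y = 0)"
  proof (rule separating_vector)
    show "\<Xi> \<notin> Y" using Y(2) by blast
    fix u v a assume "u \<in> W" "v \<in> W"
    then obtain P w Q w' where
      P: "finite P" "P \<subseteq> {s<..<e}" "u = (\<lambda>y. \<Sum>t\<in>P. w t * bspline p y t)" and
      Q: "finite Q" "Q \<subseteq> {s<..<e}" "v = (\<lambda>y. \<Sum>t\<in>Q. w' t * bspline p y t)"
      by (auto simp: W_def)
    let ?w = "\<lambda>t. (if t \<in> P then w t else 0) + a * (if t \<in> Q then w' t else 0)"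
    have "u y + a * v y = (\<Sum>t\<in>P \<union> Q. ?w t * bspline p y t)" for y
    proof -
      have "u y = (\<Sum>t\<in>P \<union> Q. (if t \<in> P then w t else 0) * bspline p y t)"
        unfolding P(3) using P(1) Q(1) by (intro sum.mono_neutral_cong_left) auto
      moreover have "v y = (\<Sum>t\<in>P \<union> Q. (if t \<in> Q then w' t else 0) * bspline p y t)"
        unfolding Q(3) using P(1) Q(1) by (intro sum.mono_neutral_cong_left) auto
      ultimately show ?thesis by (simp only: sum_distrib_left sum.distrib distrib_right mult.assoc)
    qed
    then show "(\<lambda>y. u y + a * v y) \<in> W"
      using P(1,2) Q(1,2) unfolding W_def
      by (intro CollectI exI[of _ "P \<union> Q"] exI[of _ ?w]) auto
  next
    fix c :: "real list \<Rightarrow> real"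
    show "\<exists>v\<in>W. v \<Xi> \<noteq> (\<Sum>y\<in>Y. c y * v y)"
    proof (rule ccontr)
      assume *: "\<not> ?thesis"
      have pt: "bspline p \<Xi> t = (\<Sum>y\<in>Y. c y * bspline p y t)" if "t \<in> {s<..<e}" for t
      proof -
        have "(\<lambda>y. \<Sum>t\<in>{t}. (1::real) * bspline p y t) \<in> W"
          unfolding W_def using that by (intro CollectI exI[of _ "{t}"] exI[of _ "\<lambda>_. 1"]) auto
        then show ?thesis using * by fastforce
      qed
      let ?c = "c(\<Xi> := - 1)"
      have nin: "\<Xi> \<notin> Y" using Y(2) by blast
      have "(\<Sum>y\<in>{\<Xi>}. ?c y * bspline p y x) = 0"
      proof (rule bspline_sums_independent[where \<Xi> = "\<lambda>y. y" and J = Y and s = s and e = e])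
        fix t assume t: "t \<in> {s<..<e}"
        have "(\<Sum>y\<in>Y. ?c y * bspline p y t) = (\<Sum>y\<in>Y. c y * bspline p y t)"
          using nin by (intro sum.cong) auto
        then show "(\<Sum>y\<in>{\<Xi>} \<union> Y. ?c y * bspline p y t) = 0"
          using pt[OF t] Y(1) nin by simp
      qed (use x Y nin in auto)
      then show False using x(3) by simp
    qed
  qed (use Y in auto)
  then show ?thesis unfolding W_def by fastforce
qed

text \<open>The vanishing combination is summed over the grid of nodes against the product weights,
  and distributivity turns each term into a product over the directions. One vanishing factor kills
  an index, in a direction that may depend on the index, which is the form dual-compatibility has on
  structured charts.\<close>

lemma tensor_dual:
  fixes g :: "'i \<Rightarrow> 'd::finite \<Rightarrow> real \<Rightarrow> real"
  assumes "finite I" "k \<in> I"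
    and P: "\<And>l. finite (P l)" "\<And>l. (\<Sum>t\<in>P l. w l t * g k l t) = 1"
    and kill: "\<And>i. i \<in> I \<Longrightarrow> i \<noteq> k \<Longrightarrow> \<exists>l. (\<Sum>t\<in>P l. w l t * g i l t) = 0"
    and zero: "\<And>x::real^'d. (\<And>l. x $ l \<in> P l) \<Longrightarrow> (\<Sum>i\<in>I. c i * (\<Prod>l\<in>UNIV. g i l (x $ l))) = 0"
  shows "c k = 0"
proof -
  let ?D = "\<lambda>i. \<Prod>l\<in>UNIV. \<Sum>t\<in>P l. w l t * g i l t"
  have D: "?D i = (\<Sum>x\<in>Pi\<^sub>E UNIV P. (\<Prod>l\<in>UNIV. w l (x l)) * (\<Prod>l\<in>UNIV. g i l (x l)))" for i
    by (subst prod_sum_PiE) (auto simp: P prod.distrib)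
  have "(\<Sum>i\<in>I. c i * ?D i) =
      (\<Sum>x\<in>Pi\<^sub>E UNIV P. (\<Prod>l\<in>UNIV. w l (x l)) * (\<Sum>i\<in>I. c i * (\<Prod>l\<in>UNIV. g i l (x l))))"
    unfolding D sum_distrib_left by (subst sum.swap) (simp only: mult.left_commute)
  also have "\<dots> = 0"
  proof (rule sum.neutral, rule ballI)
    fix x assume "x \<in> Pi\<^sub>E UNIV P"
    then show "(\<Prod>l\<in>UNIV. w l (x l)) * (\<Sum>i\<in>I. c i * (\<Prod>l\<in>UNIV. g i l (x l))) = 0"
      using zero[of "\<chi> l. x l"] by (simp add: PiE_iff)
  qed
  finally have "(\<Sum>i\<in>I. c i * ?D i) = 0" .
  moreover have "(\<Sum>i\<in>I. c i * ?D i) = (\<Sum>i\<in>{k}. c i * ?D i)"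
  proof (rule sum.mono_neutral_right)
    show "\<forall>i\<in>I - {k}. c i * ?D i = 0"
    proof
      fix i assume "i \<in> I - {k}"
      then have "\<exists>l\<in>UNIV. (\<Sum>t\<in>P l. w l t * g i l t) = 0" using kill by blast
      then have "?D i = 0" by (intro prod_zero) auto
      then show "c i * ?D i = 0" by simp
    qed
  qed (use assms in auto)
  ultimately show ?thesis using P(2) by simp
qed

section \<open>Functionals on L2\<close>

lemma L2_measurable: "f \<in> L2 \<mu> \<Longrightarrow> f \<in> borel_measurable \<mu>"
  by (simp add: L2_def)

lemma L2_integrable_mult:
  assumes "f \<in> L2 \<mu>" "g \<in> L2 \<mu>" shows "integrable \<mu> (\<lambda>x. f x * g x)"
proof (rule Bochner_Integration.integrable_bound)
  show "integrable \<mu> (\<lambda>x. (f x)\<^sup>2 + (g x)\<^sup>2)" using assms by (simp add: L2_def)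
  show "AE x in \<mu>. norm (f x * g x) \<le> norm ((f x)\<^sup>2 + (g x)\<^sup>2)"
  proof (rule AE_I2)
    fix x
    have "2 * (\<bar>f x\<bar> * \<bar>g x\<bar>) \<le> (f x)\<^sup>2 + (g x)\<^sup>2"
      using sum_squares_bound[of "\<bar>f x\<bar>" "\<bar>g x\<bar>"] by simp
    moreover have "0 \<le> \<bar>f x\<bar> * \<bar>g x\<bar>" by simp
    ultimately have "\<bar>f x\<bar> * \<bar>g x\<bar> \<le> (f x)\<^sup>2 + (g x)\<^sup>2" by linarith
    then show "norm (f x * g x) \<le> norm ((f x)\<^sup>2 + (g x)\<^sup>2)" by (simp add: abs_mult)
  qed
  show "(\<lambda>x. f x * g x) \<in> borel_measurable \<mu>"
    using assms by (auto simp: L2_def)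
qed

lemma L2_cmult: "f \<in> L2 \<mu> \<Longrightarrow> (\<lambda>x. c * f x) \<in> L2 \<mu>"
  by (auto simp: L2_def power_mult_distrib)

lemma L2_add:
  assumes "f \<in> L2 \<mu>" "g \<in> L2 \<mu>" shows "(\<lambda>x. f x + g x) \<in> L2 \<mu>"
proof -
  have "integrable \<mu> (\<lambda>x. (f x)\<^sup>2 + 2 * (f x * g x) + (g x)\<^sup>2)"
    using assms L2_integrable_mult[OF assms]
    by (intro Bochner_Integration.integrable_add integrable_mult_right) (auto simp: L2_def)
  moreover have "(\<lambda>x. (f x)\<^sup>2 + 2 * (f x * g x) + (g x)\<^sup>2) = (\<lambda>x. (f x + g x)\<^sup>2)"
    by (simp add: power2_sum algebra_simps)
  ultimately show ?thesis using assms by (auto simp: L2_def)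
qed

lemma L2_zero: "(\<lambda>x. 0) \<in> L2 \<mu>"
  by (simp add: L2_def)

lemma L2_sum:
  assumes "finite I" "\<And>i. i \<in> I \<Longrightarrow> f i \<in> L2 \<mu>" shows "(\<lambda>x. \<Sum>i\<in>I. c i * f i x) \<in> L2 \<mu>"
  using assms by (induction I rule: finite_induct) (auto intro!: L2_add L2_cmult L2_zero)

lemma L2_functional_sum:
  assumes "L2_functional \<mu> \<Lambda>" "finite I" "\<And>i. i \<in> I \<Longrightarrow> f i \<in> L2 \<mu>"
  shows "\<Lambda> (\<lambda>x. \<Sum>i\<in>I. c i * f i x) = (\<Sum>i\<in>I. c i * \<Lambda> (f i))"
proof -
  have add: "\<Lambda> (\<lambda>x. f x + g x) = \<Lambda> f + \<Lambda> g" if "f \<in> L2 \<mu>" "g \<in> L2 \<mu>" for f g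
    using assms(1) that unfolding L2_functional_def by blast
  have cmult: "\<Lambda> (\<lambda>x. c * f x) = c * \<Lambda> f" if "f \<in> L2 \<mu>" for c f
    using assms(1) that unfolding L2_functional_def by blast
  show ?thesis
    using assms(2,3)
  proof (induction I rule: finite_induct)
    case empty
    show ?case using cmult[OF L2_zero, of 0] by simp
  next
    case (insert k I)
    have "\<Lambda> (\<lambda>x. c k * f k x + (\<Sum>i\<in>I. c i * f i x)) =
        \<Lambda> (\<lambda>x. c k * f k x) + \<Lambda> (\<lambda>x. \<Sum>i\<in>I. c i * f i x)"
      by (rule add) (use insert in \<open>auto intro!: L2_cmult L2_sum\<close>)
    also have "\<dots> = c k * \<Lambda> (f k) + (\<Sum>i\<in>I. c i * \<Lambda> (f i))"
      using insert.IH insert.prems cmult[of "f k" "c k"] by simp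
    finally show ?case using insert.hyps by simp
  qed
qed

lemma L2_functional_integral:
  assumes h: "h \<in> L2 \<mu>" shows "L2_functional \<mu> (\<lambda>f. \<integral>x. h x * f x \<partial>\<mu>)"
  unfolding L2_functional_def
proof (intro conjI ballI allI impI)
  fix f g assume f: "f \<in> L2 \<mu>" and g: "g \<in> L2 \<mu>"
  show "(\<integral>x. h x * (f x + g x) \<partial>\<mu>) = (\<integral>x. h x * f x \<partial>\<mu>) + (\<integral>x. h x * g x \<partial>\<mu>)"
    using L2_integrable_mult[OF h f] L2_integrable_mult[OF h g] by (simp add: distrib_left)
  show "(\<integral>x. h x * f x \<partial>\<mu>) = (\<integral>x. h x * g x \<partial>\<mu>)" if "AE x in \<mu>. f x = g x"
  proof (rule integral_cong_AE)
    show "AE x in \<mu>. h x * f x = h x * g x" using that by eventually_elim simp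
  qed (use L2_measurable[OF f] L2_measurable[OF g] L2_measurable[OF h] in auto)
next
  fix c f assume f: "f \<in> L2 \<mu>"
  have "(\<integral>x. h x * (c * f x) \<partial>\<mu>) = (\<integral>x. c * (h x * f x) \<partial>\<mu>)"
    by (simp only: mult.left_commute)
  then show "(\<integral>x. h x * (c * f x) \<partial>\<mu>) = c * (\<integral>x. h x * f x \<partial>\<mu>)" by simp
qed

text \<open>The vectors of pairings with square-integrable functions are separated by
  \<open>separating_vector\<close>. A relation among the pairings would produce a nontrivial
  combination of the \<open>f i\<close> that is orthogonal to itself and so vanishes almost
  everywhere.\<close>

lemma L2_dual_family:
  assumes "finite I" and f: "\<And>i. i \<in> I \<Longrightarrow> f i \<in> L2 \<mu>"
    and indep: "\<And>c. AE x in \<mu>. (\<Sum>i\<in>I. c i * f i x) = 0 \<Longrightarrow> \<forall>i\<in>I. c i = 0"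
  shows "\<exists>\<Lambda>. (\<forall>i\<in>I. L2_functional \<mu> (\<Lambda> i)) \<and> (\<forall>i\<in>I. \<forall>j\<in>I. \<Lambda> i (f j) = (if i = j then 1 else 0))"
proof -
  have "\<exists>\<Lambda>. L2_functional \<mu> \<Lambda> \<and> (\<forall>j\<in>I. \<Lambda> (f j) = (if k = j then 1 else 0))" if k: "k \<in> I" for k
  proof -
    define W where "W = (\<lambda>h i. if i \<in> I then \<integral>x. h x * f i x \<partial>\<mu> else 0) ` L2 \<mu>"
    have "\<exists>w\<in>W. w k = 1 \<and> (\<forall>i\<in>I - {k}. w i = 0)"
    proof (rule separating_vector)
      fix u v s assume "u \<in> W" "v \<in> W"
      then obtain g h where g: "g \<in> L2 \<mu>" "u = (\<lambda>i. if i \<in> I then \<integral>x. g x * f i x \<partial>\<mu> else 0)"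
        and h: "h \<in> L2 \<mu>" "v = (\<lambda>i. if i \<in> I then \<integral>x. h x * f i x \<partial>\<mu> else 0)"
        by (auto simp: W_def)
      have "(\<integral>x. (g x + s * h x) * f i x \<partial>\<mu>) = (\<integral>x. g x * f i x \<partial>\<mu>) + s * (\<integral>x. h x * f i x \<partial>\<mu>)"
        if "i \<in> I" for i
      proof -
        have "(\<integral>x. (g x + s * h x) * f i x \<partial>\<mu>) = (\<integral>x. g x * f i x + s * (h x * f i x) \<partial>\<mu>)"
          by (simp only: distrib_right mult.assoc)
        then show ?thesis
          using L2_integrable_mult[OF g(1) f[OF that]] L2_integrable_mult[OF h(1) f[OF that]] by simp
      qed
      then have "(\<lambda>i. u i + s * v i) = (\<lambda>i. if i \<in> I then \<integral>x. (g x + s * h x) * f i x \<partial>\<mu> else 0)"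
        unfolding g(2) h(2) by auto
      moreover have "(\<lambda>x. g x + s * h x) \<in> L2 \<mu>" using g(1) h(1) by (intro L2_add L2_cmult)
      ultimately show "(\<lambda>i. u i + s * v i) \<in> W"
        unfolding W_def by (rule image_eqI[where x = "\<lambda>x. g x + s * h x"])
    next
      fix c
      show "\<exists>w\<in>W. w k \<noteq> (\<Sum>i\<in>I - {k}. c i * w i)"
      proof (rule ccontr)
        assume "\<not> ?thesis"
        then have *: "w k = (\<Sum>i\<in>I - {k}. c i * w i)" if "w \<in> W" for w using that by blast
        \<comment> \<open>The test function \<open>h\<close> is \<open>f k\<close> minus the
          combination of the others with coefficients \<open>c\<close>; the assumed relation,
          evaluated for \<open>h\<close>, says that the integral of its square is 0.\<close>
        define c' where "c' = (\<lambda>i. if i = k then 1 else - c i)"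
        define h where "h = (\<lambda>x. \<Sum>i\<in>I. c' i * f i x)"
        have h: "h \<in> L2 \<mu>" unfolding h_def using assms(1) f by (intro L2_sum)
        have "(h x)\<^sup>2 = (\<Sum>i\<in>I. c' i * (h x * f i x))" for x
        proof -
          have "(h x)\<^sup>2 = h x * (\<Sum>i\<in>I. c' i * f i x)" by (simp add: power2_eq_square h_def)
          then show ?thesis by (simp only: sum_distrib_left mult.left_commute)
        qed
        then have "(\<integral>x. (h x)\<^sup>2 \<partial>\<mu>) = (\<integral>x. (\<Sum>i\<in>I. c' i * (h x * f i x)) \<partial>\<mu>)" by simp
        also have "\<dots> = (\<Sum>i\<in>I. c' i * (\<integral>x. h x * f i x \<partial>\<mu>))"
          using L2_integrable_mult[OF h f] by (subst Bochner_Integration.integral_sum) auto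
        also have "\<dots> = (\<integral>x. h x * f k x \<partial>\<mu>) - (\<Sum>i\<in>I - {k}. c i * (\<integral>x. h x * f i x \<partial>\<mu>))"
          using assms(1) k by (subst sum.remove[of _ k]) (auto simp: c'_def sum_negf[symmetric] intro!: sum.cong)
        also have "\<dots> = 0"
        proof -
          note *[of "\<lambda>i. if i \<in> I then \<integral>x. h x * f i x \<partial>\<mu> else 0"]
          moreover have "(\<lambda>i. if i \<in> I then \<integral>x. h x * f i x \<partial>\<mu> else 0) \<in> W" unfolding W_def using h by (rule imageI)
          ultimately have "(if k \<in> I then \<integral>x. h x * f k x \<partial>\<mu> else 0) =
              (\<Sum>i\<in>I - {k}. c i * (if i \<in> I then \<integral>x. h x * f i x \<partial>\<mu> else 0))"
            by simp
          then show ?thesis using k by simp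
        qed
        finally have "(\<integral>x. (h x)\<^sup>2 \<partial>\<mu>) = 0" .
        then have "AE x in \<mu>. (h x)\<^sup>2 = 0"
          using h integral_nonneg_eq_0_iff_AE[of \<mu> "\<lambda>x. (h x)\<^sup>2"] by (simp add: L2_def)
        then have "AE x in \<mu>. (\<Sum>i\<in>I. c' i * f i x) = 0" by (simp add: h_def)
        then have "c' k = 0" using indep[of c'] k by blast
        then show False by (simp add: c'_def)
      qed
    qed (use assms(1) in auto)
    then obtain w where w: "w \<in> W" "w k = 1" "\<And>i. i \<in> I - {k} \<Longrightarrow> w i = 0" by blast
    then obtain h where h: "h \<in> L2 \<mu>" "w = (\<lambda>i. if i \<in> I then \<integral>x. h x * f i x \<partial>\<mu> else 0)"
      unfolding W_def by (elim imageE)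
    have "(\<integral>x. h x * f j x \<partial>\<mu>) = (if k = j then 1 else 0)" if "j \<in> I" for j
      using fun_cong[OF h(2), of j] w(2) w(3)[of j] that by auto
    then show ?thesis using L2_functional_integral[OF h(1)] by (intro exI[of _ "\<lambda>f. \<integral>x. h x * f x \<partial>\<mu>"]) blast
  qed
  then have "\<forall>k\<in>I. \<exists>\<Lambda>. L2_functional \<mu> \<Lambda> \<and> (\<forall>j\<in>I. \<Lambda> (f j) = (if k = j then 1 else 0))" by blast
  from bchoice[OF this] show ?thesis by blast
qed

section \<open>Elements, charts and volume\<close>

text \<open>Coordinates are released one at a time, those outside \<open>K\<close> being frozen at
  \<open>y\<close>. Releasing \<open>k\<close> interpolates linearly between the maps frozen at 0
  and at 1 in this coordinate, which are differentiable by induction.\<close>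

lemma d_linear_differentiable:
  fixes F :: "real^'d::finite \<Rightarrow> real^'d"
  assumes "d_linear F"
  shows "F differentiable (at x)"
proof -
  have "(\<lambda>x. F (\<chi> l. if l \<in> K then x $ l else y $ l)) differentiable (at x)" for K y x
    using finite[of K]
  proof (induction K arbitrary: y rule: finite_induct)
    case (insert k K)
    let ?m = "\<lambda>t x. F (\<chi> l. if l \<in> K then x $ l else (\<chi> i. if i = k then t else y $ i) $ l)"
    have "(\<lambda>x. F (\<chi> l. if l \<in> insert k K then x $ l else y $ l)) =
        (\<lambda>x. (1 - x $ k) *\<^sub>R ?m 0 x + x $ k *\<^sub>R ?m 1 x)"
    proof
      fix x :: "real^'d"
      let ?p = "\<chi> l. if l \<in> K then x $ l else (\<chi> i. if i = k then 0 else y $ i) $ l"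
      have "(\<chi> l. if l \<in> insert k K then x $ l else y $ l) = ?p + x $ k *\<^sub>R axis k 1"
        "(\<chi> l. if l \<in> K then x $ l else (\<chi> i. if i = k then 1 else y $ i) $ l) = ?p + axis k 1"
        using insert.hyps by (auto simp: vec_eq_iff axis_def)
      then show "F (\<chi> l. if l \<in> insert k K then x $ l else y $ l) =
          (1 - x $ k) *\<^sub>R ?m 0 x + x $ k *\<^sub>R ?m 1 x"
        using assms[unfolded d_linear_def, rule_format, of ?p "x $ k" k] by simp
    qed
    moreover have "(\<lambda>x. x $ k) differentiable at x" for x :: "real^'d"
      by (intro bounded_linear_imp_differentiable bounded_linear_vec_nth)
    ultimately show ?case
      using insert.IH by (auto intro!: differentiable_add differentiable_scaleR differentiable_diff)
  qed simp
  from this[of UNIV] show ?thesis by simp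
qed

lemma d_linear_continuous: "d_linear F \<Longrightarrow> continuous_on S F"
  using d_linear_differentiable differentiable_imp_continuous_within
  by (intro continuous_at_imp_continuous_on ballI) blast

lemma element_open:
  assumes "element q" shows "open q"
proof -
  obtain F where F: "d_linear F" "inj_on F (cbox 0 1)" "q = F ` box 0 1"
    using assms by (auto simp: element_def parametrizes_def)
  then show ?thesis
    using inj_on_subset[OF F(2) box_subset_cbox] d_linear_continuous[OF F(1)]
    by (auto intro: invariance_of_domain)
qed

text \<open>The compact image of the closed cube contains the closure of \<open>q\<close>. The
  boundary of \<open>q\<close> thus lies in the image of the boundary of the cube, which is null
  because \<open>F\<close> is differentiable.\<close>

lemma element_boundary_null:
  assumes "element q" shows "negligible (closure q - q)"
proof -
  obtain F where F: "d_linear F" "q = F ` box 0 1"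
    using assms by (auto simp: element_def parametrizes_def)
  have "compact (F ` cbox 0 1)"
    by (intro compact_continuous_image d_linear_continuous F compact_cbox)
  moreover have "q \<subseteq> F ` cbox 0 1" using F box_subset_cbox by blast
  ultimately have "closure q \<subseteq> F ` cbox 0 1" by (simp add: closure_minimal compact_imp_closed)
  then have "closure q - q \<subseteq> F ` (cbox 0 1 - box 0 1)" using F by blast
  moreover have "negligible (F ` (cbox 0 1 - box 0 1))"
    using F(1) by (intro negligible_differentiable_image_negligible negligible_frontier_interval)
      (auto intro!: differentiable_at_imp_differentiable_on d_linear_differentiable)
  ultimately show ?thesis by (rule negligible_subset[rotated])
qed

text \<open>The interior of a closed set contains every open subset of its own closure. A mesh is
  tied to its chart only through closures; this fact places the open elements inside the
  chart.\<close>

lemma open_polytope_regular: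
  assumes "open_polytope W" "open U" "U \<subseteq> closure W" shows "U \<subseteq> W"
proof -
  obtain P where P: "finite P" "\<And>C. C \<in> P \<Longrightarrow> polytope C" "W = interior (\<Union>P)"
    using assms(1) by (auto simp: open_polytope_def)
  have "closed (\<Union>P)" using P polytope_imp_closed by (intro closed_Union) auto
  then have "closure W \<subseteq> \<Union>P" unfolding P(3) by (simp add: closure_minimal interior_subset)
  then show ?thesis using assms(2,3) unfolding P(3) by (meson interior_maximal order_trans)
qed

lemma open_polytope_bounded:
  assumes "open_polytope W" shows "bounded W"
proof -
  obtain P where P: "finite P" "\<And>C. C \<in> P \<Longrightarrow> polytope C" "W = interior (\<Union>P)"
    using assms(1) by (auto simp: open_polytope_def)
  then have "bounded (\<Union>P)" using polytope_imp_bounded by (intro bounded_Union) auto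
  then show ?thesis unfolding P(3) using bounded_subset interior_subset by blast
qed

section \<open>Mesh elements, transition domains and the quotient\<close>

locale meshed =
  fixes M :: "('d::finite, 'z) meshed_manifold_scheme"
  assumes manifold: "is_proto_manifold M"
    and mesh: "is_proto_mesh M"
begin

lemma chart_polytope: "i < num_charts M \<Longrightarrow> open_polytope (chart M i)"
  using manifold by (simp add: is_proto_manifold_def)

lemma open_tdom: "i < num_charts M \<Longrightarrow> j < num_charts M \<Longrightarrow> open (tdom M i j)"
  using manifold by (simp add: is_proto_manifold_def)

lemma open_chart: "i < num_charts M \<Longrightarrow> open (chart M i)"
  using open_tdom[of i i] is_proto_manifoldD(1)[OF manifold, of i i] by simp

lemma continuous_transition:
  "i < num_charts M \<Longrightarrow> j < num_charts M \<Longrightarrow> continuous_on (tdom M i j) (transition M i j)"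
  using is_proto_manifoldD(3)[OF manifold, of i j] by (auto intro: homeomorphism_cont1)

lemma transition_tdom:
  "i < num_charts M \<Longrightarrow> j < num_charts M \<Longrightarrow> x \<in> tdom M i j \<Longrightarrow> transition M i j x \<in> tdom M j i"
  using is_proto_manifoldD(3)[OF manifold, of i j] by (auto dest: homeomorphism_image1)

lemma tdom_subset: "i < num_charts M \<Longrightarrow> j < num_charts M \<Longrightarrow> tdom M i j \<subseteq> chart M i"
  using is_proto_manifoldD(2)[OF manifold] .

lemma mesh_of: "i < num_charts M \<Longrightarrow> mesh_of (chart M i) (mesh M i)"
  using mesh by (simp add: is_proto_mesh_def)

lemma mesh_open: "i < num_charts M \<Longrightarrow> q \<in> mesh M i \<Longrightarrow> open q"
  using mesh_of[of i] element_open[of q] by (simp add: mesh_of_def)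

lemma mesh_subset_chart:
  assumes "i < num_charts M" "q \<in> mesh M i" shows "q \<subseteq> chart M i"
proof -
  have "q \<subseteq> closure (chart M i)"
    using mesh_of[OF assms(1)] assms(2) closure_subset unfolding mesh_of_def by blast
  then show ?thesis
    using open_polytope_regular[OF chart_polytope[OF assms(1)] mesh_open[OF assms]] by blast
qed

lemma skeleton_null:
  assumes "i < num_charts M" shows "negligible (chart M i - \<Union>(mesh M i))"
proof -
  have m: "finite (mesh M i)" "\<And>q. q \<in> mesh M i \<Longrightarrow> element q"
    "(\<Union>q\<in>mesh M i. closure q) = closure (chart M i)"
    using mesh_of[OF assms] by (auto simp: mesh_of_def)
  have "negligible (\<Union>q\<in>mesh M i. closure q - q)"
    using m element_boundary_null by (intro negligible_Union) auto
  moreover have "chart M i - \<Union>(mesh M i) \<subseteq> (\<Union>q\<in>mesh M i. closure q - q)"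
  proof
    fix x assume x: "x \<in> chart M i - \<Union>(mesh M i)"
    then have "x \<in> (\<Union>q\<in>mesh M i. closure q)" using m(3) closure_subset[of "chart M i"] by auto
    then show "x \<in> (\<Union>q\<in>mesh M i. closure q - q)" using x by blast
  qed
  ultimately show ?thesis by (rule negligible_subset)
qed

text \<open>An open element that meets the closure of another meets that element itself, and
  disjointness makes the two equal. Hence an element lies in a transition domain or misses
  it.\<close>

lemma mesh_subset_tdom:
  assumes ij: "i < num_charts M" "j < num_charts M" and q: "q \<in> mesh M i"
    and x: "x \<in> q" "x \<in> tdom M i j"
  shows "q \<subseteq> tdom M i j"
proof -
  obtain T where T: "T \<subseteq> mesh M i" "tdom M i j = merge T"
    using mesh ij unfolding is_proto_mesh_def by meson
  obtain q' where q': "q' \<in> T" "x \<in> closure q'"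
    using x(2) interior_subset unfolding T(2) merge_def by blast
  have "q \<inter> q' \<noteq> {}"
    using q'(2) x(1) open_Int_closure_eq_empty[OF mesh_open[OF ij(1) q]] by blast
  then have "q = q'"
    using mesh_of[OF ij(1)] q q'(1) T(1) unfolding mesh_of_def pairwise_def disjnt_def by blast
  then have "q \<subseteq> (\<Union>q\<in>T. closure q)" using q'(1) closure_subset by blast
  then show ?thesis unfolding T(2) merge_def
    by (rule interior_maximal) (rule mesh_open[OF ij(1) q])
qed

lemma transition_mesh:
  assumes "i < num_charts M" "j < num_charts M" "q \<in> mesh M i" "q \<subseteq> tdom M i j"
  shows "transition M i j ` q \<in> mesh M j"
  using mesh assms unfolding is_proto_mesh_def by meson

lemma proj_eq_iff:
  assumes "i < num_charts M" "j < num_charts M" "x \<in> chart M i" "y \<in> chart M j"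
  shows "proj M i x = proj M j y \<longleftrightarrow> x \<in> tdom M i j \<and> transition M i j x = y"
proof -
  have "proj M i x = proj M j y \<longleftrightarrow> ((i, x), (j, y)) \<in> glue M"
    unfolding proj_def using eq_equiv_class_iff[OF equiv_glue[OF manifold]] assms by simp
  then show ?thesis using assms transition_tdom by (auto simp: glue_def)
qed

lemma proj_transition:
  assumes "i < num_charts M" "j < num_charts M" "x \<in> tdom M i j"
  shows "proj M j (transition M i j x) = proj M i x"
proof -
  have "x \<in> chart M i" "transition M i j x \<in> chart M j"
    using assms(3) transition_tdom[OF assms] tdom_subset[OF assms(1,2)] tdom_subset[OF assms(2,1)]
    by auto
  then show ?thesis using proj_eq_iff[OF assms(1,2)] assms(3) by metis
qed

lemma proj_in_Omega_chart:
  assumes "i < num_charts M" "j < num_charts M" "x \<in> chart M i"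
  shows "proj M i x \<in> Omega_chart M j \<longleftrightarrow> x \<in> tdom M i j"
proof
  assume "proj M i x \<in> Omega_chart M j"
  then obtain y where "y \<in> chart M j" "proj M i x = proj M j y" by (auto simp: Omega_chart_def)
  then show "x \<in> tdom M i j" using proj_eq_iff[OF assms] by simp
next
  assume x: "x \<in> tdom M i j"
  then have "transition M i j x \<in> chart M j"
    using transition_tdom[OF assms(1,2)] tdom_subset[OF assms(2,1)] by blast
  then show "proj M i x \<in> Omega_chart M j"
    unfolding Omega_chart_def using proj_transition[OF assms(1,2) x] by (metis imageI)
qed

lemma proj_in_Omega: "i < num_charts M \<Longrightarrow> x \<in> chart M i \<Longrightarrow> proj M i x \<in> Omega M"
  unfolding Omega_def proj_def by (rule quotientI) simp

lemma Omega_cases: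
  assumes "P \<in> Omega M"
  obtains i x where "i < num_charts M" "x \<in> chart M i" "P = proj M i x"
proof -
  obtain u where u: "u \<in> (SIGMA i:{..<num_charts M}. chart M i)" "P = glue M `` {u}"
    using assms unfolding Omega_def by (rule quotientE)
  then show thesis using that[of "fst u" "snd u"] by (auto simp: proj_def)
qed

lemma inv_proj:
  assumes "i < num_charts M" "x \<in> chart M i"
  shows "inv_into (chart M i) (proj M i) (proj M i x) = x"
  using inj_on_proj[OF manifold assms(1)] assms(2) by simp

lemma openin_proj_image:
  assumes "i < num_charts M" "open V" "V \<subseteq> chart M i"
  shows "openin (Omega_top M) (proj M i ` V)"
  unfolding openin_Omega_top
proof (intro conjI allI impI)
  show "proj M i ` V \<subseteq> Omega M" using assms proj_in_Omega by blast
  fix j assume j: "j < num_charts M"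
  have "{x \<in> chart M j. proj M j x \<in> proj M i ` V} = tdom M j i \<inter> transition M j i -` V" (is "?L = ?R")
  proof
    show "?L \<subseteq> ?R"
    proof
      fix x assume "x \<in> ?L"
      then obtain y where y: "x \<in> chart M j" "y \<in> V" "proj M j x = proj M i y" by blast
      then have "x \<in> tdom M j i \<and> transition M j i x = y"
        using proj_eq_iff[OF j assms(1), of x y] assms(3) by blast
      then show "x \<in> ?R" using y(2) by simp
    qed
    show "?R \<subseteq> ?L"
    proof
      fix x assume x: "x \<in> ?R"
      then have "proj M j x = proj M i (transition M j i x)" "x \<in> chart M j"
        using proj_transition[OF j assms(1)] tdom_subset[OF j assms(1)] by auto
      then show "x \<in> ?L" using x by simp
    qed
  qed
  moreover have "open (tdom M j i \<inter> transition M j i -` V)"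
    using continuous_on_open_vimage[OF open_tdom[OF j assms(1)]] continuous_transition[OF j assms(1)]
      assms(2)
    by (metis Int_commute)
  ultimately show "open {x \<in> chart M j. proj M j x \<in> proj M i ` V}" by simp
qed

lemma subset_supp:
  assumes "openin (Omega_top M) U" "\<And>P. P \<in> U \<Longrightarrow> f P \<noteq> 0"
  shows "U \<subseteq> supp M f"
proof -
  have "U \<subseteq> Omega M" using assms(1) by (simp add: openin_Omega_top)
  then have "U \<subseteq> {P \<in> Omega M. f P \<noteq> 0}" using assms(2) by blast
  moreover have "topspace (Omega_top M) = Omega M"
  proof -
    have "openin (Omega_top M) (Omega M)"
      unfolding openin_Omega_top
    proof (intro conjI allI impI subset_refl)
      fix i assume i: "i < num_charts M"
      then have "{x \<in> chart M i. proj M i x \<in> Omega M} = chart M i" using proj_in_Omega by blast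
      then show "open {x \<in> chart M i. proj M i x \<in> Omega M}" using open_chart[OF i] by simp
    qed
    moreover have "V \<subseteq> Omega M" if "openin (Omega_top M) V" for V
      using that by (simp add: openin_Omega_top)
    ultimately show ?thesis unfolding topspace_def by blast
  qed
  ultimately have "U \<subseteq> Omega_top M closure_of {P \<in> Omega M. f P \<noteq> 0}"
    using closure_of_subset[of "{P \<in> Omega M. f P \<noteq> 0}" "Omega_top M"] by auto
  then show ?thesis unfolding supp_def using assms(1) by (rule interior_of_maximal)
qed

end

section \<open>Determinants of coercive and bounded forms\<close>

lemma continuous_on_det: "continuous_on S (det :: real^'n::finite^'n \<Rightarrow> real)"
  unfolding det_def by (intro continuous_intros)

text \<open>The segment from the identity to \<open>A\<close> consists of positive definite forms,
  so the determinant has no zero on it and keeps the sign it has at the identity.\<close>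

lemma det_pos_of_coercive:
  fixes A :: "real^'n::finite^'n"
  assumes "c > 0" "\<And>v. c * (v \<bullet> v) \<le> v \<bullet> (A *v v)"
  shows "det A > 0"
proof (rule ccontr)
  assume "\<not> det A > 0"
  let ?f = "\<lambda>s. det ((1 - s) *\<^sub>R mat 1 + s *\<^sub>R A)"
  have "continuous_on {0..1} ?f"
    by (intro continuous_on_compose2[OF continuous_on_det[of UNIV]] continuous_intros) auto
  moreover have "?f 1 \<le> 0" "0 \<le> ?f 0" using \<open>\<not> det A > 0\<close> by auto
  ultimately obtain s where s: "0 \<le> s" "s \<le> 1" "?f s = 0"
    using IVT2'[of ?f 1 0 0] by auto
  then have "\<not> invertible ((1 - s) *\<^sub>R mat 1 + s *\<^sub>R A)" by (simp add: invertible_det_nz)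
  then obtain v where v: "v \<noteq> 0" "((1 - s) *\<^sub>R mat 1 + s *\<^sub>R A) *v v = 0"
    using invertible_left_inverse matrix_left_invertible_ker by blast
  have "((1 - s) *\<^sub>R mat 1 + s *\<^sub>R A) *v v = (1 - s) *\<^sub>R v + s *\<^sub>R (A *v v)"
    by (simp add: matrix_vector_mult_add_rdistrib scaleR_matrix_vector_assoc[symmetric])
  then have "0 = v \<bullet> ((1 - s) *\<^sub>R v + s *\<^sub>R (A *v v))" using v by simp
  also have "\<dots> = (1 - s) * (v \<bullet> v) + s * (v \<bullet> (A *v v))" by (simp add: inner_add_right)
  also have "\<dots> > 0"
  proof (cases "s = 0")
    case False
    have "0 < c * (v \<bullet> v)" using assms(1) v(1) by simp
    then have "0 < s * (v \<bullet> (A *v v))" using assms(2)[of v] s(1) False by simp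
    moreover have "0 \<le> (1 - s) * (v \<bullet> v)" using s(2) by simp
    ultimately show ?thesis by linarith
  qed (use v in simp)
  finally show False by simp
qed

text \<open>Polarisation with sums and differences of unit vectors bounds every entry by
  \<open>\<bar>C\<bar>\<close>; the Leibniz formula does the rest.\<close>

lemma det_le_of_bounded_form:
  fixes A :: "real^'n::finite^'n"
  assumes sym: "transpose A = A" and pos: "\<And>v. 0 \<le> v \<bullet> (A *v v)"
    and bound: "\<And>v. v \<bullet> (A *v v) \<le> C * (v \<bullet> v)"
  shows "\<bar>det A\<bar> \<le> (\<Sum>p | p permutes (UNIV :: 'n set). \<bar>C\<bar> ^ CARD('n))"
proof -
  have entry: "\<bar>A $ i $ j\<bar> \<le> \<bar>C\<bar>" for i j
  proof -
    let ?e = "\<lambda>i. axis i 1 :: real^'n"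
    have a: "?e i \<bullet> (A *v ?e j) = A $ i $ j" for i j
      by (simp add: matrix_vector_mul_component inner_axis' inner_axis) 
    have "A $ j $ i = A $ i $ j" by (metis sym transpose_def vec_lambda_beta)
    then have p: "(?e i + ?e j) \<bullet> (A *v (?e i + ?e j)) = A $ i $ i + A $ j $ j + 2 * A $ i $ j"
      and m: "(?e i - ?e j) \<bullet> (A *v (?e i - ?e j)) = A $ i $ i + A $ j $ j - 2 * A $ i $ j"
      by (simp_all add: matrix_vector_right_distrib matrix_vector_mult_diff_distrib inner_add_left inner_add_right
          inner_diff_left inner_diff_right a)
    \<comment> \<open>By the parallelogram identity each squared length is at most 4. This includes
      \<open>i = j\<close>, where the difference is 0.\<close>
    have n: "(?e i + ?e j) \<bullet> (?e i + ?e j) + (?e i - ?e j) \<bullet> (?e i - ?e j) = 4"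
      by (simp add: inner_add_left inner_add_right inner_diff_left inner_diff_right inner_axis_axis)
    have k: "v \<bullet> (A *v v) \<le> \<bar>C\<bar> * (v \<bullet> v)" for v
      using bound[of v] mult_right_mono[OF abs_ge_self[of C], of "v \<bullet> v"] by simp
    have "(?e i + ?e j) \<bullet> (?e i + ?e j) \<le> 4" "(?e i - ?e j) \<bullet> (?e i - ?e j) \<le> 4"
      using n inner_ge_zero[of "?e i + ?e j"] inner_ge_zero[of "?e i - ?e j"] by linarith+
    then have "\<bar>C\<bar> * ((?e i + ?e j) \<bullet> (?e i + ?e j)) \<le> \<bar>C\<bar> * 4"
      "\<bar>C\<bar> * ((?e i - ?e j) \<bullet> (?e i - ?e j)) \<le> \<bar>C\<bar> * 4"
      by (intro mult_left_mono; simp)+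
    then show ?thesis
      using k[of "?e i + ?e j"] k[of "?e i - ?e j"] pos[of "?e i + ?e j"] pos[of "?e i - ?e j"] p m
      by linarith
  qed
  have "\<bar>det A\<bar> \<le> (\<Sum>p | p permutes (UNIV :: 'n set). \<bar>of_int (sign p) * (\<Prod>i\<in>UNIV. A $ i $ p i)\<bar>)"
    unfolding det_def by (rule sum_abs)
  also have "\<dots> \<le> (\<Sum>p | p permutes (UNIV :: 'n set). \<bar>C\<bar> ^ CARD('n))"
  proof (rule sum_mono)
    fix p :: "'n \<Rightarrow> 'n"
    have "\<bar>of_int (sign p) * (\<Prod>i\<in>UNIV. A $ i $ p i)\<bar> = (\<Prod>i\<in>UNIV. \<bar>A $ i $ p i\<bar>)"
      by (simp add: abs_mult abs_prod sign_def)
    also have "\<dots> \<le> (\<Prod>i\<in>(UNIV::'n set). \<bar>C\<bar>)" using entry by (intro prod_mono) auto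
    finally show "\<bar>of_int (sign p) * (\<Prod>i\<in>UNIV. A $ i $ p i)\<bar> \<le> \<bar>C\<bar> ^ CARD('n)" by simp
  qed
  finally show ?thesis .
qed

context meshed
begin

text \<open>Nothing is known about \<open>g\<close> on the mesh skeleton, but the skeleton is null,
  and all subsets of a null set are Lebesgue measurable.\<close>

lemma sets_lebesgue_piecewise_continuous:
  assumes "i < num_charts M" "\<And>q. q \<in> mesh M i \<Longrightarrow> continuous_on q g" "U \<in> sets borel"
  shows "{x \<in> chart M i. (g x :: real) \<in> U} \<in> sets lebesgue"
proof -
  let ?W = "\<Union>(mesh M i)"
  have o: "open ?W" using mesh_open[OF assms(1)] by blast
  have "continuous_on ?W g"
    using continuous_on_open_Union[of "mesh M i" g] assms(1,2) mesh_open by blast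
  then have "g \<in> borel_measurable (lebesgue_on ?W)"
    using o by (intro continuous_imp_measurable_on_sets_lebesgue) auto
  then have "g -` U \<inter> ?W \<in> sets (lebesgue_on ?W)"
    using measurable_sets[of g "lebesgue_on ?W" borel U] assms(3) by simp
  then have "g -` U \<inter> ?W \<in> sets lebesgue"
    using o by (simp add: sets_restrict_space_iff)
  moreover have "{x \<in> chart M i - ?W. g x \<in> U} \<in> sets lebesgue"
    by (intro negligible_imp_sets negligible_subset[OF skeleton_null[OF assms(1)]]) auto
  moreover have "{x \<in> chart M i. g x \<in> U} = (g -` U \<inter> ?W) \<union> {x \<in> chart M i - ?W. g x \<in> U}"
    using mesh_subset_chart[OF assms(1)] by blast
  ultimately show ?thesis by simp
qed

lemma chart_lmeasurable: "i < num_charts M \<Longrightarrow> chart M i \<in> lmeasurable"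
  using open_chart open_polytope_bounded[OF chart_polytope] by (simp add: lmeasurable_open)

lemma L2_chart:
  assumes "i < num_charts M" "\<And>q. q \<in> mesh M i \<Longrightarrow> continuous_on q g"
    and "\<And>x. x \<in> \<Union>(mesh M i) \<Longrightarrow> \<bar>g x\<bar> \<le> K"
  shows "g \<in> L2 (lebesgue_on (chart M i))"
proof -
  have m: "g \<in> borel_measurable (lebesgue_on (chart M i))"
  proof (rule measurableI)
    fix U :: "real set" assume "U \<in> sets borel"
    then have "{x \<in> chart M i. g x \<in> U} \<in> sets lebesgue"
      using assms by (intro sets_lebesgue_piecewise_continuous)
    moreover have "g -` U \<inter> space (lebesgue_on (chart M i)) = {x \<in> chart M i. g x \<in> U}" by auto
    ultimately show "g -` U \<inter> space (lebesgue_on (chart M i)) \<in> sets (lebesgue_on (chart M i))"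
      using open_chart[OF assms(1)] by (auto simp: sets_restrict_space_iff)
  qed simp
  interpret finite_measure "lebesgue_on (chart M i)"
    using chart_lmeasurable[OF assms(1)] by (rule finite_measure_lebesgue_on)
  have "AE x in lebesgue_on (chart M i). norm ((g x)\<^sup>2) \<le> K\<^sup>2"
  proof -
    have "AE x in lebesgue. x \<notin> chart M i - \<Union>(mesh M i)"
      using skeleton_null[OF assms(1)] by (intro AE_not_in) (simp add: negligible_iff_null_sets)
    then have "AE x in lebesgue. x \<in> chart M i \<longrightarrow> norm ((g x)\<^sup>2) \<le> K\<^sup>2"
    proof (eventually_elim, intro impI)
      fix x assume "x \<notin> chart M i - \<Union>(mesh M i)" "x \<in> chart M i"
      then have "\<bar>g x\<bar> \<le> K" using assms(3) by blast
      then show "norm ((g x)\<^sup>2) \<le> K\<^sup>2" by (simp add: power2_le_iff_abs_le abs_le_square_iff[symmetric])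
    qed
    then show ?thesis using open_chart[OF assms(1)] by (simp add: AE_restrict_space_iff)
  qed
  then have "integrable (lebesgue_on (chart M i)) (\<lambda>x. (g x)\<^sup>2)"
    using m by (intro integrable_const_bound) auto
  then show ?thesis using m by (simp add: L2_def)
qed

end

section \<open>The volume measure and square-integrability on the manifold\<close>

locale volumetric = meshed M
  for M :: "('d::finite, 'z) meshed_manifold_scheme" +
  assumes metric: "is_metric M"
    and volume: "is_volume M"
begin

definition vol_density :: "nat \<Rightarrow> real^'d \<Rightarrow> real" where
  "vol_density i x = (if x \<in> chart M i then sqrt (det (metric M i x)) else 0)"

lemma metricD:
  assumes "i < num_charts M"
  shows "metric M i \<in> borel_measurable (lebesgue_on (chart M i))"
    "\<And>x. x \<in> chart M i \<Longrightarrow> transpose (metric M i x) = metric M i x"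
    "\<exists>c>0. \<exists>C. \<forall>x\<in>chart M i. \<forall>v.
       c * (v \<bullet> v) \<le> v \<bullet> (metric M i x *v v) \<and> v \<bullet> (metric M i x *v v) \<le> C * (v \<bullet> v)"
  using conjunct1[OF metric[unfolded is_metric_def]] assms by blast+

lemma vol_density_pos:
  assumes "i < num_charts M" "x \<in> chart M i" shows "0 < vol_density i x"
proof -
  obtain c where "c > 0" "\<And>v. c * (v \<bullet> v) \<le> v \<bullet> (metric M i x *v v)"
    using metricD(3)[OF assms(1)] assms(2) by blast
  then have "det (metric M i x) > 0" by (rule det_pos_of_coercive)
  then show ?thesis using assms(2) by (simp add: vol_density_def)
qed

lemma vol_density_bounded:
  assumes "i < num_charts M" shows "\<exists>D. \<forall>x. vol_density i x \<le> D"
proof -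
  obtain c C where c: "c > 0" "\<And>x v. x \<in> chart M i \<Longrightarrow>
      c * (v \<bullet> v) \<le> v \<bullet> (metric M i x *v v) \<and> v \<bullet> (metric M i x *v v) \<le> C * (v \<bullet> v)"
    using metricD(3)[OF assms] by blast
  let ?D = "\<Sum>p | p permutes (UNIV :: 'd set). \<bar>C\<bar> ^ CARD('d)"
  have "vol_density i x \<le> sqrt ?D" for x
  proof (cases "x \<in> chart M i")
    case True
    have "\<bar>det (metric M i x)\<bar> \<le> ?D"
    proof (rule det_le_of_bounded_form)
      show "0 \<le> v \<bullet> (metric M i x *v v)" for v
      proof -
        have "0 \<le> c * (v \<bullet> v)" using c(1) by simp
        then show ?thesis using c(2)[OF True, of v] by linarith
      qed
    qed (use metricD(2)[OF assms True] c(2)[OF True] in auto)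
    then show ?thesis using True by (simp add: vol_density_def)
  next
    case False
    have "0 \<le> ?D" by (intro sum_nonneg) auto
    then show ?thesis using False by (simp add: vol_density_def)
  qed
  then show ?thesis by blast
qed

lemma vol_density_measurable:
  assumes "i < num_charts M" shows "vol_density i \<in> borel_measurable lebesgue"
proof -
  have "(\<lambda>A :: real^'d^'d. sqrt (det A)) \<in> borel_measurable borel"
    by (intro borel_measurable_continuous_onI continuous_intros continuous_on_det)
  then have "(\<lambda>x. sqrt (det (metric M i x))) \<in> borel_measurable (lebesgue_on (chart M i))"
    using measurable_compose[OF metricD(1)[OF assms]] by blast
  then show ?thesis
    using open_chart[OF assms] unfolding vol_density_def[abs_def]
    by (subst borel_measurable_if) auto
qed

lemma emeasure_volume:
  assumes "i < num_charts M" "E \<in> sets lebesgue" "E \<subseteq> chart M i"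
  shows "emeasure (volume M) (proj M i ` E) = (\<integral>\<^sup>+x. ennreal (vol_density i x) * indicator E x \<partial>lebesgue)"
proof -
  have "emeasure (volume M) (proj M i ` E) = (\<integral>\<^sup>+ x\<in>E. ennreal (sqrt (det (metric M i x))) \<partial>lebesgue)"
    using volume assms unfolding is_volume_def by blast
  also have "\<dots> = (\<integral>\<^sup>+x. ennreal (vol_density i x) * indicator E x \<partial>lebesgue)"
    using assms(3) by (intro nn_integral_cong) (auto simp: vol_density_def indicator_def)
  finally show ?thesis .
qed

text \<open>The density is strictly positive on the chart, so the volume and the Lebesgue measure
  have the same null sets there.\<close>

lemma emeasure_volume_eq_0_iff:
  assumes "i < num_charts M" "E \<in> sets lebesgue" "E \<subseteq> chart M i"
  shows "emeasure (volume M) (proj M i ` E) = 0 \<longleftrightarrow> negligible E"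
proof -
  have [measurable]: "vol_density i \<in> borel_measurable lebesgue" "E \<in> sets lebesgue"
    using vol_density_measurable assms by auto
  have "(\<lambda>x. ennreal (vol_density i x) * indicator E x) \<in> borel_measurable lebesgue" by measurable
  then have "emeasure (volume M) (proj M i ` E) = 0 \<longleftrightarrow>
      (AE x in lebesgue. ennreal (vol_density i x) * indicator E x = 0)"
    unfolding emeasure_volume[OF assms] by (rule nn_integral_0_iff_AE)
  also have "\<dots> \<longleftrightarrow> (AE x in lebesgue. x \<notin> E)"
  proof (rule AE_cong)
    fix x :: "real^'d"
    show "ennreal (vol_density i x) * indicator E x = 0 \<longleftrightarrow> x \<notin> E"
      using vol_density_pos[OF assms(1), of x] assms(3) by (cases "x \<in> E") (auto simp: ennreal_eq_0_iff)
  qed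
  also have "\<dots> \<longleftrightarrow> negligible E"
    using assms(2) by (simp add: negligible_iff_null_sets AE_iff_null_sets)
  finally show ?thesis .
qed

lemma space_volume: "space (volume M) = Omega M"
  using volume by (simp add: is_volume_def)

lemma sets_volume_iff:
  "U \<in> sets (volume M) \<longleftrightarrow> U \<subseteq> Omega M \<and>
     (\<forall>i<num_charts M. {x \<in> chart M i. proj M i x \<in> U} \<in> sets lebesgue)"
  using volume by (simp add: is_volume_def)

lemma Omega_chart_sets:
  assumes "j < num_charts M" shows "Omega_chart M j \<in> sets (volume M)"
  unfolding sets_volume_iff
proof (intro conjI allI impI)
  show "Omega_chart M j \<subseteq> Omega M"
    unfolding Omega_chart_def using proj_in_Omega[OF assms] by blast
  fix i assume i: "i < num_charts M"
  have "{x \<in> chart M i. proj M i x \<in> Omega_chart M j} = tdom M i j"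
    using proj_in_Omega_chart[OF i assms] tdom_subset[OF i assms] by blast
  then show "{x \<in> chart M i. proj M i x \<in> Omega_chart M j} \<in> sets lebesgue"
    using open_tdom[OF i assms] by simp
qed

text \<open>Finitely many charts of finite Lebesgue measure, each with bounded density, cover the
  manifold. Measurable functions that are bounded almost everywhere are therefore
  square-integrable.\<close>

lemma finite_volume: "finite_measure (volume M)"
proof
  have "Omega_chart M i \<in> fmeasurable (volume M)" if i: "i < num_charts M" for i
  proof -
    obtain D where D: "\<And>x. vol_density i x \<le> D" using vol_density_bounded[OF i] by blast
    have "emeasure (volume M) (Omega_chart M i) = (\<integral>\<^sup>+x. ennreal (vol_density i x) * indicator (chart M i) x \<partial>lebesgue)"
      unfolding Omega_chart_def using open_chart[OF i] by (intro emeasure_volume i) auto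
    also have "\<dots> \<le> (\<integral>\<^sup>+x. ennreal D * indicator (chart M i) x \<partial>lebesgue)"
      using D by (intro nn_integral_mono mult_right_mono) (auto intro: ennreal_leI)
    also have "\<dots> = ennreal D * emeasure lebesgue (chart M i)"
      using open_chart[OF i] by (intro nn_integral_cmult_indicator) auto
    also have "\<dots> < \<infinity>"
    proof -
      have "emeasure lebesgue (chart M i) < top"
        using chart_lmeasurable[OF i] unfolding fmeasurable_def infinity_ennreal_def by blast
      then show ?thesis using ennreal_mult_less_top ennreal_less_top infinity_ennreal_def by metis
    qed
    finally show ?thesis using Omega_chart_sets[OF i] by (simp add: fmeasurable_def)
  qed
  moreover have "Omega M = (\<Union>i<num_charts M. Omega_chart M i)"
  proof
    show "Omega M \<subseteq> (\<Union>i<num_charts M. Omega_chart M i)"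
    proof
      fix P assume "P \<in> Omega M"
      then obtain i x where "i < num_charts M" "x \<in> chart M i" "P = proj M i x" by (rule Omega_cases)
      then show "P \<in> (\<Union>i<num_charts M. Omega_chart M i)" unfolding Omega_chart_def by blast
    qed
    show "(\<Union>i<num_charts M. Omega_chart M i) \<subseteq> Omega M"
      using Omega_chart_sets sets.sets_into_space[of _ "volume M"] by (auto simp: space_volume)
  qed
  ultimately have "Omega M \<in> fmeasurable (volume M)"
    by (metis (mono_tags, lifting) fmeasurable.finite_UN finite_lessThan lessThan_iff)
  then show "emeasure (volume M) (space (volume M)) \<noteq> \<infinity>"
    unfolding space_volume fmeasurable_def by (simp add: less_top)
qed

lemma L2_volume:
  assumes "j < num_charts M" and outside: "\<And>P. P \<in> Omega M \<Longrightarrow> P \<notin> Omega_chart M j \<Longrightarrow> f P = 0"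
    and cont: "\<And>i q. i < num_charts M \<Longrightarrow> q \<in> mesh M i \<Longrightarrow> continuous_on q (\<lambda>x. f (proj M i x))"
    and bound: "\<And>x. x \<in> \<Union>(mesh M j) \<Longrightarrow> \<bar>f (proj M j x)\<bar> \<le> K"
  shows "f \<in> L2 (volume M)"
proof -
  have m: "f \<in> borel_measurable (volume M)"
  proof (rule measurableI)
    fix U :: "real set" assume U: "U \<in> sets borel"
    show "f -` U \<inter> space (volume M) \<in> sets (volume M)"
      unfolding sets_volume_iff space_volume
    proof (intro conjI allI impI)
      fix i assume i: "i < num_charts M"
      have "{x \<in> chart M i. proj M i x \<in> f -` U \<inter> Omega M} = {x \<in> chart M i. f (proj M i x) \<in> U}"
        using proj_in_Omega[OF i] by blast
      then show "{x \<in> chart M i. proj M i x \<in> f -` U \<inter> Omega M} \<in> sets lebesgue"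
        using sets_lebesgue_piecewise_continuous[OF i cont[OF i] U] by simp
    qed blast
  qed simp
  interpret finite_measure "volume M" by (rule finite_volume)
  let ?E = "chart M j - \<Union>(mesh M j)"
  have "proj M j ` ?E \<in> null_sets (volume M)"
  proof
    show "emeasure (volume M) (proj M j ` ?E) = 0"
      using skeleton_null[OF assms(1)] emeasure_volume_eq_0_iff[OF assms(1) negligible_imp_sets] by blast
    show "proj M j ` ?E \<in> sets (volume M)"
      unfolding sets_volume_iff
    proof (intro conjI allI impI)
      show "proj M j ` ?E \<subseteq> Omega M" using proj_in_Omega[OF assms(1)] by blast
      fix i assume i: "i < num_charts M"
      \<comment> \<open>Transition functions map elements to elements, so seen from chart
        \<open>i\<close> the skeleton of chart \<open>j\<close> lies in the skeleton of chart
        \<open>i\<close>. This yields measurability in every chart.\<close>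
      have "{x \<in> chart M i. proj M i x \<in> proj M j ` ?E} \<subseteq> chart M i - \<Union>(mesh M i)"
      proof
        fix x assume "x \<in> {x \<in> chart M i. proj M i x \<in> proj M j ` ?E}"
        then obtain y where x: "x \<in> chart M i" and y: "y \<in> ?E" "proj M i x = proj M j y" by blast
        then have t: "x \<in> tdom M i j" "transition M i j x = y"
          using proj_eq_iff[OF i assms(1), of x y] by auto
        have "x \<notin> q" if q: "q \<in> mesh M i" for q
        proof
          assume "x \<in> q"
          then have "transition M i j ` q \<in> mesh M j"
            using mesh_subset_tdom[OF i assms(1) q _ t(1)] transition_mesh[OF i assms(1) q] by blast
          then show False using \<open>x \<in> q\<close> t(2) y(1) by blast
        qed
        then show "x \<in> chart M i - \<Union>(mesh M i)" using x by blast
      qed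
      then show "{x \<in> chart M i. proj M i x \<in> proj M j ` ?E} \<in> sets lebesgue"
        by (intro negligible_imp_sets negligible_subset[OF skeleton_null[OF i]])
    qed
  qed
  then have "AE P in volume M. P \<notin> proj M j ` ?E" by (rule AE_not_in)
  moreover have "AE P in volume M. P \<in> Omega M" using space_volume by (intro AE_I2) simp
  ultimately have "AE P in volume M. norm ((f P)\<^sup>2) \<le> K\<^sup>2"
  proof eventually_elim
    fix P assume P: "P \<notin> proj M j ` ?E" "P \<in> Omega M"
    show "norm ((f P)\<^sup>2) \<le> K\<^sup>2"
    proof (cases "P \<in> Omega_chart M j")
      case True
      then obtain x where x: "x \<in> chart M j" "P = proj M j x" by (auto simp: Omega_chart_def)
      then have "x \<in> \<Union>(mesh M j)" using P(1) by blast
      then have "\<bar>f P\<bar> \<le> K" using bound x(2) by blast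
      then show ?thesis by (simp add: abs_le_square_iff[symmetric])
    next
      case False
      then show ?thesis using outside[OF P(2)] by simp
    qed
  qed
  then have "integrable (volume M) (\<lambda>x. (f x)\<^sup>2)"
    using m by (intro integrable_const_bound) auto
  then show ?thesis using m by (simp add: L2_def)
qed

text \<open>By continuity a nonzero value would spread to a nonempty open part of \<open>q\<close>,
  and the image of such a set has positive volume.\<close>

lemma AE_volume_eq_0D:
  assumes i: "i < num_charts M" "q \<in> mesh M i" and x: "x \<in> q"
    and cont: "continuous_on q (\<lambda>x. f (proj M i x))"
    and ae: "AE P in volume M. f P = (0::real)"
  shows "f (proj M i x) = 0"
proof (rule ccontr)
  assume nz: "f (proj M i x) \<noteq> 0"
  let ?V = "{y \<in> q. f (proj M i y) \<noteq> 0}"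
  have oq: "open q" using mesh_open[OF i] .
  have "?V = q \<inter> (\<lambda>x. f (proj M i x)) -` (- {0})" by auto
  moreover have "open (q \<inter> (\<lambda>x. f (proj M i x)) -` (- {0}))"
    using cont oq by (intro continuous_open_preimage) auto
  ultimately have V: "open ?V" by simp
  have sub: "?V \<subseteq> chart M i" using mesh_subset_chart[OF i] by blast
  obtain N where N: "N \<in> sets (volume M)" "emeasure (volume M) N = 0" "{P \<in> space (volume M). f P \<noteq> 0} \<subseteq> N"
    using ae by (auto elim: AE_E)
  have "proj M i ` ?V \<subseteq> N" using N(3) sub proj_in_Omega[OF i(1)] by (auto simp: space_volume)
  then have "emeasure (volume M) (proj M i ` ?V) = 0"
    using emeasure_mono[of "proj M i ` ?V" N "volume M"] N by simp
  then have "negligible ?V" using emeasure_volume_eq_0_iff[OF i(1) _ sub] V by simp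
  then show False using open_not_negligible[OF V] x nz by blast
qed

end

section \<open>Independence of the basis functions\<close>

lemma negligible_coordinate_in_finite:
  fixes l :: "'d::finite"
  assumes "finite K" shows "negligible {x::real^'d. x $ l \<in> K}"
proof -
  have "negligible {x::real^'d. x $ l = t}" for t
    using negligible_standard_hyperplane[of "axis l 1 :: real^'d" t]
    by (simp add: axis_in_Basis_iff inner_axis)
  moreover have "{x::real^'d. x $ l \<in> K} = (\<Union>t\<in>K. {x. x $ l = t})" by blast
  ultimately show ?thesis using assms by (auto intro!: negligible_Union)
qed

section \<open>Indices and basis functions in chart coordinates\<close>

locale bspline_manifold = volumetric S
  for S :: "('d::finite, 'a, 'z) spline_manifold_scheme" +
  fixes pdual :: "nat \<Rightarrow> 'a \<Rightarrow> (real^'d \<Rightarrow> real) \<Rightarrow> real"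
  assumes charts: "admissible_charts S"
    and proto_basis: "is_proto_basis S"
    and splines: "bspline_assumptions S"
    and proto_dual: "is_proto_dual S pdual"
    and compatible: "dual_compatible S"
begin

lemma indexD:
  assumes "A \<in> indices S" "(j, a) \<in> A"
  shows "j < num_charts S" "a \<in> proto_indices S j" "B S A = basis_fun S (j, a)"
proof -
  have "A \<subseteq> (SIGMA i:{..<num_charts S}. proto_indices S i)"
    using in_quotient_imp_subset[OF equiv_same_fun] assms(1) unfolding indices_def by blast
  then show "j < num_charts S" "a \<in> proto_indices S j" using assms(2) by auto
  show "B S A = basis_fun S (j, a)" using B_eq_basis_fun[OF assms] .
qed

lemma index_cases:
  assumes "A \<in> indices S" obtains j a where "(j, a) \<in> A"
  using in_quotient_imp_non_empty[OF equiv_same_fun, of A S] assms unfolding indices_def by auto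

lemma index_eqI:
  assumes A: "A \<in> indices S" and A': "A' \<in> indices S" and "(i, a) \<in> A" "(i, a) \<in> A'"
  shows "A = A'"
proof (rule quotient_eqI[OF equiv_same_fun A[unfolded indices_def] A'[unfolded indices_def] assms(3,4)])
  show "((i, a), (i, a)) \<in> same_fun S"
    using indexD(1,2)[OF A assms(3)] by (simp add: same_fun_def)
qed

lemma finite_proto_indices: "i < num_charts S \<Longrightarrow> finite (proto_indices S i)"
  using proto_basis by (simp add: is_proto_basis_def)

lemma finite_indices: "finite (indices S)"
  unfolding indices_def
proof (rule finite_quotient)
  show "finite (SIGMA i:{..<num_charts S}. proto_indices S i)" using finite_proto_indices by auto
  show "same_fun S \<subseteq> (SIGMA i:{..<num_charts S}. proto_indices S i) \<times> (SIGMA i:{..<num_charts S}. proto_indices S i)"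
    by (auto simp: same_fun_def)
qed

lemma chart_indices_subset: "chart_indices S i \<subseteq> indices S"
  by (auto simp: chart_indices_def)

lemma near_indices_subset: "near_indices S i \<subseteq> indices S"
  by (auto simp: near_indices_def)

lemma basis_fun_proj:
  assumes "i < num_charts S" "j < num_charts S" "x \<in> chart S i"
  shows "basis_fun S (j, a) (proj S i x) =
    (if x \<in> tdom S i j then proto_basis S j a (transition S i j x) else 0)"
proof (cases "x \<in> tdom S i j")
  case True
  then have "transition S i j x \<in> chart S j"
    using transition_tdom[OF assms(1,2)] tdom_subset[OF assms(2,1)] by blast
  then have "inv_into (chart S j) (proj S j) (proj S i x) = transition S i j x"
    using inv_proj[OF assms(2)] proj_transition[OF assms(1,2) True] by metis
  then show ?thesis
    using True proj_in_Omega_chart[OF assms] by (simp add: basis_fun_def)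
next
  case False
  then show ?thesis using proj_in_Omega_chart[OF assms] by (simp add: basis_fun_def)
qed

lemma B_proj_own:
  assumes "A \<in> indices S" "(i, a) \<in> A" "x \<in> chart S i"
  shows "B S A (proj S i x) = proto_basis S i a x"
  using indexD[OF assms(1,2)] basis_fun_proj[of i i x a] assms(3)
    is_proto_manifoldD(1)[OF manifold, of i i] transition_self[OF manifold] by simp

lemma proto_basis_polynomial:
  assumes "i < num_charts S" "a \<in> proto_indices S i" "q \<in> mesh S i"
  obtains f where "real_polynomial_function f" "\<And>x. x \<in> q \<Longrightarrow> proto_basis S i a x = f x"
  using proto_basis assms unfolding is_proto_basis_def by meson

lemma proto_basis_continuous:
  assumes "i < num_charts S" "a \<in> proto_indices S i" "q \<in> mesh S i"
  shows "continuous_on q (proto_basis S i a)"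
proof -
  obtain f where f: "real_polynomial_function f" "\<And>x. x \<in> q \<Longrightarrow> proto_basis S i a x = f x"
    using proto_basis_polynomial[OF assms] by blast
  have "continuous_on q f"
    using continuous_real_polymonial_function[OF f(1)] by (simp add: continuous_at_imp_continuous_on)
  then show ?thesis using f(2) by (simp cong: continuous_on_cong)
qed

lemma proto_basis_bounded:
  assumes "i < num_charts S" "a \<in> proto_indices S i"
  shows "\<exists>K. \<forall>x\<in>\<Union>(mesh S i). \<bar>proto_basis S i a x\<bar> \<le> K"
proof -
  have "\<exists>K. \<forall>x\<in>q. \<bar>proto_basis S i a x\<bar> \<le> K" if q: "q \<in> mesh S i" for q
  proof -
    obtain f where f: "real_polynomial_function f" "\<And>x. x \<in> q \<Longrightarrow> proto_basis S i a x = f x"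
      using proto_basis_polynomial[OF assms q] by blast
    have "bounded q"
      using mesh_subset_chart[OF assms(1) q] open_polytope_bounded[OF chart_polytope[OF assms(1)]]
        bounded_subset by blast
    then have "compact (f ` closure q)"
      using continuous_real_polymonial_function[OF f(1)]
      by (intro compact_continuous_image) (auto simp: continuous_at_imp_continuous_on)
    then obtain K where "\<And>x. x \<in> closure q \<Longrightarrow> \<bar>f x\<bar> \<le> K"
      using compact_imp_bounded bounded_iff by (metis imageI real_norm_def)
    then have "\<forall>x\<in>q. \<bar>proto_basis S i a x\<bar> \<le> K" using f(2) closure_subset by (metis subsetD)
    then show ?thesis ..
  qed
  then obtain K where K: "\<And>q x. q \<in> mesh S i \<Longrightarrow> x \<in> q \<Longrightarrow> \<bar>proto_basis S i a x\<bar> \<le> K q"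
    by metis
  have fin: "finite (mesh S i)" using mesh_of[OF assms(1)] by (simp add: mesh_of_def)
  have "\<forall>x\<in>\<Union>(mesh S i). \<bar>proto_basis S i a x\<bar> \<le> Max (K ` mesh S i)"
  proof
    fix x assume "x \<in> \<Union>(mesh S i)"
    then obtain q where q: "q \<in> mesh S i" "x \<in> q" by blast
    have "K q \<le> Max (K ` mesh S i)" using fin q(1) by simp
    then show "\<bar>proto_basis S i a x\<bar> \<le> Max (K ` mesh S i)" using K[OF q] by linarith
  qed
  then show ?thesis ..
qed

lemma proto_basis_L2:
  assumes "i < num_charts S" "a \<in> proto_indices S i"
  shows "proto_basis S i a \<in> L2 (lebesgue_on (chart S i))"
  using L2_chart[OF assms(1) proto_basis_continuous[OF assms]] proto_basis_bounded[OF assms] by blast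

lemma B_continuous:
  assumes A: "A \<in> indices S" and i: "i < num_charts S" and q: "q \<in> mesh S i"
  shows "continuous_on q (\<lambda>x. B S A (proj S i x))"
proof -
  obtain j a where ja: "(j, a) \<in> A" using A by (rule index_cases)
  note D = indexD[OF A ja]
  have e: "B S A (proj S i x) = (if x \<in> tdom S i j then proto_basis S j a (transition S i j x) else 0)"
    if "x \<in> q" for x
    using basis_fun_proj[OF i D(1)] mesh_subset_chart[OF i q] that D(3) by auto
  show ?thesis
  proof (cases "q \<inter> tdom S i j = {}")
    case True
    then have "B S A (proj S i x) = 0" if "x \<in> q" for x using e that by auto
    then show ?thesis by (simp cong: continuous_on_cong)
  next
    case False
    then have sub: "q \<subseteq> tdom S i j" using mesh_subset_tdom[OF i D(1) q] by blast
    have "continuous_on q (\<lambda>x. proto_basis S j a (transition S i j x))"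
      using continuous_transition[OF i D(1)] sub
      by (intro continuous_on_compose2[OF proto_basis_continuous[OF D(1,2) transition_mesh[OF i D(1) q sub]]])
        (auto intro: continuous_on_subset)
    moreover have "B S A (proj S i x) = proto_basis S j a (transition S i j x)" if "x \<in> q" for x
      using e[OF that] sub that by auto
    ultimately show ?thesis by (simp cong: continuous_on_cong)
  qed
qed

lemma B_L2:
  assumes A: "A \<in> indices S" shows "B S A \<in> L2 (volume S)"
proof -
  obtain j a where ja: "(j, a) \<in> A" using A by (rule index_cases)
  note D = indexD[OF A ja]
  obtain K where K: "\<And>x. x \<in> \<Union>(mesh S j) \<Longrightarrow> \<bar>proto_basis S j a x\<bar> \<le> K"
    using proto_basis_bounded[OF D(1,2)] by blast
  show ?thesis
  proof (rule L2_volume[OF D(1)])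
    show "B S A P = 0" if "P \<notin> Omega_chart S j" for P
      using that D(3) by (simp add: basis_fun_def)
    show "\<bar>B S A (proj S j x)\<bar> \<le> K" if x: "x \<in> \<Union>(mesh S j)" for x
    proof -
      have "x \<in> chart S j" using x mesh_subset_chart[OF D(1)] by blast
      then show ?thesis using B_proj_own[OF A ja] K[OF x] by simp
    qed
  qed (use B_continuous[OF A] in auto)
qed

lemma AE_chartI:
  assumes "i < num_charts S" "negligible N" "\<And>x. x \<in> \<Union>(mesh S i) \<Longrightarrow> x \<notin> N \<Longrightarrow> P x"
  shows "AE x in lebesgue_on (chart S i). P x"
proof -
  have "negligible (N \<union> (chart S i - \<Union>(mesh S i)))" using skeleton_null[OF assms(1)] assms(2) by simp
  then have "AE x in lebesgue. x \<notin> N \<union> (chart S i - \<Union>(mesh S i))"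
    by (intro AE_not_in) (simp add: negligible_iff_null_sets)
  then have "AE x in lebesgue. x \<in> chart S i \<longrightarrow> P x"
    by eventually_elim (use assms(3) in blast)
  then show ?thesis using open_chart[OF assms(1)] by (simp add: AE_restrict_space_iff)
qed

text \<open>The proto-basis is only assumed to be linearly independent as a set of functions, which does not
  exclude functions that vanish off the mesh skeleton. Independence almost everywhere comes from the
  proto-dual functionals.\<close>

lemma chart_functions_independent:
  assumes i: "i < num_charts S" and D: "D \<subseteq> chart_indices S i"
    and zero: "AE x in lebesgue_on (chart S i). (\<Sum>A\<in>D. c A * B S A (proj S i x)) = 0"
    and A: "A \<in> D"
  shows "c A = 0"
proof -
  have ex: "\<exists>a. a \<in> proto_indices S i \<and> (i, a) \<in> A" if "A \<in> D" for A
    using D that by (auto simp: chart_indices_def)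
  then obtain a where a: "\<And>A. A \<in> D \<Longrightarrow> a A \<in> proto_indices S i \<and> (i, a A) \<in> A" by metis
  have ind: "A \<in> indices S" if "A \<in> D" for A using D chart_indices_subset that by blast
  have fin: "finite D" using ind finite_indices by (meson finite_subset subsetI)
  let ?b = "\<lambda>A. proto_basis S i (a A)"
  have L2: "?b A \<in> L2 (lebesgue_on (chart S i))" if "A \<in> D" for A
    using proto_basis_L2[OF i] a[OF that] by blast
  have dual: "L2_functional (lebesgue_on (chart S i)) (pdual i (a A))"
    and dual': "\<And>a'. a' \<in> proto_indices S i \<Longrightarrow> pdual i (a A) (proto_basis S i a') = (if a A = a' then 1 else 0)"
    using proto_dual i a[OF A] unfolding is_proto_dual_def by blast+
  have ne: "a A \<noteq> a A'" if "A' \<in> D" "A' \<noteq> A" for A'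
    using index_eqI[OF ind[OF that(1)] ind[OF A]] a[OF that(1)] a[OF A] that(2) by metis
  have "AE x in lebesgue_on (chart S i). x \<in> chart S i"
    using AE_space[of "lebesgue_on (chart S i)"] by simp
  with zero have ae: "AE x in lebesgue_on (chart S i). (\<Sum>A\<in>D. c A * ?b A x) = 0"
  proof eventually_elim
    case (elim x)
    have "(\<Sum>A\<in>D. c A * B S A (proj S i x)) = (\<Sum>A\<in>D. c A * ?b A x)"
      using B_proj_own[OF ind _ elim(2)] a by (intro sum.cong) auto
    then show ?case using elim(1) by simp
  qed
  \<comment> \<open>The functional respects equality almost everywhere. The zero function is written
    as an empty sum so that \<open>L2_functional_sum\<close> evaluates it.\<close>
  have "pdual i (a A) (\<lambda>x. \<Sum>A\<in>D. c A * ?b A x) = pdual i (a A) (\<lambda>x. \<Sum>A\<in>{}. c A * ?b A x)"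
  proof -
    have "(\<lambda>x. \<Sum>A\<in>D. c A * ?b A x) \<in> L2 (lebesgue_on (chart S i))" using fin L2 by (rule L2_sum)
    moreover have "(\<lambda>x. 0) \<in> L2 (lebesgue_on (chart S i))" by (rule L2_zero)
    moreover have "pdual i (a A) f = pdual i (a A) g"
      if "f \<in> L2 (lebesgue_on (chart S i))" "g \<in> L2 (lebesgue_on (chart S i))"
        "AE x in lebesgue_on (chart S i). f x = g x" for f g
      using dual that unfolding L2_functional_def by blast
    ultimately show ?thesis using ae unfolding sum.empty by blast
  qed
  also have "\<dots> = (\<Sum>A'\<in>{}. c A' * pdual i (a A) (?b A'))"
    by (rule L2_functional_sum[OF dual]) auto
  finally have "pdual i (a A) (\<lambda>x. \<Sum>A\<in>D. c A * ?b A x) = 0" by simp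
  then have "(\<Sum>A'\<in>D. c A' * pdual i (a A) (?b A')) = 0"
    using L2_functional_sum[OF dual fin L2, where c = c] by simp
  also have "(\<Sum>A'\<in>D. c A' * pdual i (a A) (?b A')) = (\<Sum>A'\<in>D. if A' = A then c A else 0)"
  proof (rule sum.cong[OF refl])
    fix A' assume A': "A' \<in> D"
    show "c A' * pdual i (a A) (?b A') = (if A' = A then c A else 0)"
      using dual'[of "a A'"] a[OF A'] ne[OF A'] by (cases "A' = A") simp_all
  qed
  finally show ?thesis using fin A by simp
qed

text \<open>A function of the chart that vanished on all elements would be a null combination with
  coefficient 1, against \<open>chart_functions_independent\<close> for the singleton
  \<open>{A}\<close>.\<close>

lemma chart_function_nonzero:
  assumes i: "i < num_charts S" and A: "A \<in> chart_indices S i"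
  obtains q x where "q \<in> mesh S i" "x \<in> q" "B S A (proj S i x) \<noteq> 0"
proof -
  have "\<exists>x\<in>\<Union>(mesh S i). B S A (proj S i x) \<noteq> 0"
  proof (rule ccontr)
    assume "\<not> ?thesis"
    then have "AE x in lebesgue_on (chart S i). (\<Sum>A\<in>{A}. 1 * B S A (proj S i x)) = 0"
      by (intro AE_chartI[OF i negligible_empty]) auto
    then show False using chart_functions_independent[OF i, of "{A}" "\<lambda>_. 1"] A by simp
  qed
  then show thesis using that by blast
qed

lemma open_nonzero:
  assumes "A \<in> indices S" "i < num_charts S" "q \<in> mesh S i"
  shows "open {x \<in> q. B S A (proj S i x) \<noteq> 0}"
proof -
  have "{x \<in> q. B S A (proj S i x) \<noteq> 0} = q \<inter> (\<lambda>x. B S A (proj S i x)) -` (- {0})" by auto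
  then show ?thesis
    using continuous_open_preimage[OF B_continuous[OF assms] mesh_open[OF assms(2,3)], of "- {0}"]
      open_Compl[OF closed_singleton] by metis
qed

text \<open>Both functions stay nonzero on an open part of \<open>q\<close> around \<open>x\<close>,
  whose image is open in the quotient and lies in both supports. Where one function of the chart is
  nonzero, only near indices contribute to a sum.\<close>

lemma nearI:
  assumes i: "i < num_charts S" and q: "q \<in> mesh S i" and x: "x \<in> q"
    and A: "A \<in> chart_indices S i" "B S A (proj S i x) \<noteq> 0"
    and A': "A' \<in> indices S" "B S A' (proj S i x) \<noteq> 0"
  shows "A' \<in> near_indices S i"
proof -
  have A0: "A \<in> indices S" using A(1) chart_indices_subset by blast
  let ?V = "{x \<in> q. B S A (proj S i x) \<noteq> 0} \<inter> {x \<in> q. B S A' (proj S i x) \<noteq> 0}"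
  have "open ?V" using open_nonzero[OF A0 i q] open_nonzero[OF A'(1) i q] by (rule open_Int)
  then have o: "openin (Omega_top S) (proj S i ` ?V)"
    using mesh_subset_chart[OF i q] by (intro openin_proj_image[OF i]) auto
  have "proj S i ` ?V \<subseteq> supp S (B S A)" by (rule subset_supp[OF o]) auto
  moreover have "proj S i ` ?V \<subseteq> supp S (B S A')" by (rule subset_supp[OF o]) auto
  moreover have "proj S i x \<in> proj S i ` ?V" using x A(2) A'(2) by blast
  ultimately have "supp S (B S A') \<inter> supp S (B S A) \<noteq> {}" by blast
  then show ?thesis using A(1) A'(1) unfolding near_indices_def by blast
qed

lemma chart_indices_near:
  assumes i: "i < num_charts S" and A: "A \<in> chart_indices S i"
  shows "A \<in> near_indices S i"
proof -
  obtain q x where "q \<in> mesh S i" "x \<in> q" "B S A (proj S i x) \<noteq> 0"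
    using chart_function_nonzero[OF i A] .
  then show ?thesis using nearI[OF i _ _ A _ _] A chart_indices_subset by blast
qed

end

section \<open>Vanishing of the coefficients, by the kind of index\<close>

context bspline_manifold
begin

lemma index_kind:
  assumes "A \<in> indices S" shows "A \<in> indices_s S \<union> indices_e S \<union> indices_v S"
proof -
  obtain j a where ja: "(j, a) \<in> A" using assms by (rule index_cases)
  then have "A \<in> chart_indices S j" using indexD[OF assms ja] assms by (auto simp: chart_indices_def)
  moreover have "j \<in> charts_of S Structured \<union> charts_of S Edge \<union> charts_of S Vertex"
    using indexD(1)[OF assms ja] by (cases "kind S j") (auto simp: charts_of_def)
  ultimately show ?thesis by (auto simp: indices_s_def indices_e_def indices_v_def)
qed

lemma structured_splines:
  assumes "i \<in> charts_of S Structured" "A \<in> near_indices S i"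
  shows "local_knots (spline_degree S) (knots S A i l)"
    "x \<in> chart S i \<Longrightarrow> B S A (proj S i x) = (\<Prod>l\<in>UNIV. bspline (spline_degree S) (knots S A i l) (x $ l))"
  using splines assms unfolding bspline_assumptions_def by blast+

lemma edge_splines:
  assumes "i \<in> charts_of S Edge" "A \<in> near_indices S i"
  shows "local_knots (spline_degree S) (knots S A i (coord S 3))"
    "x \<in> chart S i \<Longrightarrow> B S A (proj S i x) = planar_factor S A i (planar S x) *
       bspline (spline_degree S) (knots S A i (coord S 3)) (x $ coord S 3)"
  using splines assms unfolding bspline_assumptions_def by blast+

lemma planar_shift:
  assumes "CARD('d) = 3" shows "planar S (x + t *\<^sub>R axis (coord S 3) 1) = planar S x"
proof -
  have "inj_on (coord S) {1..3}" using charts assms by (simp add: admissible_charts_def bij_betw_def)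
  then have "coord S 1 \<noteq> coord S 3" "coord S 2 \<noteq> coord S 3"
    by (auto dest!: inj_onD)
  then show ?thesis by (simp add: planar_def axis_def)
qed

lemma vertex_charts_disjoint:
  assumes "i \<in> charts_of S Vertex" "j \<in> charts_of S Vertex" "j \<noteq> i"
  shows "tdom S i j = {}"
proof -
  have "vertex_chart_2d S i \<or> vertex_chart_3d S i" using charts assms(1) unfolding admissible_charts_def by blast
  then show ?thesis
    using assms(2,3) unfolding vertex_chart_2d_def vertex_chart_3d_def charts_of_def by fastforce
qed

lemma structured_coefficient_zero:
  assumes zero: "\<forall>i<num_charts S. \<forall>q\<in>mesh S i. \<forall>x\<in>q.
      (\<Sum>A\<in>indices S. c A * B S A (proj S i x)) = 0"
    and A: "A \<in> indices_s S"
  shows "c A = 0"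
proof -
  obtain i where i: "i \<in> charts_of S Structured" and Ai: "A \<in> chart_indices S i"
    using A by (auto simp: indices_s_def)
  let ?p = "spline_degree S" and ?N = "near_indices S i"
  have in': "i < num_charts S" using i by (simp add: charts_of_def)
  have An: "A \<in> ?N" using chart_indices_near[OF in' Ai] .
  have A0: "A \<in> indices S" using Ai chart_indices_subset by blast
  have finN: "finite ?N" using near_indices_subset finite_indices finite_subset by blast
  obtain q x0 where q: "q \<in> mesh S i" and x0: "x0 \<in> q" "B S A (proj S i x0) \<noteq> 0"
    using chart_function_nonzero[OF in' Ai] .
  let ?V = "{x \<in> q. B S A (proj S i x) \<noteq> 0}"
  have V: "open ?V" using open_nonzero[OF A0 in' q] .
  define K where "K l = (\<Union>A'\<in>?N. set (knots S A' i l))" for l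
  have finK: "finite (K l)" for l unfolding K_def using finN by auto
  \<comment> \<open>The knot hyperplanes of the finitely many near indices form a null set, so the
    open set \<open>?V\<close> has a point off all of them and a whole box around it whose sides are
    free of knots.\<close>
  have "negligible (\<Union>l. {x::real^'d. x $ l \<in> K l})"
    using negligible_coordinate_in_finite[OF finK] by (intro negligible_Union) auto
  then have "\<not> ?V \<subseteq> (\<Union>l. {x. x $ l \<in> K l})"
    using open_not_negligible[OF V] x0 negligible_subset by blast
  then obtain y where y: "y \<in> ?V" "\<And>l. y $ l \<notin> K l" by blast
  have "open (?V \<inter> (\<Inter>l. {x. x $ l \<notin> K l}))"
  proof (intro open_Int V open_INT ballI)
    fix l
    have "open ((\<lambda>x::real^'d. x $ l) -` (- K l))"
      using finK by (intro open_vimage continuous_intros) (auto intro: finite_imp_closed)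
    then show "open {x::real^'d. x $ l \<notin> K l}" by (simp add: vimage_def)
  qed auto
  moreover have "y \<in> ?V \<inter> (\<Inter>l. {x. x $ l \<notin> K l})" using y by blast
  ultimately obtain s e where se: "box s e \<subseteq> ?V \<inter> (\<Inter>l. {x. x $ l \<notin> K l})" "y \<in> box s e"
    by (rule open_contains_box)
  have yse: "y $ l \<in> {s $ l<..<e $ l}" for l using se(2) by (simp add: mem_box_cart)
  have free: "K l \<inter> {s $ l<..<e $ l} = {}" for l
  proof (rule ccontr)
    assume "K l \<inter> {s $ l<..<e $ l} \<noteq> {}"
    then obtain t where t: "t \<in> K l" "t \<in> {s $ l<..<e $ l}" by blast
    have "(\<chi> m. if m = l then t else y $ m) \<in> box s e"
      using t(2) yse by (auto simp: mem_box_cart)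
    then have "(\<chi> m. if m = l then t else y $ m) $ l \<notin> K l" using se(1) by blast
    then show False using t(1) by simp
  qed
  have sub: "box s e \<subseteq> q" "box s e \<subseteq> chart S i"
    using se(1) mesh_subset_chart[OF in' q] by blast+
  \<comment> \<open>These are the knot vectors that a functional in direction \<open>l\<close> can
    annihilate. By dual-compatibility every other near index has its knot vector in
    \<open>?Y l\<close> for at least one \<open>l\<close>.\<close>
  let ?Y = "\<lambda>l. {knots S A' i l | A'. A' \<in> ?N \<and> knots S A i l \<noteq> knots S A' i l \<and>
      overlap ?p (knots S A i l) (knots S A' i l)}"
  define dual where "dual l P w \<longleftrightarrow> finite P \<and> P \<subseteq> {s $ l<..<e $ l} \<and>
      (\<Sum>t\<in>P. w t * bspline ?p (knots S A i l) t) = 1 \<and>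
      (\<forall>k\<in>?Y l. (\<Sum>t\<in>P. w t * bspline ?p k t) = 0)" for l P w
  have "\<exists>P w. dual l P w" for l
  proof -
    have "B S A (proj S i y) \<noteq> 0" "y \<in> chart S i" using y(1) se(2) sub by auto
    then have "(\<Prod>l\<in>UNIV. bspline ?p (knots S A i l) (y $ l)) \<noteq> 0"
      using structured_splines(2)[OF i An] by simp
    then have "bspline ?p (knots S A i l) (y $ l) \<noteq> 0" by simp
    moreover have "finite (?Y l)" using finN by simp
    moreover have "set (knots S A' i l) \<inter> {s $ l<..<e $ l} = {}" if "A' \<in> ?N" for A'
      using free[of l] that unfolding K_def by blast
    ultimately show ?thesis
      unfolding dual_def using An structured_splines(1)[OF i] yse by (intro bspline_point_dual) auto
  qed
  then obtain P w where "\<And>l. dual l (P l) (w l)" by metis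
  then have P: "\<And>l. finite (P l)" "\<And>l. P l \<subseteq> {s $ l<..<e $ l}"
    "\<And>l. (\<Sum>t\<in>P l. w l t * bspline ?p (knots S A i l) t) = 1"
    "\<And>l k. k \<in> ?Y l \<Longrightarrow> (\<Sum>t\<in>P l. w l t * bspline ?p k t) = 0"
    unfolding dual_def by blast+
  show ?thesis
  proof (rule tensor_dual[where g = "\<lambda>A' l. bspline ?p (knots S A' i l)", OF finN An P(1,3)])
    fix A' assume A': "A' \<in> ?N" "A' \<noteq> A"
    then obtain l where "knots S A i l \<noteq> knots S A' i l" "overlap ?p (knots S A i l) (knots S A' i l)"
      using conjunct1[OF compatible[unfolded dual_compatible_def], rule_format, OF i Ai] by blast
    then have "knots S A' i l \<in> ?Y l" using A' by blast
    then show "\<exists>l. (\<Sum>t\<in>P l. w l t * bspline ?p (knots S A' i l) t) = 0" using P(4) by blast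
  next
    fix x :: "real^'d" assume x: "\<And>l. x $ l \<in> P l"
    \<comment> \<open>The univariate nodes lie in the sides of the box, so the grid points lie in
      \<open>?V\<close>, where the given function is nonzero and \<open>nearI\<close>
      applies.\<close>
    have "x \<in> box s e" using x P(2) unfolding mem_box_cart by (metis greaterThanLessThan_iff subsetD)
    then have xq: "x \<in> q" "x \<in> chart S i" "B S A (proj S i x) \<noteq> 0" using sub se(1) by blast+
    have "0 = (\<Sum>A\<in>indices S. c A * B S A (proj S i x))" using zero[rule_format, OF in' q xq(1)] by simp
    also have "\<dots> = (\<Sum>A\<in>?N. c A * B S A (proj S i x))"
      using nearI[OF in' q xq(1) Ai xq(3)] near_indices_subset finite_indices
      by (intro sum.mono_neutral_right) auto
    also have "\<dots> = (\<Sum>A\<in>?N. c A * (\<Prod>l\<in>UNIV. bspline ?p (knots S A i l) (x $ l)))"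
      using structured_splines(2)[OF i _ xq(2)] by (intro sum.cong) auto
    finally show "(\<Sum>A\<in>?N. c A * (\<Prod>l\<in>UNIV. bspline ?p (knots S A i l) (x $ l))) = 0" by simp
  qed
qed

lemma edge_coefficient_zero:
  assumes zero: "\<forall>i<num_charts S. \<forall>q\<in>mesh S i. \<forall>x\<in>q.
      (\<Sum>A\<in>indices S. c A * B S A (proj S i x)) = 0"
    and A: "A \<in> indices_e S"
  shows "c A = 0"
proof -
  obtain i where i: "i \<in> charts_of S Edge" and Ai: "A \<in> chart_indices S i"
    using A by (auto simp: indices_e_def)
  let ?p = "spline_degree S" and ?N = "near_indices S i" and ?m = "coord S 3"
  \<comment> \<open>Once the structured coefficients are gone, \<open>?X\<close> and
    \<open>?Y\<close> are the near indices that remain: those of this edge chart and those from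
    outside it. Their splines along the edge are the two families for
    \<open>bspline_sums_independent\<close>.\<close>
  let ?X = "chart_indices S i \<inter> indices_e S"
  let ?Y = "(near_indices S i - chart_indices S i) \<inter> (indices_e S \<union> indices_v S)"
  have in': "i < num_charts S" using i by (simp add: charts_of_def)
  have card: "CARD('d) = 3" using charts i unfolding admissible_charts_def by blast
  have XN: "?X \<subseteq> ?N" using chart_indices_near[OF in'] by blast
  have finN: "finite ?N" using near_indices_subset finite_indices finite_subset by blast
  define K where "K = (\<Union>A'\<in>?N. set (knots S A' i ?m))"
  have finK: "finite K" unfolding K_def using finN by auto
  have "(\<Sum>A\<in>?X. c A * B S A (proj S i x)) = 0" if x: "x \<in> \<Union>(mesh S i)" "x $ ?m \<notin> K" for x
  proof (cases "\<forall>A\<in>?X. B S A (proj S i x) = 0")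
    case False
    then obtain A0 where A0: "A0 \<in> ?X" "B S A0 (proj S i x) \<noteq> 0" by blast
    obtain q where q: "q \<in> mesh S i" "x \<in> q" using x(1) by blast
    have A0i: "A0 \<in> chart_indices S i" "A0 \<in> indices S" using A0 chart_indices_subset by blast+
    \<comment> \<open>\<open>?z t\<close> moves \<open>x\<close> along the edge to third coordinate
      \<open>t\<close>. The planar coordinates stay fixed, so the planar factor is a constant along
      this line and is absorbed into the coefficients \<open>?c\<close>.\<close>
    let ?z = "\<lambda>t. x + (t - x $ ?m) *\<^sub>R axis ?m (1::real)"
    let ?V = "{x \<in> q. B S A0 (proj S i x) \<noteq> 0}"
    have z: "?z t $ ?m = t" for t by (simp add: axis_def)
    have "open (?z -` ?V \<inter> - K)"
      using open_nonzero[OF A0i(2) in' q(1)] finK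
      by (intro open_Int open_vimage continuous_intros) (auto intro: finite_imp_closed)
    moreover have "x $ ?m \<in> ?z -` ?V \<inter> - K" using x(2) q(2) A0(2) by simp
    ultimately obtain r where r: "0 < r" "ball (x $ ?m) r \<subseteq> ?z -` ?V \<inter> - K"
      by (rule openE)
    define s e where "s = x $ ?m - r" and "e = x $ ?m + r"
    have se: "x $ ?m \<in> {s<..<e}" "{s<..<e} \<subseteq> ?z -` ?V \<inter> - K"
      using r by (simp_all add: s_def e_def ball_eq_greaterThanLessThan)
    have chart: "?z t \<in> chart S i" if "t \<in> {s<..<e}" for t
      using se(2) that mesh_subset_chart[OF in' q(1)] by blast
    have val: "B S A (proj S i (?z t)) = planar_factor S A i (planar S x) * bspline ?p (knots S A i ?m) t"
      if "t \<in> {s<..<e}" "A \<in> ?N" for t A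
      using edge_splines(2)[OF i that(2) chart[OF that(1)]] planar_shift[OF card] z by simp
    let ?c = "\<lambda>A. c A * planar_factor S A i (planar S x)"
    have "(\<Sum>A\<in>?X. ?c A * bspline ?p (knots S A i ?m) (x $ ?m)) = 0"
    proof (rule bspline_sums_independent[where J = ?Y and s = s and e = e])
      fix t assume t: "t \<in> {s<..<e}"
      then have zq: "?z t \<in> q" "B S A0 (proj S i (?z t)) \<noteq> 0" using se(2) by blast+
      \<comment> \<open>A structured index has coefficient 0 already. Any other index outside
        \<open>?X\<close> and \<open>?Y\<close> is not near, because a non-structured index of an
        edge chart is an edge index; by \<open>nearI\<close> with \<open>A0\<close> it vanishes at
        this point.\<close>
      have "c A * B S A (proj S i (?z t)) = 0" if "A \<in> indices S - (?X \<union> ?Y)" for A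
      proof (cases "A \<in> indices_s S")
        case True
        then show ?thesis using structured_coefficient_zero[OF zero] by simp
      next
        case False
        then have "A \<notin> ?N"
          using that index_kind[of A] i unfolding indices_e_def by blast
        then show ?thesis using nearI[OF in' q(1) zq(1) A0i(1) zq(2)] that by auto
      qed
      then have "(\<Sum>A\<in>?X \<union> ?Y. c A * B S A (proj S i (?z t))) = (\<Sum>A\<in>indices S. c A * B S A (proj S i (?z t)))"
        using XN near_indices_subset[of i] by (intro sum.mono_neutral_left finite_indices) auto
      also have "\<dots> = 0" using zero[rule_format, OF in' q(1) zq(1)] .
      also have "(\<Sum>A\<in>?X \<union> ?Y. c A * B S A (proj S i (?z t))) = (\<Sum>A\<in>?X \<union> ?Y. ?c A * bspline ?p (knots S A i ?m) t)"
        using val[OF t] XN by (intro sum.cong) auto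
      finally show "(\<Sum>A\<in>?X \<union> ?Y. ?c A * bspline ?p (knots S A i ?m) t) = 0" .
    next
      show "finite ?X" "finite ?Y" using finN XN finite_subset by blast+
      show "local_knots ?p (knots S A i ?m)" if "A \<in> ?X \<union> ?Y" for A
        using edge_splines(1)[OF i] XN that by blast
      show "set (knots S A i ?m) \<inter> {s<..<e} = {}" if "A \<in> ?X \<union> ?Y" for A
        using se(2) XN that unfolding K_def by blast
      show "knots S A i ?m \<noteq> knots S A' i ?m \<and> overlap ?p (knots S A i ?m) (knots S A' i ?m)"
        if "A \<in> ?X" "A' \<in> ?Y" for A A'
        using conjunct2[OF conjunct2[OF compatible[unfolded dual_compatible_def]], rule_format, OF i that]
        by blast
    qed (use se(1) in auto)
    moreover have "B S A (proj S i x) = planar_factor S A i (planar S x) * bspline ?p (knots S A i ?m) (x $ ?m)"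
      if "A \<in> ?X" for A
      using val[OF se(1), of A] XN that by auto
    ultimately show ?thesis by (simp add: mult.assoc)
  qed simp
  \<comment> \<open>The excluded points, with a knot as third coordinate, form a null set. The
    partial sum over functions of the single chart \<open>i\<close> is now within reach of its
    proto-dual functionals.\<close>
  then have "AE x in lebesgue_on (chart S i). (\<Sum>A\<in>?X. c A * B S A (proj S i x)) = 0"
    by (intro AE_chartI[OF in' negligible_coordinate_in_finite[OF finK, of ?m]]) auto
  then show ?thesis
    using chart_functions_independent[OF in', of ?X c A] A Ai by blast
qed

lemma coefficient_zero:
  assumes zero: "\<forall>i<num_charts S. \<forall>q\<in>mesh S i. \<forall>x\<in>q.
      (\<Sum>A\<in>indices S. c A * B S A (proj S i x)) = 0"
    and A: "A \<in> indices S"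
  shows "c A = 0"
proof -
  have se: "c A = 0" if "A \<in> indices_s S \<union> indices_e S" for A
    using structured_coefficient_zero[OF zero] edge_coefficient_zero[OF zero] that by blast
  show ?thesis
  proof (cases "A \<in> indices_s S \<union> indices_e S")
    case False
    then have Av: "A \<in> indices_v S" using index_kind[OF A] by blast
    then obtain i where i: "i \<in> charts_of S Vertex" and Ai: "A \<in> chart_indices S i"
      by (auto simp: indices_v_def)
    let ?D = "chart_indices S i \<inter> indices_v S"
    have in': "i < num_charts S" using i by (simp add: charts_of_def)
    have "(\<Sum>A\<in>?D. c A * B S A (proj S i x)) = 0" if x: "x \<in> \<Union>(mesh S i)" for x
    proof -
      have xc: "x \<in> chart S i" using x mesh_subset_chart[OF in'] by blast
      have "c A * B S A (proj S i x) = 0" if AD: "A \<in> indices S - ?D" for A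
      proof (cases "A \<in> indices_s S \<union> indices_e S")
        case False
        then have Av: "A \<in> indices_v S" using index_kind AD by blast
        then obtain j where j: "j \<in> charts_of S Vertex" "A \<in> chart_indices S j"
          by (auto simp: indices_v_def)
        \<comment> \<open>A vertex function outside \<open>?D\<close> belongs to a different vertex
          chart; its transition domain in chart \<open>i\<close> is empty, so the function vanishes
          on chart \<open>i\<close>.\<close>
        have "j \<noteq> i" using AD Av j(2) by blast
        obtain a where a: "(j, a) \<in> A" "A \<in> indices S" using j(2) by (auto simp: chart_indices_def)
        have "j < num_charts S" using j(1) by (simp add: charts_of_def)
        then have "B S A (proj S i x) = 0"
          using basis_fun_proj[OF in' _ xc, of j a] vertex_charts_disjoint[OF i j(1) \<open>j \<noteq> i\<close>] indexD(3)[OF a(2,1)]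
          by simp
        then show ?thesis by simp
      qed (use se in simp)
      then have "(\<Sum>A\<in>?D. c A * B S A (proj S i x)) = (\<Sum>A\<in>indices S. c A * B S A (proj S i x))"
        using chart_indices_subset[of i] by (intro sum.mono_neutral_left finite_indices) auto
      also have "\<dots> = 0" using x zero in' by blast
      finally show ?thesis .
    qed
    then have "AE x in lebesgue_on (chart S i). (\<Sum>A\<in>?D. c A * B S A (proj S i x)) = 0"
      by (intro AE_chartI[OF in' negligible_empty]) auto
    then show ?thesis
      using chart_functions_independent[OF in', of ?D c A] Av Ai by blast
  qed (use se in blast)
qed

lemma basis_independent:
  assumes "AE P in volume S. (\<Sum>A\<in>indices S. c A * B S A P) = 0"
  shows "\<forall>A\<in>indices S. c A = 0"
proof -
  have "(\<Sum>A\<in>indices S. c A * B S A (proj S i x)) = 0"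
    if "i < num_charts S" "q \<in> mesh S i" "x \<in> q" for i q x
    by (rule AE_volume_eq_0D[OF that _ assms])
      (intro continuous_on_sum continuous_on_mult_left B_continuous that(1,2))
  then show ?thesis using coefficient_zero[of c] by blast
qed

end

theorem theorem1:
  fixes S :: "('d::finite, 'a) spline_manifold"
    and pdual :: "nat \<Rightarrow> 'a \<Rightarrow> (real^'d \<Rightarrow> real) \<Rightarrow> real"
  assumes "CARD('d) \<in> {1, 2, 3}"
    and "is_proto_manifold S"
    and "is_proto_mesh S"
    and "admissible_charts S"
    and "is_metric S"
    and "is_volume S"
    and "is_proto_basis S"
    and "bspline_assumptions S"
    and "is_proto_dual S pdual"
    and "dual_compatible S"
  shows "\<exists>\<Lambda> :: (nat \<times> 'a) set \<Rightarrow> ((nat \<times> (real^'d)) set \<Rightarrow> real) \<Rightarrow> real.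
    (\<forall>A\<in>indices S. L2_functional (volume S) (\<Lambda> A)) \<and>
    (\<forall>A\<in>indices S. \<forall>A'\<in>indices S.
       B S A' \<in> L2 (volume S) \<and> \<Lambda> A (B S A') = (if A = A' then 1 else 0))"
proof -
  interpret bspline_manifold S pdual
    using assms by unfold_locales
  show ?thesis
    using L2_dual_family[where f = "B S", OF finite_indices B_L2 basis_independent] B_L2 by blast
qed

end
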